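(* Let $n\ge3$ and let $(W,S)$ be the affine Weyl group of type $\tilde A_{n-1}$. The integral deformed affine realization $\Lambda_\zeta$ over $\mathbb{Z}[\zeta,\zeta^{-1}]$ is a reflection faithful representation of $(W,S)$. Moreover, let $A$ be any $\mathbb{Z}[\zeta,\zeta^{-1}]$-algebra that is an integral domain and in which the unit $\zeta$ has infinite order. Then $\Lambda_A=\Lambda_\zeta\otimes_{\mathbb{Z}[\zeta,\zeta^{-1}]}A$ is reflection faithful (over $A$) as well.
   Context: $\zeta$ is a formal variable, $\Omega=\mathbb{Z}/n\mathbb{Z}$, $S=\{s_i\}_{i\in\Omega}$. $\Lambda_\zeta$ is the free $\mathbb{Z}[\zeta,\zeta^{-1}]$-module with basis $\{x_i\}_{i\in\Omega}$, with $W$-action $s_i(x_i)=\zeta x_{i+1}$, $s_i(x_{i+1})=\zeta^{-1}x_i$, $s_i(x_j)=x_j$ for $j\notin\{i,i+1\}$. A representation $V$ of a Coxeter system $(W,S)$ over an integral domain $A$ is reflection faithful if: (a) $V$ is faithful; (b) $V^w$ is free of finite rank over $A$ for all $w\in W$; (c) $V/V^w$ is free of finite rank over $A$ for all $w\in W$; (d) $\mathrm{rk}_A(V/V^w)=1$ if and only if $w$ is a reflection in $W$ (a conjugate of a simple reflection). *)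

theory Defs
  imports "HOL-Algebra.Algebra" "HOL-Algebra.Algebraic_Closure_Type" "HOL-Library.Poly_Mapping"
begin

section \<open>Coxeter systems\<close>

text \<open>
  A Coxeter matrix \<open>m\<close> on \<open>I\<close> presents the group with generators \<open>I\<close> and relations
  \<open>(i j)^(m i j) = 1\<close>. An infinite label is encoded as \<open>0\<close>, for which \<open>relator\<close> is vacuous.
  Since \<open>m i i = 1\<close>, every generator is its own inverse, so words in \<open>I\<close>
  (without formal inverses) modulo the congruence below are the presented group.
\<close>

definition coxeter_matrix :: "'i set \<Rightarrow> ('i \<Rightarrow> 'i \<Rightarrow> nat) \<Rightarrow> bool" where
  "coxeter_matrix I m \<longleftrightarrow>
     (\<forall>i\<in>I. m i i = 1) \<and>
     (\<forall>i\<in>I. \<forall>j\<in>I. m i j = m j i \<and> (i \<noteq> j \<longrightarrow> m i j \<noteq> 1))"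

inductive coxeter_equiv :: "'i set \<Rightarrow> ('i \<Rightarrow> 'i \<Rightarrow> nat) \<Rightarrow> 'i list \<Rightarrow> 'i list \<Rightarrow> bool"
  for I m where
  refl: "coxeter_equiv I m u u"
| sym: "coxeter_equiv I m u v \<Longrightarrow> coxeter_equiv I m v u"
| trans: "coxeter_equiv I m u v \<Longrightarrow> coxeter_equiv I m v w \<Longrightarrow> coxeter_equiv I m u w"
| relator: "i \<in> I \<Longrightarrow> j \<in> I \<Longrightarrow> u \<in> lists I \<Longrightarrow> v \<in> lists I \<Longrightarrow>
    coxeter_equiv I m (u @ concat (replicate (m i j) [i, j]) @ v) (u @ v)"

definition word_value :: "('g, 'x) monoid_scheme \<Rightarrow> ('i \<Rightarrow> 'g) \<Rightarrow> 'i list \<Rightarrow> 'g" where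
  "word_value W s u = foldr (\<lambda>i g. s i \<otimes>\<^bsub>W\<^esub> g) u \<one>\<^bsub>W\<^esub>"

definition coxeter_system ::
  "('g, 'x) monoid_scheme \<Rightarrow> 'i set \<Rightarrow> ('i \<Rightarrow> 'i \<Rightarrow> nat) \<Rightarrow> ('i \<Rightarrow> 'g) \<Rightarrow> bool" where
  "coxeter_system W I m s \<longleftrightarrow>
     group W \<and> coxeter_matrix I m \<and> s \<in> I \<rightarrow> carrier W \<and>
     word_value W s ` lists I = carrier W \<and>
     (\<forall>u\<in>lists I. \<forall>v\<in>lists I. word_value W s u = word_value W s v \<longleftrightarrow> coxeter_equiv I m u v)"

definition reflections :: "('g, 'x) monoid_scheme \<Rightarrow> 'g set \<Rightarrow> 'g set" where
  "reflections W S = {g \<otimes>\<^bsub>W\<^esub> t \<otimes>\<^bsub>W\<^esub> inv\<^bsub>W\<^esub> g | g t. g \<in> carrier W \<and> t \<in> S}"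

text \<open>For affine type A with \<open>n \<ge> 3\<close> generators the Coxeter graph is the cycle on \<open>\<int>/n\<int>\<close>,
  which is represented by \<open>{0..<n}\<close>.\<close>

definition Omega :: "nat \<Rightarrow> int set" where
  "Omega n = carrier (integer_mod_group n)"

definition succ_mod :: "nat \<Rightarrow> int \<Rightarrow> int" where
  "succ_mod n i = i \<otimes>\<^bsub>integer_mod_group n\<^esub> 1"

definition affine_A_matrix :: "nat \<Rightarrow> int \<Rightarrow> int \<Rightarrow> nat" where
  "affine_A_matrix n i j =
     (if i = j then 1 else if j = succ_mod n i \<or> i = succ_mod n j then 3 else 2)"


section \<open>Free modules, quotients and reflection faithful representations\<close>

text \<open>
  The HOL-Algebra record for modules extends that of rings; its fields \<open>mult\<close> and \<open>one\<close>
  play no role for modules and are left \<open>undefined\<close> below.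
\<close>

definition is_basis :: "('a, 'b) ring_scheme \<Rightarrow> ('a, 'm, 'c) module_scheme \<Rightarrow> 'm set \<Rightarrow> bool" where
  "is_basis R M B \<longleftrightarrow>
     finite B \<and> B \<subseteq> carrier M \<and>
     (\<forall>x\<in>carrier M. \<exists>!c. c \<in> B \<rightarrow>\<^sub>E carrier R \<and> x = (\<Oplus>\<^bsub>M\<^esub>b\<in>B. c b \<odot>\<^bsub>M\<^esub> b))"

definition free_of_rank :: "('a, 'b) ring_scheme \<Rightarrow> ('a, 'm, 'c) module_scheme \<Rightarrow> nat \<Rightarrow> bool" where
  "free_of_rank R M k \<longleftrightarrow> module R M \<and> (\<exists>B. is_basis R M B \<and> card B = k)"

definition free_of_finite_rank :: "('a, 'b) ring_scheme \<Rightarrow> ('a, 'm, 'c) module_scheme \<Rightarrow> bool" where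
  "free_of_finite_rank R M \<longleftrightarrow> (\<exists>k. free_of_rank R M k)"

text \<open>Scaling a coset by \<open>0\<close> elementwise gives \<open>{0}\<close>, hence the sum with \<open>N\<close> in \<open>smult\<close>.\<close>

definition quotient_module ::
  "('a, 'm, 'c) module_scheme \<Rightarrow> 'm set \<Rightarrow> ('a, 'm set) module" where
  "quotient_module M N =
     \<lparr>carrier = a_rcosets\<^bsub>M\<^esub> N, monoid.mult = undefined, monoid.one = undefined,
      ring.zero = N, add = set_add M,
      module.smult = (\<lambda>a C. N <+>\<^bsub>M\<^esub> ((\<lambda>x. a \<odot>\<^bsub>M\<^esub> x) ` C))\<rparr>"

definition linear_representation ::
  "('g, 'x) monoid_scheme \<Rightarrow> ('a, 'b) ring_scheme \<Rightarrow> ('a, 'm, 'c) module_scheme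
     \<Rightarrow> ('g \<Rightarrow> 'm \<Rightarrow> 'm) \<Rightarrow> bool" where
  "linear_representation W A V \<rho> \<longleftrightarrow>
     module A V \<and> group_action W (carrier V) \<rho> \<and>
     (\<forall>w\<in>carrier W. \<forall>x\<in>carrier V. \<forall>y\<in>carrier V. \<rho> w (x \<oplus>\<^bsub>V\<^esub> y) = \<rho> w x \<oplus>\<^bsub>V\<^esub> \<rho> w y) \<and>
     (\<forall>w\<in>carrier W. \<forall>a\<in>carrier A. \<forall>x\<in>carrier V. \<rho> w (a \<odot>\<^bsub>V\<^esub> x) = a \<odot>\<^bsub>V\<^esub> \<rho> w x)"

definition fixed_submodule ::
  "('a, 'm, 'c) module_scheme \<Rightarrow> ('g \<Rightarrow> 'm \<Rightarrow> 'm) \<Rightarrow> 'g \<Rightarrow> ('a, 'm, 'c) module_scheme" where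
  "fixed_submodule V \<rho> w = V\<lparr>carrier := invariants (carrier V) \<rho> w\<rparr>"

text \<open>
  Over an integral domain the rank of a free module is unique, so \<open>free_of_rank A M 1\<close>
  says that the free module \<open>M\<close> has rank 1.
\<close>

definition reflection_faithful ::
  "('g, 'x) monoid_scheme \<Rightarrow> 'g set \<Rightarrow> ('a, 'b) ring_scheme \<Rightarrow> ('a, 'm, 'c) module_scheme
     \<Rightarrow> ('g \<Rightarrow> 'm \<Rightarrow> 'm) \<Rightarrow> bool" where
  "reflection_faithful W S A V \<rho> \<longleftrightarrow>
     domain A \<and> linear_representation W A V \<rho> \<and>
     faithful_action W (carrier V) \<rho> \<and>
     (\<forall>w\<in>carrier W. free_of_finite_rank A (fixed_submodule V \<rho> w)) \<and>
     (\<forall>w\<in>carrier W. free_of_finite_rank A (quotient_module V (invariants (carrier V) \<rho> w))) \<and>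
     (\<forall>w\<in>carrier W. free_of_rank A (quotient_module V (invariants (carrier V) \<rho> w)) 1
        \<longleftrightarrow> w \<in> reflections W S)"


section \<open>Extension of scalars\<close>

text \<open>
  For an \<open>R\<close>-module \<open>M\<close> and an \<open>R\<close>-algebra \<open>A\<close>, the tensor product over \<open>R\<close> is the free
  abelian group on pairs \<open>(x, a)\<close>, where \<open>frag_of (x, a)\<close> stands for the pure tensor of \<open>x\<close>
  and \<open>a\<close>, modulo the biadditivity and balancing relations. \<open>A\<close> acts on the second factor,
  and an endomorphism of \<open>M\<close> acts on the first.
\<close>

definition tensor_free ::
  "('r, 'm, 'c) module_scheme \<Rightarrow> ('r, 'a, 'd) module_scheme \<Rightarrow> ('m \<times> 'a \<Rightarrow>\<^sub>0 int) monoid" where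
  "tensor_free M A = free_Abelian_group (carrier M \<times> carrier A)"

definition tensor_relations ::
  "('r, 'b) ring_scheme \<Rightarrow> ('r, 'm, 'c) module_scheme \<Rightarrow> ('r, 'a, 'd) module_scheme
     \<Rightarrow> ('m \<times> 'a \<Rightarrow>\<^sub>0 int) set" where
  "tensor_relations R M A =
     {frag_of (x \<oplus>\<^bsub>M\<^esub> y, a) - frag_of (x, a) - frag_of (y, a) | x y a.
        x \<in> carrier M \<and> y \<in> carrier M \<and> a \<in> carrier A} \<union>
     {frag_of (x, a \<oplus>\<^bsub>A\<^esub> b) - frag_of (x, a) - frag_of (x, b) | x a b.
        x \<in> carrier M \<and> a \<in> carrier A \<and> b \<in> carrier A} \<union>
     {frag_of (r \<odot>\<^bsub>M\<^esub> x, a) - frag_of (x, r \<odot>\<^bsub>A\<^esub> a) | r x a.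
        r \<in> carrier R \<and> x \<in> carrier M \<and> a \<in> carrier A}"

definition tensor_kernel ::
  "('r, 'b) ring_scheme \<Rightarrow> ('r, 'm, 'c) module_scheme \<Rightarrow> ('r, 'a, 'd) module_scheme
     \<Rightarrow> ('m \<times> 'a \<Rightarrow>\<^sub>0 int) set" where
  "tensor_kernel R M A = generate (tensor_free M A) (tensor_relations R M A)"

definition base_change ::
  "('r, 'b) ring_scheme \<Rightarrow> ('r, 'm, 'c) module_scheme \<Rightarrow> ('r, 'a, 'd) module_scheme
     \<Rightarrow> ('a, ('m \<times> 'a \<Rightarrow>\<^sub>0 int) set) module" where
  "base_change R M A =
     \<lparr>carrier = carrier (tensor_free M A Mod tensor_kernel R M A),
      monoid.mult = undefined, monoid.one = undefined,
      ring.zero = \<one>\<^bsub>tensor_free M A Mod tensor_kernel R M A\<^esub>,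
      add = (\<lambda>C D. C \<otimes>\<^bsub>tensor_free M A Mod tensor_kernel R M A\<^esub> D),
      module.smult = (\<lambda>a C. tensor_kernel R M A <#>\<^bsub>tensor_free M A\<^esub>
        (frag_extend (\<lambda>(x, b). frag_of (x, a \<otimes>\<^bsub>A\<^esub> b)) ` C))\<rparr>"

definition base_change_action ::
  "('r, 'b) ring_scheme \<Rightarrow> ('r, 'm, 'c) module_scheme \<Rightarrow> ('r, 'a, 'd) module_scheme
     \<Rightarrow> ('g \<Rightarrow> 'm \<Rightarrow> 'm) \<Rightarrow> 'g \<Rightarrow> ('m \<times> 'a \<Rightarrow>\<^sub>0 int) set \<Rightarrow> ('m \<times> 'a \<Rightarrow>\<^sub>0 int) set" where
  "base_change_action R M A \<rho> w =
     (\<lambda>C\<in>carrier (base_change R M A). tensor_kernel R M A <#>\<^bsub>tensor_free M A\<^esub>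
        (frag_extend (\<lambda>(x, b). frag_of (\<rho> w x, b)) ` C))"


section \<open>The integral deformed affine realization\<close>

text \<open>
  \<open>\<int>[\<zeta>, \<zeta>\<^sup>-\<^sup>1]\<close> is the group ring of \<open>\<int>\<close> over \<open>\<int>\<close>: finitely supported functions from exponents
  to coefficients, with convolution as product.
\<close>

type_synonym laurent = "int \<Rightarrow>\<^sub>0 int"

definition laurent_ring :: "laurent ring" where
  "laurent_ring = ring_of_type_algebra"

definition zeta :: laurent where
  "zeta = Poly_Mapping.single 1 1"

definition zeta_inv :: laurent where
  "zeta_inv = Poly_Mapping.single (- 1) 1"

text \<open>The index set \<open>I\<close> is meant to be finite: all functions are allowed as coordinates.\<close>

definition free_module :: "('a, 'b) ring_scheme \<Rightarrow> 'i set \<Rightarrow> ('a, 'i \<Rightarrow> 'a) module" where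
  "free_module R I =
     \<lparr>carrier = I \<rightarrow>\<^sub>E carrier R, monoid.mult = undefined, monoid.one = undefined,
      ring.zero = (\<lambda>i\<in>I. \<zero>\<^bsub>R\<^esub>), add = (\<lambda>u v. \<lambda>i\<in>I. u i \<oplus>\<^bsub>R\<^esub> v i),
      module.smult = (\<lambda>a v. \<lambda>i\<in>I. a \<otimes>\<^bsub>R\<^esub> v i)\<rparr>"

definition Lambda :: "nat \<Rightarrow> (laurent, int \<Rightarrow> laurent) module" where
  "Lambda n = free_module laurent_ring (Omega n)"

definition x_basis :: "nat \<Rightarrow> int \<Rightarrow> int \<Rightarrow> laurent" where
  "x_basis n i = (\<lambda>j\<in>Omega n. if j = i then \<one>\<^bsub>laurent_ring\<^esub> else \<zero>\<^bsub>laurent_ring\<^esub>)"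

text \<open>
  The formulas on generators and basis vectors determine the action; extensionality
  in the group element only removes the irrelevant values outside \<open>carrier W\<close>.
\<close>

definition Lambda_action ::
  "('g, 'x) monoid_scheme \<Rightarrow> nat \<Rightarrow> (int \<Rightarrow> 'g) \<Rightarrow> 'g \<Rightarrow> (int \<Rightarrow> laurent) \<Rightarrow> int \<Rightarrow> laurent" where
  "Lambda_action W n s = (THE \<rho>.
     linear_representation W laurent_ring (Lambda n) \<rho> \<and> \<rho> \<in> extensional (carrier W) \<and>
     (\<forall>i\<in>Omega n.
        \<rho> (s i) (x_basis n i) = zeta \<odot>\<^bsub>Lambda n\<^esub> x_basis n (succ_mod n i) \<and>
        \<rho> (s i) (x_basis n (succ_mod n i)) = zeta_inv \<odot>\<^bsub>Lambda n\<^esub> x_basis n i \<and>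
        (\<forall>j\<in>Omega n - {i, succ_mod n i}. \<rho> (s i) (x_basis n j) = x_basis n j)))"

end

theory Submission
  imports Defs
begin

text \<open>
  Put \<open>y\<^sub>j = \<zeta>\<^sup>j x\<^bsub>j mod n\<^esub>\<close> for all integers \<open>j\<close>. Then \<open>s\<^sub>i\<close> exchanges \<open>y\<^sub>i\<close> and \<open>y\<^bsub>i+1\<^esub>\<close>, so \<open>W\<close> permutes
  the \<open>y\<^sub>j\<close> through affine permutations \<open>f\<close> of the integers, that is \<open>f (x + n) = f x + n\<close> and
  \<open>\<Sum>(f x - x) = 0\<close> over a period. By Tits' length argument \<open>W\<close> acts faithfully on the integers, and
  the reflections are exactly the elements that act by exchanging the classes of two
  incongruent integers.

  A vector is fixed by \<open>w\<close> iff its coefficient function, extended quasi-periodically to the integers,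
  is constant on the orbits of \<open>f\<close>. As \<open>\<zeta>\<close> has infinite order, it vanishes on an orbit that meets
  one of its own proper translates by multiples of \<open>n\<close>, and on any other orbit it is determined up to
  units by a single coordinate. Thus \<open>V\<^sup>w\<close> is the graph of a linear map between coordinate modules,
  so \<open>V\<^sup>w\<close> and \<open>V/V\<^sup>w\<close> are free. If \<open>V/V\<^sup>w\<close> has rank 1, only one coordinate is dependent, and the
  vanishing of \<open>\<Sum>(f x - x)\<close> forces \<open>f\<close> to exchange two classes.
\<close>

section \<open>Affine permutations of the integers\<close>

text \<open>These are the elements of the affine symmetric group. The differences
  \<open>f x - x\<close> are periodic, so the condition on their sum does not depend on the chosen
  period. Without it the rank criterion would fail: moving a single class by a nonzero multiple of
  \<open>n\<close> also leaves a fixed module with just one dependent coordinate, yet it is no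
  reflection.

  The ring of Laurent polynomials over the integers is not a principal ideal domain, so submodules
  and quotients are not free for general reasons. Freeness is obtained by naming coordinates that
  parametrise \<open>V^w\<close>, each other coordinate being zero or a power of zeta times one of
  these. Such a description survives every change of scalars that keeps zeta of infinite order. The
  argument is therefore run once, over an arbitrary domain with a unit of infinite order, for
  modules known only through a coordinate bijection, and both realizations are instances. For the
  base change this requires an identification of the tensor product, whose elements are cosets in a
  free abelian group, with tuples over \<open>A\<close>.\<close>

definition affine_perm :: "nat \<Rightarrow> (int \<Rightarrow> int) \<Rightarrow> bool" where
  "affine_perm n f \<longleftrightarrow> bij f \<and> (\<forall>x. f (x + int n) = f x + int n) \<and> (\<Sum>x\<in>{0..<int n}. f x - x) = 0"

text \<open>The two cases exclude each other only if \<open>n\<close> does not divide \<open>a - b\<close>.\<close>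

definition affine_swap :: "nat \<Rightarrow> int \<Rightarrow> int \<Rightarrow> int \<Rightarrow> int" where
  "affine_swap n a b x =
     (if int n dvd x - a then x + (b - a) else if int n dvd x - b then x + (a - b) else x)"

lemma periodic_shift:
  fixes f :: "int \<Rightarrow> int"
  assumes "\<And>x. f (x + m) = f x + m"
  shows "f (x + k * m) = f x + k * m"
proof (induction k rule: int_induct[where k = 0])
  case (step1 i)
  then show ?case using assms[of "x + i * m"] by (simp add: algebra_simps)
next
  case (step2 i)
  then show ?case using assms[of "x + (i - 1) * m"] by (simp add: algebra_simps)
qed simp

lemma affine_perm_bij: "affine_perm n f \<Longrightarrow> bij f"
  by (simp add: affine_perm_def)

lemma affine_perm_eq_iff: "affine_perm n f \<Longrightarrow> f x = f y \<longleftrightarrow> x = y"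
  by (metis affine_perm_bij bij_is_inj injD)

lemma affine_perm_shift: "affine_perm n f \<Longrightarrow> f (x + k * int n) = f x + k * int n"
  by (intro periodic_shift) (simp add: affine_perm_def)

lemma affine_perm_dvd_iff:
  assumes "affine_perm n f"
  shows "int n dvd f x - f y \<longleftrightarrow> int n dvd x - y"
proof
  assume "int n dvd x - y"
  then obtain k where "x = y + k * int n" by (auto simp: dvd_def algebra_simps)
  then show "int n dvd f x - f y" using affine_perm_shift[OF assms] by simp
next
  assume "int n dvd f x - f y"
  then obtain k where "f x = f y + k * int n" by (auto simp: dvd_def algebra_simps)
  then have "f x = f (y + k * int n)" using affine_perm_shift[OF assms] by simp
  then show "int n dvd x - y" by (simp add: affine_perm_eq_iff[OF assms])
qed

lemma bij_betw_affine_perm_mod: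
  assumes "affine_perm n f" "n > 0"
  shows "bij_betw (\<lambda>x. f x mod int n) {0..<int n} {0..<int n}"
proof -
  have "inj_on (\<lambda>x. f x mod int n) {0..<int n}"
  proof (rule inj_onI)
    fix x y assume xy: "x \<in> {0..<int n}" "y \<in> {0..<int n}" "f x mod int n = f y mod int n"
    then have "int n dvd x - y"
      using affine_perm_dvd_iff[OF assms(1)] by (simp add: mod_eq_dvd_iff)
    then have "x mod int n = y mod int n" by (simp add: mod_eq_dvd_iff)
    then show "x = y" using xy by simp
  qed
  moreover have "(\<lambda>x. f x mod int n) ` {0..<int n} \<subseteq> {0..<int n}" using assms(2) by auto
  ultimately show ?thesis
    by (simp add: bij_betw_def endo_inj_surj)
qed

lemma affine_perm_id: "affine_perm n id"
  by (simp add: affine_perm_def)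

text \<open>The displacement \<open>f y - y\<close> is periodic and \<open>x -> g x mod n\<close>
  permutes the period \<open>{0..<n}\<close>, so the total displacement is additive under
  composition.\<close>

lemma affine_perm_comp:
  assumes f: "affine_perm n f" and g: "affine_perm n g" and n: "n > 0"
  shows "affine_perm n (f \<circ> g)"
proof -
  have per: "f (y mod int n) - y mod int n = f y - y" for y
    using affine_perm_shift[OF f, of "y mod int n" "y div int n"]
    by (metis (no_types, opaque_lifting) add_diff_cancel_right mod_mult_div_eq mult.commute)
  have "(\<Sum>x\<in>{0..<int n}. f (g x) - x)
      = (\<Sum>x\<in>{0..<int n}. f (g x) - g x) + (\<Sum>x\<in>{0..<int n}. g x - x)"
    by (simp add: sum.distrib[symmetric])
  also have "(\<Sum>x\<in>{0..<int n}. f (g x) - g x)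
      = (\<Sum>x\<in>{0..<int n}. f (g x mod int n) - g x mod int n)"
    by (simp add: per)
  also have "\<dots> = (\<Sum>x\<in>{0..<int n}. f x - x)"
    by (rule sum.reindex_bij_betw[OF bij_betw_affine_perm_mod[OF g n]])
  finally have "(\<Sum>x\<in>{0..<int n}. f (g x) - x) = 0"
    using f g by (simp add: affine_perm_def)
  then show ?thesis
    using f g by (simp add: affine_perm_def bij_comp)
qed

lemma affine_perm_inv_shift:
  assumes "affine_perm n f"
  shows "inv_into UNIV f (x + k * int n) = inv_into UNIV f x + k * int n"
proof -
  have "f (inv_into UNIV f x + k * int n) = x + k * int n"
    using assms by (simp add: affine_perm_shift bij_is_surj affine_perm_bij surj_f_inv_f)
  then show ?thesis
    by (metis assms affine_perm_bij bij_inv_eq_iff)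
qed

section \<open>Swaps of two residue classes\<close>

lemma affine_swap_shift: "affine_swap n a b (x + int n) = affine_swap n a b x + int n"
  by (simp add: affine_swap_def diff_add_eq[symmetric])

lemma affine_swap_left [simp]: "affine_swap n a b a = b"
  by (simp add: affine_swap_def)

lemma affine_swap_right: "\<not> int n dvd a - b \<Longrightarrow> affine_swap n a b b = a"
  by (simp add: affine_swap_def dvd_diff_commute)

lemma affine_swap_other: "\<not> int n dvd x - a \<Longrightarrow> \<not> int n dvd x - b \<Longrightarrow> affine_swap n a b x = x"
  by (simp add: affine_swap_def)

lemma affine_swap_commute:
  assumes "\<not> int n dvd a - b"
  shows "affine_swap n a b = affine_swap n b a"
proof
  fix x
  have "\<not> (int n dvd x - a \<and> int n dvd x - b)"
    using assms dvd_diff[of "int n" "x - b" "x - a"] by auto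
  then show "affine_swap n a b x = affine_swap n b a x" by (auto simp: affine_swap_def)
qed

lemma affine_swap_swap:
  assumes "\<not> int n dvd a - b"
  shows "affine_swap n a b (affine_swap n a b x) = x"
proof -
  have 1: "\<not> (int n dvd x - a \<and> int n dvd x - b)"
    using assms dvd_diff[of "int n" "x - b" "x - a"] by auto
  have 2: "x + (b - a) - b = x - a" "x + (a - b) - a = x - b" by auto
  have 3: "int n dvd x - a \<Longrightarrow> \<not> int n dvd x + (b - a) - a"
    using assms dvd_diff[of "int n" "x - a" "x + (b - a) - a"] by (auto simp: algebra_simps dvd_diff_commute)
  show ?thesis using 1 2 3 by (simp add: affine_swap_def)
qed

lemma bij_affine_swap: "\<not> int n dvd a - b \<Longrightarrow> bij (affine_swap n a b)"
  by (rule o_bij[of "affine_swap n a b"]) (auto simp: affine_swap_swap fun_eq_iff)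

lemma sum_mod_indicator:
  assumes "n > 0"
  shows "(\<Sum>x\<in>{0..<int n}. if int n dvd x - a then c else 0) = (c :: int)"
proof -
  have "(\<Sum>x\<in>{0..<int n}. if int n dvd x - a then c else 0)
      = (\<Sum>x\<in>{0..<int n}. if x = a mod int n then c else 0)"
    by (rule sum.cong) (auto simp: mod_eq_dvd_iff[symmetric])
  also have "\<dots> = c" using assms by simp
  finally show ?thesis .
qed

text \<open>Each of the two classes meets the period once, and the displacements
  \<open>b - a\<close> and \<open>a - b\<close> cancel; incongruence of \<open>a\<close> and
  \<open>b\<close> keeps the cases of the definition apart.\<close>

lemma affine_perm_swap:
  assumes n: "n > 0" and ab: "\<not> int n dvd a - b"
  shows "affine_perm n (affine_swap n a b)"
proof -
  have "\<not> (int n dvd x - a \<and> int n dvd x - b)" for x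
    using ab dvd_diff[of "int n" "x - b" "x - a"] by auto
  then have "affine_swap n a b x - x
      = (if int n dvd x - a then b - a else 0) + (if int n dvd x - b then a - b else 0)" for x
    by (auto simp: affine_swap_def)
  then have "(\<Sum>x\<in>{0..<int n}. affine_swap n a b x - x) = 0"
    using n by (simp add: sum.distrib sum_mod_indicator)
  then show ?thesis
    by (simp add: affine_perm_def bij_affine_swap ab affine_swap_shift)
qed

text \<open>The conjugation rule, written without inverses. \<open>f\<close> preserves congruence in
  both directions, so the case distinction of \<open>affine_swap\<close> carries over. The braid and
  commutation relations and the shape of all reflections follow from it.\<close>

lemma affine_swap_conj:
  assumes "affine_perm n f"
  shows "f (affine_swap n a b x) = affine_swap n (f a) (f b) (f x)"
proof (cases "int n dvd x - a")
  case True
  then obtain k where "x = a + k * int n" by (auto simp: dvd_def algebra_simps)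
  then show ?thesis
    using affine_perm_shift[OF assms] affine_perm_shift[OF assms, of b k]
    by (simp add: affine_swap_def algebra_simps)
next
  case a: False
  show ?thesis
  proof (cases "int n dvd x - b")
    case True
    then obtain k where "x = b + k * int n" by (auto simp: dvd_def algebra_simps)
    then show ?thesis
      using a affine_perm_shift[OF assms] affine_perm_shift[OF assms, of a k]
        affine_perm_dvd_iff[OF assms, of x a]
      by (simp add: affine_swap_def algebra_simps)
  next
    case False
    then show ?thesis using a by (simp add: affine_swap_other affine_perm_dvd_iff[OF assms])
  qed
qed

text \<open>Lets reduced indices such as \<open>succ_mod n i\<close> be traded for
  \<open>i + 1\<close>: moving both arguments by the same multiple of \<open>n\<close> changes
  neither their residues nor their difference.\<close>

lemma affine_swap_cong:
  assumes "int n dvd a - a'" "b - a = b' - a'"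
  shows "affine_swap n a b = affine_swap n a' b'"
proof
  fix x
  obtain k where k: "a = a' + k * int n" using assms(1) by (auto simp: dvd_def algebra_simps)
  have "int n dvd x - a \<longleftrightarrow> int n dvd x - a'"
    using dvd_add_right_iff[of "int n" "k * int n" "x - a"] k by (simp add: algebra_simps)
  moreover have "int n dvd x - b \<longleftrightarrow> int n dvd x - b'"
    using dvd_add_right_iff[of "int n" "k * int n" "x - b"] k assms(2) by (simp add: algebra_simps)
  ultimately show "affine_swap n a b x = affine_swap n a' b' x"
    using assms(2) by (simp add: affine_swap_def algebra_simps)
qed

section \<open>Adjacent swaps and the Coxeter relations\<close>

abbreviation adjacent_swap :: "nat \<Rightarrow> int \<Rightarrow> int \<Rightarrow> int" where
  "adjacent_swap n i \<equiv> affine_swap n i (i + 1)"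

text \<open>What \<open>n \<ge> 3\<close> provides: the consecutive integers \<open>i\<close>,
  \<open>i + 1\<close>, \<open>i + 2\<close> are pairwise incongruent.\<close>

lemma not_dvd_small:
  assumes "n \<ge> 3" "m \<noteq> 0" "\<bar>m\<bar> < 3"
  shows "\<not> int n dvd m"
  using assms dvd_imp_le_int[of m "int n"] by auto

lemma affine_perm_adjacent_swap: "n \<ge> 3 \<Longrightarrow> affine_perm n (adjacent_swap n i)"
  by (simp add: affine_perm_swap not_dvd_small)

lemma adjacent_swap_swap: "n \<ge> 3 \<Longrightarrow> adjacent_swap n i (adjacent_swap n i x) = x"
  by (simp add: affine_swap_swap not_dvd_small)

lemma adjacent_swap_right: "n \<ge> 3 \<Longrightarrow> adjacent_swap n i (i + 1) = i"
  by (simp add: affine_swap_right not_dvd_small)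

text \<open>Both sides are the swap of \<open>i\<close> and \<open>i + 2\<close>, by the conjugation
  rule applied to either adjacent swap.\<close>

lemma adjacent_swap_braid:
  fixes i :: int
  assumes n: "n \<ge> 3"
  shows "adjacent_swap n i (adjacent_swap n (i + 1) (adjacent_swap n i x)) =
    adjacent_swap n (i + 1) (adjacent_swap n i (adjacent_swap n (i + 1) x))"
proof -
  have 1: "adjacent_swap n i (i + 2) = i + 2" "adjacent_swap n (i + 1) i = i"
    using not_dvd_small[OF n, of 1] not_dvd_small[OF n, of "-1"] not_dvd_small[OF n, of 2] not_dvd_small[OF n, of "-2"]
    by (auto intro!: affine_swap_other)
  have 2: "i + 1 + 1 = i + 2" by simp
  have "adjacent_swap n i (adjacent_swap n (i + 1) (adjacent_swap n i x)) = affine_swap n i (i + 2) x"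
    using affine_swap_conj[OF affine_perm_adjacent_swap[OF n], of i "i + 1" "i + 1 + 1" "adjacent_swap n i x"]
    unfolding 2 1 adjacent_swap_right[OF n] adjacent_swap_swap[OF n] .
  also have "\<dots> = adjacent_swap n (i + 1) (adjacent_swap n i (adjacent_swap n (i + 1) x))"
    using affine_swap_conj[OF affine_perm_adjacent_swap[OF n], of "i + 1" i "i + 1" "adjacent_swap n (i + 1) x"]
    unfolding 1 affine_swap_left adjacent_swap_swap[OF n] by (simp add: add.commute)
  finally show ?thesis .
qed

text \<open>Turns a braid relation between involutions into the relator of length six.\<close>

lemma swap_braid_power:
  assumes "\<And>x. f (f x) = x" "\<And>x. g (g x) = x" "\<And>x. f (g (f x)) = g (f (g x))"
  shows "f (g (f (g (f (g x))))) = x"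
  using assms(3)[of "g (f (g x))"] by (simp add: assms(1,2))

lemma adjacent_swap_far:
  assumes n: "n \<ge> 3" and ij: "\<not> int n dvd i - j" "\<not> int n dvd i + 1 - j" "\<not> int n dvd i - (j + 1)"
  shows "adjacent_swap n i j = j" "adjacent_swap n i (j + 1) = j + 1"
  using assms by (auto intro!: affine_swap_other simp: dvd_diff_commute[of "int n" j]
      dvd_diff_commute[of "int n" "j + 1"])

text \<open>The swap at \<open>i\<close> fixes both \<open>j\<close> and \<open>j + 1\<close>, so
  conjugating by it leaves the swap at \<open>j\<close> unchanged.\<close>

lemma adjacent_swap_commute:
  assumes n: "n \<ge> 3" and ij: "\<not> int n dvd i - j" "\<not> int n dvd i + 1 - j" "\<not> int n dvd i - (j + 1)"
  shows "adjacent_swap n i (adjacent_swap n j x) = adjacent_swap n j (adjacent_swap n i x)"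
  by (subst affine_swap_conj[OF affine_perm_adjacent_swap[OF n]])
     (simp add: adjacent_swap_far[OF assms])

definition affine_word :: "nat \<Rightarrow> int list \<Rightarrow> int \<Rightarrow> int" where
  "affine_word n u = foldr (\<lambda>i g. adjacent_swap n i \<circ> g) u id"

lemma affine_word_simps [simp]:
  "affine_word n [] = id"
  "affine_word n (i # u) = adjacent_swap n i \<circ> affine_word n u"
  by (simp_all add: affine_word_def)

lemma affine_word_append: "affine_word n (u @ v) = affine_word n u \<circ> affine_word n v"
  by (induction u) (simp_all add: o_assoc)

lemma affine_perm_word: "n \<ge> 3 \<Longrightarrow> affine_perm n (affine_word n u)"
  by (induction u) (simp_all add: affine_perm_id affine_perm_comp affine_perm_adjacent_swap)

lemma Omega_eq: "n > 0 \<Longrightarrow> Omega n = {0..<int n}"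
  by (simp add: Omega_def carrier_integer_mod_group)

lemma succ_mod_eq: "succ_mod n i = (i + 1) mod int n"
  by (simp add: succ_mod_def)

lemma adjacent_swap_succ_mod: "adjacent_swap n (succ_mod n i) = adjacent_swap n (i + 1)"
  by (rule affine_swap_cong) (simp_all add: succ_mod_eq dvd_minus_mod dvd_diff_commute)

lemma eq_succ_mod_iff: "n > 0 \<Longrightarrow> j \<in> Omega n \<Longrightarrow> j = succ_mod n i \<longleftrightarrow> int n dvd i + 1 - j"
  by (auto simp: Omega_eq succ_mod_eq mod_eq_dvd_iff[symmetric])

lemma eq_Omega_iff: "n > 0 \<Longrightarrow> i \<in> Omega n \<Longrightarrow> j \<in> Omega n \<Longrightarrow> i = j \<longleftrightarrow> int n dvd i - j"
  by (auto simp: Omega_eq mod_eq_dvd_iff[symmetric])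

text \<open>Together the incongruences say that \<open>{i, i + 1}\<close> and
  \<open>{j, j + 1}\<close> are disjoint modulo \<open>n\<close>.\<close>

lemma far_indices:
  assumes "i \<in> Omega n" "j \<in> Omega n" "n > 0" "i \<noteq> j" "j \<noteq> succ_mod n i" "i \<noteq> succ_mod n j"
  shows "\<not> int n dvd i - j" "\<not> int n dvd i + 1 - j" "\<not> int n dvd i - (j + 1)"
  using assms eq_Omega_iff[of n i j] eq_succ_mod_iff[of n j i] eq_succ_mod_iff[of n i j]
  by (simp_all add: dvd_diff_commute[of "int n" "j + 1"])

lemma concat_replicate_simps:
  "concat (replicate 2 [i, j]) = [i, j, i, j]" "concat (replicate 3 [i, j]) = [i, j, i, j, i, j]"
  by (simp_all add: numeral_2_eq_2 numeral_3_eq_3)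

lemma affine_word_relator:
  assumes n: "n \<ge> 3" and ij: "i \<in> Omega n" "j \<in> Omega n"
  shows "affine_word n (concat (replicate (affine_A_matrix n i j) [i, j])) = id"
proof -
  note involutive = adjacent_swap_swap[OF n]
  consider "i = j" | "i \<noteq> j" "j = succ_mod n i" | "i \<noteq> j" "i = succ_mod n j"
    | "i \<noteq> j" "j \<noteq> succ_mod n i" "i \<noteq> succ_mod n j" by blast
  then show ?thesis
  proof cases
    case 1
    then show ?thesis by (simp add: affine_A_matrix_def fun_eq_iff involutive)
  next
    case 2
    then have *: "adjacent_swap n j = adjacent_swap n (i + 1)" "affine_A_matrix n i j = 3"
      by (simp_all add: adjacent_swap_succ_mod affine_A_matrix_def)
    have "adjacent_swap n i (adjacent_swap n j (adjacent_swap n i (adjacent_swap n j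
        (adjacent_swap n i (adjacent_swap n j x))))) = x" for x
      unfolding *(1) 
      by (rule swap_braid_power[where f = "adjacent_swap n i" and g = "adjacent_swap n (i + 1)"])
        (rule involutive adjacent_swap_braid[OF n])+
    then show ?thesis
      by (simp add: *(2) concat_replicate_simps fun_eq_iff)
  next
    case 3
    then have *: "adjacent_swap n i = adjacent_swap n (j + 1)" "affine_A_matrix n i j = 3"
      by (simp_all add: adjacent_swap_succ_mod affine_A_matrix_def)
    have "adjacent_swap n i (adjacent_swap n j (adjacent_swap n i (adjacent_swap n j
        (adjacent_swap n i (adjacent_swap n j x))))) = x" for x
      unfolding *(1) 
      by (rule swap_braid_power[where f = "adjacent_swap n (j + 1)" and g = "adjacent_swap n j"])
        (rule involutive adjacent_swap_braid[OF n, symmetric])+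
    then show ?thesis by (simp add: *(2) concat_replicate_simps fun_eq_iff)
  next
    case 4
    then have "affine_A_matrix n i j = 2" by (simp add: affine_A_matrix_def)
    moreover have "adjacent_swap n i (adjacent_swap n j x) = adjacent_swap n j (adjacent_swap n i x)" for x
      using n by (intro adjacent_swap_commute far_indices ij 4) auto
    ultimately show ?thesis
      by (simp add: concat_replicate_simps fun_eq_iff involutive)
  qed
qed

lemma affine_word_coxeter_equiv:
  assumes n: "n \<ge> 3" and "coxeter_equiv (Omega n) (affine_A_matrix n) u v"
  shows "affine_word n u = affine_word n v"
  using assms(2)
  by induction (simp_all add: affine_word_append affine_word_relator[OF n])

section \<open>The Coxeter group as a group of affine permutations\<close>

locale affine_A_system =
  fixes n :: nat and W :: "('g, 'x) monoid_scheme" (structure) and s :: "int \<Rightarrow> 'g"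
  assumes n: "n \<ge> 3"
    and coxeter: "coxeter_system W (Omega n) (affine_A_matrix n) s"
begin

sublocale group W
  using coxeter by (simp add: coxeter_system_def)

lemma gen_closed [simp, intro]: "i \<in> Omega n \<Longrightarrow> s i \<in> carrier W"
  using coxeter by (auto simp: coxeter_system_def)

abbreviation "value_of \<equiv> word_value W s"

lemma value_simps [simp]: "value_of [] = \<one>" "value_of (i # u) = s i \<otimes> value_of u"
  by (simp_all add: word_value_def)

lemma value_closed [simp, intro]: "u \<in> lists (Omega n) \<Longrightarrow> value_of u \<in> carrier W"
  by (induction u) auto

lemma value_append:
  "u \<in> lists (Omega n) \<Longrightarrow> v \<in> lists (Omega n) \<Longrightarrow> value_of (u @ v) = value_of u \<otimes> value_of v"
  by (induction u) (auto simp: m_assoc)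

lemma value_surj:
  assumes "w \<in> carrier W"
  obtains u where "u \<in> lists (Omega n)" "value_of u = w"
proof -
  have "w \<in> value_of ` lists (Omega n)" using coxeter assms by (simp add: coxeter_system_def)
  then show thesis using that by auto
qed

lemma value_eq_iff:
  "u \<in> lists (Omega n) \<Longrightarrow> v \<in> lists (Omega n) \<Longrightarrow>
    value_of u = value_of v \<longleftrightarrow> coxeter_equiv (Omega n) (affine_A_matrix n) u v"
  using coxeter by (simp add: coxeter_system_def)

lemma value_relator:
  assumes "i \<in> Omega n" "j \<in> Omega n"
  shows "value_of (concat (replicate (affine_A_matrix n i j) [i, j])) = \<one>"
proof -
  have "concat (replicate k [i, j]) \<in> lists (Omega n)" for k
    using assms by (induction k) auto
  then show ?thesis
    using value_eq_iff[of _ "[]"] coxeter_equiv.relator[OF assms, of "[]" "[]" "affine_A_matrix n"]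
    by simp
qed

lemma gen_square [simp]: "i \<in> Omega n \<Longrightarrow> s i \<otimes> s i = \<one>"
  using value_relator[of i i] by (simp add: affine_A_matrix_def)

lemma gen_inv: "i \<in> Omega n \<Longrightarrow> inv (s i) = s i"
  by (simp add: inv_equality)

lemma gen_cancel [simp]: "i \<in> Omega n \<Longrightarrow> w \<in> carrier W \<Longrightarrow> w \<otimes> s i \<otimes> s i = w"
  by (simp add: m_assoc)

lemma gen_commute:
  assumes "i \<in> Omega n" "j \<in> Omega n" "affine_A_matrix n i j = 2"
  shows "s i \<otimes> s j = s j \<otimes> s i"
proof -
  have "s i \<otimes> s j \<otimes> (s i \<otimes> s j) = \<one>"
    using value_relator[of i j] assms by (simp add: concat_replicate_simps m_assoc)
  then have "s i \<otimes> s j = inv (s i \<otimes> s j)"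
    using assms by (metis gen_closed inv_equality m_closed)
  then show ?thesis using assms by (simp add: inv_mult_group gen_inv)
qed

lemma gen_braid:
  assumes "i \<in> Omega n" "j \<in> Omega n" "affine_A_matrix n i j = 3"
  shows "s i \<otimes> s j \<otimes> s i = s j \<otimes> s i \<otimes> s j"
proof -
  have "(s i \<otimes> s j \<otimes> s i) \<otimes> (s j \<otimes> s i \<otimes> s j) = \<one>"
    using value_relator[of i j] assms by (simp add: concat_replicate_simps m_assoc)
  then have "s i \<otimes> s j \<otimes> s i = inv (s j \<otimes> s i \<otimes> s j)"
    using assms by (metis gen_closed inv_equality m_closed)
  then show ?thesis using assms by (simp add: inv_mult_group gen_inv m_assoc)
qed

text \<open>Any word for \<open>w\<close> gives the same permutation, because words of equal value
  are Coxeter equivalent and the relators act trivially; \<open>perm_value\<close> records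
  this.\<close>

definition perm :: "'g \<Rightarrow> int \<Rightarrow> int" where
  "perm w = affine_word n (SOME u. u \<in> lists (Omega n) \<and> value_of u = w)"

lemma perm_value:
  assumes "u \<in> lists (Omega n)"
  shows "perm (value_of u) = affine_word n u"
proof -
  have "\<exists>v. v \<in> lists (Omega n) \<and> value_of v = value_of u" using assms by blast
  from someI_ex[OF this] show ?thesis
    unfolding perm_def using value_eq_iff[OF _ assms] affine_word_coxeter_equiv[OF n] by blast
qed

lemma perm_one [simp]: "perm \<one> = id"
  using perm_value[of "[]"] by simp

lemma perm_gen [simp]: "i \<in> Omega n \<Longrightarrow> perm (s i) = adjacent_swap n i"
  using perm_value[of "[i]"] by simp

lemma perm_mult:
  assumes "v \<in> carrier W" "w \<in> carrier W"
  shows "perm (v \<otimes> w) = perm v \<circ> perm w"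
proof -
  obtain a b where ab: "a \<in> lists (Omega n)" "value_of a = v" "b \<in> lists (Omega n)" "value_of b = w"
    using assms value_surj by metis
  then have "perm (value_of (a @ b)) = affine_word n a \<circ> affine_word n b"
    by (subst perm_value) (auto simp: affine_word_append)
  then show ?thesis
    using ab perm_value[OF ab(1)] perm_value[OF ab(3)] by (simp add: value_append)
qed

lemma perm_affine: "w \<in> carrier W \<Longrightarrow> affine_perm n (perm w)"
  using value_surj[of w] perm_value affine_perm_word[OF n] by metis

lemma perm_inv:
  assumes "w \<in> carrier W"
  shows "perm (inv w) (perm w x) = x" "perm w (perm (inv w) x) = x"
  using perm_mult[of "inv w" w] perm_mult[of w "inv w"] assms by (auto simp: fun_eq_iff)

section \<open>Length and Tits' argument\<close>

definition len :: "'g \<Rightarrow> nat" where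
  "len w = (LEAST k. \<exists>u\<in>lists (Omega n). length u = k \<and> value_of u = w)"

lemma len_le: "u \<in> lists (Omega n) \<Longrightarrow> len (value_of u) \<le> length u"
  unfolding len_def by (rule Least_le) blast

lemma len_word:
  assumes "w \<in> carrier W"
  obtains u where "u \<in> lists (Omega n)" "value_of u = w" "length u = len w"
proof -
  have "\<exists>k. \<exists>u\<in>lists (Omega n). length u = k \<and> value_of u = w"
    using value_surj[OF assms] by metis
  from LeastI_ex[OF this] show thesis using that unfolding len_def by blast
qed

lemma len_mult_gen:
  assumes "w \<in> carrier W" "i \<in> Omega n"
  shows "len (w \<otimes> s i) \<le> Suc (len w)"
proof -
  obtain u where u: "u \<in> lists (Omega n)" "value_of u = w" "length u = len w"
    using len_word[OF assms(1)] .
  then show ?thesis using len_le[of "u @ [i]"] value_append[of u "[i]"] assms by simp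
qed

text \<open>Drop the last letter of a shortest word.\<close>

lemma descent_exists:
  assumes "w \<in> carrier W" "w \<noteq> \<one>"
  obtains i where "i \<in> Omega n" "len (w \<otimes> s i) < len w"
proof -
  obtain u where u: "u \<in> lists (Omega n)" "value_of u = w" "length u = len w"
    using len_word[OF assms(1)] .
  with assms obtain v i where vi: "u = v @ [i]" by (cases u rule: rev_cases) auto
  then have "w = value_of v \<otimes> s i" using u value_append[of v "[i]"] by auto
  then have "w \<otimes> s i = value_of v" using u vi by auto
  then have "len (w \<otimes> s i) < len w" using len_le[of v] u vi by simp
  then show thesis using that u vi by auto
qed

text \<open>Tits' argument: strip from \<open>w\<close> the letters \<open>s j\<close> and \<open>s i\<close> on the right as long as this shortens it;
  what remains is increasing at both \<open>i\<close> and \<open>j\<close> by induction.\<close>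

lemma perm_ascent:
  assumes w: "w \<in> carrier W" and i: "i \<in> Omega n" and le: "len w \<le> len (w \<otimes> s i)"
  shows "perm w i < perm w (i + 1)"
  using assms
proof (induction "len w" arbitrary: w i rule: less_induct)
  case less
  note w = \<open>w \<in> carrier W\<close> and i = \<open>i \<in> Omega n\<close> and le = less.prems(3)
  show ?case
  proof (cases "w = \<one>")
    case False
    then obtain j where j: "j \<in> Omega n" "len (w \<otimes> s j) < len w"
      using descent_exists w by blast
    have ij: "i \<noteq> j" using j le by auto
    define v where "v = w \<otimes> s j"
    have v: "v \<in> carrier W" "len v < len w" "w = v \<otimes> s j" using w j by (auto simp: v_def)
    have perm_w: "perm w x = perm v (adjacent_swap n j x)" for x
      using perm_mult[OF v(1), of "s j"] v j by simp
    have far: "perm v i < perm v (i + 1)" if "len v \<le> len (v \<otimes> s i)"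
      using less.hyps[OF v(2) v(1) i that] .
    have "affine_A_matrix n i j = 2 \<or> affine_A_matrix n i j = 3"
      using ij by (simp add: affine_A_matrix_def)
    then show ?thesis
    proof
      assume m: "affine_A_matrix n i j = 2"
      \<comment> \<open>Otherwise \<open>w \<otimes> s i = v \<otimes> s i \<otimes> s j\<close>
        would have length at most \<open>len v\<close>, which is less than
        \<open>len w\<close>.\<close>
      have "len v \<le> len (v \<otimes> s i)"
      proof (rule ccontr)
        assume "\<not> ?thesis"
        moreover have "w \<otimes> s i = v \<otimes> s i \<otimes> s j"
          using gen_commute[OF i j(1) m] v i j by (simp add: m_assoc)
        ultimately show False
          using len_mult_gen[of "v \<otimes> s i" j] v i j le by simp
      qed
      moreover have "j \<noteq> succ_mod n i" "i \<noteq> succ_mod n j"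
        using m ij by (auto simp: affine_A_matrix_def)
      then have "adjacent_swap n j i = i" "adjacent_swap n j (i + 1) = i + 1"
        using n ij i j(1) by (intro adjacent_swap_far far_indices; simp)+
      ultimately show ?thesis using far by (simp add: perm_w)
    next
      assume m: "affine_A_matrix n i j = 3"
      have "\<exists>v'. v' \<in> carrier W \<and> perm v' i < perm v' (i + 1) \<and> perm v' j < perm v' (j + 1) \<and>
        (w = v' \<otimes> s j \<or> w = v' \<otimes> s i \<otimes> s j)"
      proof (cases "len v \<le> len (v \<otimes> s i)")
        case True
        moreover have "len v \<le> len (v \<otimes> s j)" using v by simp
        ultimately show ?thesis using v less.hyps[OF v(2) v(1)] i j by blast
      next
        case False
        define v' where "v' = v \<otimes> s i"
        have v': "v' \<in> carrier W" "len v' < len v" "v = v' \<otimes> s i" using v i False by (auto simp: v'_def)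
        have "len v' \<le> len (v' \<otimes> s i)" using v' by simp
        \<comment> \<open>A third letter cannot come off: \<open>w \<otimes> s i = v' \<otimes> s j
          \<otimes> s i \<otimes> s j\<close> would then have length at most
          \<open>len v' + 1\<close>, which is less than \<open>len w\<close>.\<close>
        moreover have "len v' \<le> len (v' \<otimes> s j)"
        proof (rule ccontr)
          assume "\<not> ?thesis"
          moreover have "w \<otimes> s i = v' \<otimes> s j \<otimes> s i \<otimes> s j"
            using gen_braid[OF i j(1) m] v v' i j by (simp add: m_assoc)
          ultimately show False
            using len_mult_gen[of "v' \<otimes> s j" i] len_mult_gen[of "v' \<otimes> s j \<otimes> s i" j] v v' i j le by simp
        qed
        ultimately show ?thesis using less.hyps[of v'] v v' i j by auto
      qed
      then obtain v' where v': "v' \<in> carrier W" "perm v' i < perm v' (i + 1)" "perm v' j < perm v' (j + 1)"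
        and w_eq: "w = v' \<otimes> s j \<or> w = v' \<otimes> s i \<otimes> s j" by blast
      then have perm_w: "perm w = perm v' \<circ> adjacent_swap n j \<or>
          perm w = perm v' \<circ> adjacent_swap n i \<circ> adjacent_swap n j"
        using i j by (auto simp: perm_mult)
      have "j = succ_mod n i \<or> i = succ_mod n j"
        using m ij by (auto simp: affine_A_matrix_def split: if_splits)
      then show ?thesis
      proof
        assume j': "j = succ_mod n i"
        \<comment> \<open>\<open>succ_mod\<close> wraps around at \<open>n - 1\<close>; shifting by
          \<open>k\<close> periods turns the ascent of \<open>v'\<close> at \<open>j\<close> into
          one at \<open>i + 1\<close>.\<close>
        define k where "k = - ((i + 1) div int n)"
        have k: "j = (i + 1) + k * int n"
          using j' by (simp add: succ_mod_eq k_def minus_div_mult_eq_mod)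
        have lt: "perm v' (i + 1) < perm v' (i + 2)"
          using v'(3) affine_perm_shift[OF perm_affine[OF v'(1)], of "i + 1" k]
            affine_perm_shift[OF perm_affine[OF v'(1)], of "i + 2" k] k by (simp add: algebra_simps)
        have j_eq: "adjacent_swap n j = adjacent_swap n (i + 1)" using j' by (simp add: adjacent_swap_succ_mod)
        have [simp]: "adjacent_swap n j i = i" unfolding j_eq
          by (intro affine_swap_other) (use n in \<open>simp_all add: not_dvd_small\<close>)
        have [simp]: "adjacent_swap n j (i + 1) = i + 2" by (simp add: j_eq)
        have [simp]: "adjacent_swap n i (i + 2) = i + 2"
          by (intro affine_swap_other) (use n in \<open>simp_all add: not_dvd_small\<close>)
        \<comment> \<open>The values of \<open>perm w\<close> at \<open>i\<close> and
          \<open>i + 1\<close> are those of \<open>perm v'\<close> at \<open>i\<close> and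
          \<open>i + 2\<close>, or at \<open>i + 1\<close> and \<open>i + 2\<close> if
          \<open>s i\<close> was stripped as well.\<close>
        show ?thesis using perm_w v'(2) lt by auto
      next
        assume i': "i = succ_mod n j"
        define k where "k = (j + 1) div int n"
        have k: "j = (i - 1) + k * int n"
          using i'[unfolded succ_mod_eq] div_mult_mod_eq[of "j + 1" "int n"] unfolding k_def by linarith
        have lt: "perm v' (i - 1) < perm v' i"
          using v'(3) affine_perm_shift[OF perm_affine[OF v'(1)], of "i - 1" k]
            affine_perm_shift[OF perm_affine[OF v'(1)], of "i" k] k by (simp add: algebra_simps)
        have j_eq: "adjacent_swap n j = affine_swap n (i - 1) i"
          by (rule affine_swap_cong) (simp_all add: k)
        have [simp]: "adjacent_swap n j i = i - 1"
          using adjacent_swap_right[OF n, of "i - 1"] by (simp add: j_eq)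
        have [simp]: "adjacent_swap n j (i + 1) = i + 1" unfolding j_eq
          by (intro affine_swap_other) (use n in \<open>simp_all add: not_dvd_small\<close>)
        have [simp]: "adjacent_swap n i (i - 1) = i - 1"
          by (intro affine_swap_other) (use n in \<open>simp_all add: not_dvd_small\<close>)
        \<comment> \<open>Here \<open>s j\<close> exchanges \<open>i - 1\<close> and
          \<open>i\<close>, so the values compared are those of \<open>perm v'\<close> at
          \<open>i - 1\<close> and \<open>i + 1\<close>, or at \<open>i - 1\<close> and
          \<open>i\<close>.\<close>
        show ?thesis using perm_w v'(2) lt by (auto simp: adjacent_swap_right[OF n])
      qed
    qed
  qed simp
qed

text \<open>At a descent \<open>i\<close> of \<open>w\<close>, the ascent lemma applies to
  \<open>w \<otimes> s i\<close> and shows that \<open>perm w\<close> reverses \<open>i\<close> and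
  \<open>i + 1\<close>, which the identity does not do.\<close>

lemma perm_eq_id:
  assumes w: "w \<in> carrier W" and "perm w = id"
  shows "w = \<one>"
proof (rule ccontr)
  assume "w \<noteq> \<one>"
  then obtain i where i: "i \<in> Omega n" "len (w \<otimes> s i) < len w"
    using descent_exists w by blast
  then have "perm (w \<otimes> s i) i < perm (w \<otimes> s i) (i + 1)"
    using w by (intro perm_ascent) auto
  then show False using assms i by (simp add: perm_mult adjacent_swap_right n)
qed

lemma perm_inj:
  assumes "v \<in> carrier W" "w \<in> carrier W" "perm v = perm w"
  shows "v = w"
proof -
  have "perm (v \<otimes> inv w) = id"
    using assms perm_mult[of w "inv w"] by (simp add: perm_mult)
  then have "v \<otimes> inv w = \<one>" using assms perm_eq_id by simp
  then show ?thesis using assms by (metis inv_equality inv_inv inv_closed)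
qed

text \<open>Induction on \<open>b - a\<close>. Conjugating by the swap at \<open>a\<close> moves
  \<open>a\<close> up to \<open>a + 1\<close> and does not raise \<open>b\<close>, so the distance
  shrinks until \<open>w\<close> acts as an adjacent swap; faithfulness then identifies it with a
  generator.\<close>

lemma reflection_of_swap:
  assumes "w \<in> carrier W" "perm w = affine_swap n a b" "a < b" "\<not> int n dvd a - b"
  shows "w \<in> reflections W (s ` Omega n)"
  using assms
proof (induction "nat (b - a)" arbitrary: w a b rule: less_induct)
  case less
  define i where "i = a mod int n"
  have i: "i \<in> Omega n" using n by (simp add: i_def Omega_eq)
  have s_i: "adjacent_swap n i = adjacent_swap n a"
    by (rule affine_swap_cong) (simp_all add: i_def mod_eq_dvd_iff[symmetric])
  show ?case
  proof (cases "b = a + 1")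
    case True
    then have "w = s i" using less.prems i s_i by (intro perm_inj) auto
    moreover have "s i = \<one> \<otimes> s i \<otimes> inv \<one>" using i by simp
    ultimately show ?thesis using i unfolding reflections_def by blast
  next
    case False
    define b' where "b' = adjacent_swap n a b"
    define v where "v = s i \<otimes> w \<otimes> s i"
    have v: "v \<in> carrier W" using i less.prems by (simp add: v_def)
    have b': "b' = b \<or> int n dvd b - (a + 1) \<and> b' = b - 1"
      using less.prems(4) by (simp add: b'_def affine_swap_def dvd_diff_commute[of "int n" b a])
    \<comment> \<open>If \<open>b\<close> is congruent to \<open>a + 1\<close> but different from
      it, then \<open>b - (a + 1)\<close> is a positive multiple of \<open>n\<close>, so even
      \<open>b - 1\<close> lies beyond \<open>a + 1\<close>.\<close>
    have lt: "a + 1 < b'"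
      using b' less.prems(3) False zdvd_imp_le[of "int n" "b - (a + 1)"] n by auto
    have *: "affine_swap n (a + 1) b' = perm v"
    proof
      fix x
      have "perm v x = adjacent_swap n a (affine_swap n a b (adjacent_swap n a x))"
        using i less.prems s_i by (simp add: v_def perm_mult)
      also have "\<dots> = affine_swap n (a + 1) b' x"
        by (subst affine_swap_conj) (simp_all add: affine_perm_adjacent_swap adjacent_swap_swap n b'_def)
      finally show "affine_swap n (a + 1) b' x = perm v x" by simp
    qed
    have "\<not> int n dvd (a + 1) - b'"
      using affine_perm_dvd_iff[OF affine_perm_adjacent_swap[OF n], of a a b] less.prems(4)
      by (simp add: b'_def)
    then have "v \<in> reflections W (s ` Omega n)"
      using less.hyps[of b' "a + 1" v] lt b' v * by auto
    then obtain g t where gt: "g \<in> carrier W" "t \<in> s ` Omega n" "v = g \<otimes> t \<otimes> inv g"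
      by (auto simp: reflections_def)
    have t: "t \<in> carrier W" using gt by auto
    have "w = s i \<otimes> v \<otimes> s i"
      using i less.prems by (simp add: v_def m_assoc[symmetric])
    also have "\<dots> = (s i \<otimes> g) \<otimes> t \<otimes> inv (s i \<otimes> g)"
      using gt t i by (simp add: inv_mult_group gen_inv m_assoc)
    finally show ?thesis using gt i unfolding reflections_def by blast
  qed
qed

text \<open>By the conjugation rule, a conjugate of \<open>s i\<close> by \<open>g\<close> swaps the
  classes of the images of \<open>i\<close> and \<open>i + 1\<close> under
  \<open>perm g\<close>.\<close>

lemma swap_of_reflection:
  assumes "w \<in> reflections W (s ` Omega n)"
  obtains a b where "w \<in> carrier W" "perm w = affine_swap n a b" "\<not> int n dvd a - b"
proof -
  obtain g i where g: "g \<in> carrier W" "i \<in> Omega n" "w = g \<otimes> s i \<otimes> inv g"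
    using assms by (auto simp: reflections_def)
  have "perm w x = affine_swap n (perm g i) (perm g (i + 1)) x" for x
    using g by (simp add: perm_mult affine_swap_conj[OF perm_affine] perm_inv)
  then have "perm w = affine_swap n (perm g i) (perm g (i + 1))" by (rule ext)
  moreover have "\<not> int n dvd perm g i - perm g (i + 1)"
    unfolding affine_perm_dvd_iff[OF perm_affine[OF g(1)]] by (rule not_dvd_small[OF n]) auto
  moreover have "w \<in> carrier W" using g by simp
  ultimately show thesis using that by blast
qed

end

section \<open>Modules with coordinates\<close>

text \<open>\<open>M\<close> is not assumed to be a module: the axioms are transported back along
  \<open>\<phi>\<close>. Modules of cosets can thus be treated by computing their operations in
  coordinates.\<close>

locale coordinates = R?: cring A for A (structure) +
  fixes M :: "('a, 'm, 'c) module_scheme" and J :: "'i set" and \<phi> :: "'m \<Rightarrow> 'i \<Rightarrow> 'a"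
  assumes bij: "bij_betw \<phi> (carrier M) (J \<rightarrow>\<^sub>E carrier A)"
    and zero_coord: "\<zero>\<^bsub>M\<^esub> \<in> carrier M" "\<phi> \<zero>\<^bsub>M\<^esub> = (\<lambda>i\<in>J. \<zero>)"
    and add_coord: "\<And>x y. x \<in> carrier M \<Longrightarrow> y \<in> carrier M \<Longrightarrow> x \<oplus>\<^bsub>M\<^esub> y \<in> carrier M"
      "\<And>x y. x \<in> carrier M \<Longrightarrow> y \<in> carrier M \<Longrightarrow> \<phi> (x \<oplus>\<^bsub>M\<^esub> y) = (\<lambda>i\<in>J. \<phi> x i \<oplus> \<phi> y i)"
    and smult_coord: "\<And>a x. a \<in> carrier A \<Longrightarrow> x \<in> carrier M \<Longrightarrow> a \<odot>\<^bsub>M\<^esub> x \<in> carrier M"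
      "\<And>a x. a \<in> carrier A \<Longrightarrow> x \<in> carrier M \<Longrightarrow> \<phi> (a \<odot>\<^bsub>M\<^esub> x) = (\<lambda>i\<in>J. a \<otimes> \<phi> x i)"
begin

lemma coord_PiE: "x \<in> carrier M \<Longrightarrow> \<phi> x \<in> J \<rightarrow>\<^sub>E carrier A"
  using bij by (auto simp: bij_betw_def)

lemma coord_closed [simp, intro]: "x \<in> carrier M \<Longrightarrow> i \<in> J \<Longrightarrow> \<phi> x i \<in> carrier A"
  using coord_PiE by blast

lemma coord_inj: "x \<in> carrier M \<Longrightarrow> y \<in> carrier M \<Longrightarrow> \<phi> x = \<phi> y \<Longrightarrow> x = y"
  using bij by (auto simp: bij_betw_def inj_on_def)

lemma coord_eqI:
  assumes "x \<in> carrier M" "y \<in> carrier M" "\<And>i. i \<in> J \<Longrightarrow> \<phi> x i = \<phi> y i"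
  shows "x = y"
  using assms by (intro coord_inj PiE_ext[OF coord_PiE coord_PiE]) auto

definition of_coord :: "('i \<Rightarrow> 'a) \<Rightarrow> 'm" where
  "of_coord v = inv_into (carrier M) \<phi> v"

lemma of_coord_closed: "v \<in> J \<rightarrow>\<^sub>E carrier A \<Longrightarrow> of_coord v \<in> carrier M"
  using bij unfolding of_coord_def bij_betw_def by (metis inv_into_into)

lemma coord_of_coord: "v \<in> J \<rightarrow>\<^sub>E carrier A \<Longrightarrow> \<phi> (of_coord v) = v"
  using bij unfolding of_coord_def bij_betw_def by (metis f_inv_into_f)

lemma is_module: "module A M"
proof (rule moduleI)
  show "abelian_group M"
  proof (rule abelian_groupI)
    fix x assume x: "x \<in> carrier M"
    let ?y = "of_coord (\<lambda>i\<in>J. \<ominus> \<phi> x i)"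
    have "(\<lambda>i\<in>J. \<ominus> \<phi> x i) \<in> J \<rightarrow>\<^sub>E carrier A" using x by auto
    then have y: "?y \<in> carrier M" "\<phi> ?y = (\<lambda>i\<in>J. \<ominus> \<phi> x i)"
      by (auto simp: of_coord_closed coord_of_coord)
    then have "?y \<oplus>\<^bsub>M\<^esub> x = \<zero>\<^bsub>M\<^esub>"
      using x by (intro coord_eqI) (simp_all add: add_coord zero_coord l_neg)
    then show "\<exists>y\<in>carrier M. y \<oplus>\<^bsub>M\<^esub> x = \<zero>\<^bsub>M\<^esub>" using y by blast
  qed (auto intro!: coord_eqI simp: add_coord zero_coord a_ac)
qed (auto intro!: coord_eqI is_cring simp: add_coord smult_coord l_distr r_distr m_assoc)

sublocale module A M by (rule is_module)

lemma finsum_coord: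
  assumes "finite B" "B \<subseteq> carrier M" "c \<in> B \<rightarrow> carrier A" "i \<in> J"
  shows "\<phi> (\<Oplus>\<^bsub>M\<^esub>b\<in>B. c b \<odot>\<^bsub>M\<^esub> b) i = (\<Oplus>b\<in>B. c b \<otimes> \<phi> b i)"
  using assms(1,2,3)
proof (induction B)
  case empty
  then show ?case using assms(4) by (simp add: zero_coord)
next
  case (insert x B)
  then have "(\<lambda>b. c b \<odot>\<^bsub>M\<^esub> b) \<in> B \<rightarrow> carrier M" "(\<lambda>b. c b \<otimes> \<phi> b i) \<in> B \<rightarrow> carrier A"
    "x \<in> carrier M" "c x \<in> carrier A"
    using assms(4) by (auto simp: Pi_iff)
  then show ?case using insert assms(4)
    by (simp add: M.finsum_insert R.finsum_insert add_coord smult_coord)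
qed

section \<open>Unit vectors, bases and rank\<close>

definition unit_vector :: "'i \<Rightarrow> 'm" where
  "unit_vector j = of_coord (\<lambda>i\<in>J. if i = j then \<one> else \<zero>)"

lemma unit_vector_closed [simp, intro]: "unit_vector j \<in> carrier M"
  unfolding unit_vector_def by (rule of_coord_closed) auto

lemma unit_vector_coord: "i \<in> J \<Longrightarrow> \<phi> (unit_vector j) i = (if i = j then \<one> else \<zero>)"
  unfolding unit_vector_def by (subst coord_of_coord) auto

lemma unit_vector_inj:
  assumes "\<one> \<noteq> \<zero>"
  shows "inj_on unit_vector J"
proof (rule inj_onI)
  fix i j assume ij: "i \<in> J" "j \<in> J" and "unit_vector i = unit_vector j"
  then have "\<phi> (unit_vector i) i = \<phi> (unit_vector j) i" by simp
  then show "i = j" using assms ij by (simp add: unit_vector_coord split: if_splits)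
qed

lemma finsum_unit_vectors_coord:
  assumes "finite J" "\<one> \<noteq> \<zero>" "c \<in> unit_vector ` J \<rightarrow> carrier A" "i \<in> J"
  shows "\<phi> (\<Oplus>\<^bsub>M\<^esub>b\<in>unit_vector ` J. c b \<odot>\<^bsub>M\<^esub> b) i = c (unit_vector i)"
proof -
  have c: "c (unit_vector j) \<in> carrier A" if "j \<in> J" for j using assms(3) that by blast
  have "\<phi> (\<Oplus>\<^bsub>M\<^esub>b\<in>unit_vector ` J. c b \<odot>\<^bsub>M\<^esub> b) i = (\<Oplus>b\<in>unit_vector ` J. c b \<otimes> \<phi> b i)"
    using assms by (intro finsum_coord) auto
  also have "\<dots> = (\<Oplus>j\<in>J. c (unit_vector j) \<otimes> \<phi> (unit_vector j) i)"
    using assms unit_vector_inj by (intro R.add.finprod_reindex) auto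
  also have "\<dots> = (\<Oplus>j\<in>J. if i = j then c (unit_vector j) else \<zero>)"
    using assms c by (intro R.add.finprod_cong') (auto simp: unit_vector_coord)
  also have "\<dots> = c (unit_vector i)"
    using assms c by (intro R.add.finprod_singleton[where f = "\<lambda>j. c (unit_vector j)"]) auto
  finally show ?thesis .
qed

lemma unit_vectors_basis:
  assumes "finite J" "\<one> \<noteq> \<zero>"
  shows "is_basis A M (unit_vector ` J)"
  unfolding is_basis_def
proof (intro conjI ballI)
  fix x assume x: "x \<in> carrier M"
  let ?B = "unit_vector ` J"
  define c where "c = (\<lambda>b\<in>?B. \<phi> x (inv_into J unit_vector b))"
  have c_unit: "c (unit_vector j) = \<phi> x j" if "j \<in> J" for j
    using that by (simp add: c_def inv_into_f_f[OF unit_vector_inj[OF assms(2)]])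
  have c: "c \<in> ?B \<rightarrow>\<^sub>E carrier A"
  proof (rule PiE_I)
    fix b assume "b \<in> ?B"
    then show "c b \<in> carrier A" using x c_unit by auto
  qed (simp add: c_def)
  have sum_closed: "(\<Oplus>\<^bsub>M\<^esub>b\<in>?B. d b \<odot>\<^bsub>M\<^esub> b) \<in> carrier M" if "d \<in> ?B \<rightarrow>\<^sub>E carrier A" for d
    using that by (intro M.finsum_closed) auto
  show "\<exists>!c. c \<in> ?B \<rightarrow>\<^sub>E carrier A \<and> x = (\<Oplus>\<^bsub>M\<^esub>b\<in>?B. c b \<odot>\<^bsub>M\<^esub> b)"
  proof (rule ex1I[of _ c], rule conjI)
    have "\<phi> (\<Oplus>\<^bsub>M\<^esub>b\<in>?B. c b \<odot>\<^bsub>M\<^esub> b) i = \<phi> x i" if "i \<in> J" for i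
      using finsum_unit_vectors_coord[OF assms _ that, of c] c c_unit[OF that] by auto
    then show "x = (\<Oplus>\<^bsub>M\<^esub>b\<in>?B. c b \<odot>\<^bsub>M\<^esub> b)"
      using x sum_closed[OF c] by (intro coord_eqI) auto
  next
    fix d assume d: "d \<in> ?B \<rightarrow>\<^sub>E carrier A \<and> x = (\<Oplus>\<^bsub>M\<^esub>b\<in>?B. d b \<odot>\<^bsub>M\<^esub> b)"
    have "d (unit_vector i) = c (unit_vector i)" if "i \<in> J" for i
    proof -
      have "d \<in> ?B \<rightarrow> carrier A" using d by auto
      from finsum_unit_vectors_coord[OF assms this that] show ?thesis using d c_unit[OF that] by simp
    qed
    then show "d = c" using d c by (intro PiE_ext[of d ?B "\<lambda>_. carrier A" c]) auto
  qed (rule c)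
qed (use assms in auto)

lemma free_of_rank_card:
  assumes "finite J" "\<one> \<noteq> \<zero>"
  shows "free_of_rank A M (card J)"
  unfolding free_of_rank_def
  using is_module unit_vectors_basis[OF assms] card_image[OF unit_vector_inj[OF assms(2)]] by blast

text \<open>Two unit vectors cannot both be multiples of one vector \<open>b\<close>:
  \<open>a b_i = 1\<close> excludes \<open>a = 0\<close>, so \<open>a b_j = 0\<close> gives
  \<open>b_j = 0\<close> in a domain, against \<open>a' b_j = 1\<close>.\<close>

lemma card_eq_1_of_free_of_rank_1:
  assumes fin: "finite J" and "domain A" and "free_of_rank A M 1"
  shows "card J = 1"
proof -
  interpret domain A by fact
  obtain b where basis: "is_basis A M {b}"
    using assms(3) unfolding free_of_rank_def by (metis card_1_singletonE)
  then have b: "b \<in> carrier M" by (simp add: is_basis_def)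
  have expand: "(\<Oplus>\<^bsub>M\<^esub>x\<in>{b}. c x \<odot>\<^bsub>M\<^esub> x) = c b \<odot>\<^bsub>M\<^esub> b" if "c \<in> {b} \<rightarrow>\<^sub>E carrier A" for c
    using that b by (subst M.finsum_insert) (auto simp: PiE_iff)
  have ex: "\<exists>a\<in>carrier A. x = a \<odot>\<^bsub>M\<^esub> b" if "x \<in> carrier M" for x
  proof -
    obtain c where "c \<in> {b} \<rightarrow>\<^sub>E carrier A" "x = (\<Oplus>\<^bsub>M\<^esub>x\<in>{b}. c x \<odot>\<^bsub>M\<^esub> x)"
      using basis \<open>x \<in> carrier M\<close> unfolding is_basis_def by blast
    then show ?thesis using expand[of c] by (intro bexI[of _ "c b"]) auto
  qed
  \<comment> \<open>Uniqueness of coefficients, applied to the zero vector; it excludes an empty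
    \<open>J\<close> below.\<close>
  have torsion_free: "a = \<zero>" if a: "a \<in> carrier A" "a \<odot>\<^bsub>M\<^esub> b = \<zero>\<^bsub>M\<^esub>" for a
  proof -
    let ?d = "\<lambda>a. \<lambda>x\<in>{b}. a"
    have d: "?d a \<in> {b} \<rightarrow>\<^sub>E carrier A" "?d \<zero> \<in> {b} \<rightarrow>\<^sub>E carrier A" using a by auto
    have "\<exists>!c. c \<in> {b} \<rightarrow>\<^sub>E carrier A \<and> \<zero>\<^bsub>M\<^esub> = (\<Oplus>\<^bsub>M\<^esub>x\<in>{b}. c x \<odot>\<^bsub>M\<^esub> x)"
      using basis zero_coord(1) unfolding is_basis_def by blast
    moreover have "\<zero>\<^bsub>M\<^esub> = (\<Oplus>\<^bsub>M\<^esub>x\<in>{b}. ?d a x \<odot>\<^bsub>M\<^esub> x)" using expand[OF d(1)] a by simp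
    moreover have "\<zero>\<^bsub>M\<^esub> = (\<Oplus>\<^bsub>M\<^esub>x\<in>{b}. ?d \<zero> x \<odot>\<^bsub>M\<^esub> x)" using expand[OF d(2)] b by simp
    ultimately have "?d a = ?d \<zero>" using d by blast
    then have "?d a b = ?d \<zero> b" by (rule fun_cong)
    then show ?thesis by simp
  qed
  have "J \<noteq> {}"
  proof
    assume "J = {}"
    then have "\<one> \<odot>\<^bsub>M\<^esub> b = \<zero>\<^bsub>M\<^esub>" using b zero_coord(1) by (intro coord_eqI) auto
    then show False using torsion_free[of \<one>] by simp
  qed
  moreover have "i = j" if ij: "i \<in> J" "j \<in> J" for i j
  proof (rule ccontr)
    assume ne: "i \<noteq> j"
    obtain a where a: "a \<in> carrier A" "unit_vector i = a \<odot>\<^bsub>M\<^esub> b" using ex[of "unit_vector i"] by auto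
    obtain a' where a': "a' \<in> carrier A" "unit_vector j = a' \<odot>\<^bsub>M\<^esub> b" using ex[of "unit_vector j"] by auto
    have 1: "a \<otimes> \<phi> b i = \<one>" "a \<otimes> \<phi> b j = \<zero>"
      using unit_vector_coord[of i i] unit_vector_coord[of j i] a b ij ne by (auto simp: smult_coord)
    have 2: "a' \<otimes> \<phi> b j = \<one>"
      using unit_vector_coord[of j j] a' b ij by (auto simp: smult_coord)
    have "a = \<zero> \<or> \<phi> b j = \<zero>" using 1 a b ij by (intro integral) auto
    then show False using 1 2 a' b ij by auto
  qed
  ultimately obtain i where "J = {i}" by blast
  then show ?thesis by simp
qed

end

lemma (in cring) coordinates_free_module: "coordinates R (free_module R I) I (\<lambda>v. v)"
proof (intro coordinates.intro coordinates_axioms.intro is_cring)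
  fix x y assume "x \<in> carrier (free_module R I)" "y \<in> carrier (free_module R I)"
  then have "x i \<in> carrier R" "y i \<in> carrier R" if "i \<in> I" for i
    using that by (auto simp: free_module_def PiE_iff)
  then show "x \<oplus>\<^bsub>free_module R I\<^esub> y \<in> carrier (free_module R I)"
    by (simp add: free_module_def restrict_PiE_iff)
next
  fix a x assume "a \<in> carrier R" "x \<in> carrier (free_module R I)"
  then have "a \<in> carrier R" "x i \<in> carrier R" if "i \<in> I" for i
    using that by (auto simp: free_module_def PiE_iff)
  then show "a \<odot>\<^bsub>free_module R I\<^esub> x \<in> carrier (free_module R I)"
    by (simp add: free_module_def restrict_PiE_iff)
qed (simp_all add: free_module_def bij_betw_def restrict_PiE_iff inj_on_def)

section \<open>Cosets of a kernel as fibres\<close>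

lemma (in group_hom) rcoset_kernel_eq:
  assumes "x \<in> carrier G"
  shows "kernel G H h #> x = {y \<in> carrier G. h y = h x}"
proof
  show "kernel G H h #> x \<subseteq> {y \<in> carrier G. h y = h x}"
    using assms by (auto simp: r_coset_def kernel_def)
  show "{y \<in> carrier G. h y = h x} \<subseteq> kernel G H h #> x"
  proof
    fix y assume y: "y \<in> {y \<in> carrier G. h y = h x}"
    then have y: "y \<in> carrier G" and "y \<otimes> inv x \<in> kernel G H h"
      using assms by (simp_all add: kernel_def)
    then have "y \<otimes> inv x \<otimes> x \<in> kernel G H h #> x" unfolding r_coset_def by (intro UN_I) simp_all
    then show "y \<in> kernel G H h #> x" using assms y by (simp add: G.m_assoc)
  qed
qed

lemma (in group_hom) fiber_mult:
  assumes "x \<in> carrier G" "y \<in> carrier G"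
  shows "{z \<in> carrier G. h z = h x} <#> {z \<in> carrier G. h z = h y}
    = {z \<in> carrier G. h z = h (x \<otimes> y)}"
proof
  show "{z \<in> carrier G. h z = h x} <#> {z \<in> carrier G. h z = h y}
      \<subseteq> {z \<in> carrier G. h z = h (x \<otimes> y)}"
    using assms by (auto simp: set_mult_def)
  show "{z \<in> carrier G. h z = h (x \<otimes> y)}
      \<subseteq> {z \<in> carrier G. h z = h x} <#> {z \<in> carrier G. h z = h y}"
  proof
    fix z assume z: "z \<in> {z \<in> carrier G. h z = h (x \<otimes> y)}"
    then have "z \<in> carrier G" "h (z \<otimes> inv y) = h x" using assms by (simp_all add: H.m_assoc)
    then have "z \<otimes> inv y \<otimes> y \<in> {z \<in> carrier G. h z = h x} <#> {z \<in> carrier G. h z = h y}"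
      unfolding set_mult_def using assms by (intro UN_I[of "z \<otimes> inv y"] UN_I[of y]) simp_all
    then show "z \<in> {z \<in> carrier G. h z = h x} <#> {z \<in> carrier G. h z = h y}"
      using \<open>z \<in> carrier G\<close> assms by (simp add: G.m_assoc)
  qed
qed

text \<open>The image of a fibre under \<open>f\<close> need not be a whole fibre, scaling by zero
  being the extreme case; multiplying by the kernel completes it. Scaling on cosets has this form in
  \<open>quotient_module\<close> and in \<open>base_change\<close>.\<close>

lemma (in group_hom) kernel_mult_image_fiber:
  assumes x: "x \<in> carrier G" and f: "f \<in> carrier G \<rightarrow> carrier G"
    and hf: "\<And>y. y \<in> carrier G \<Longrightarrow> h y = h x \<Longrightarrow> h (f y) = h (f x)"
  shows "kernel G H h <#> f ` {y \<in> carrier G. h y = h x} = {y \<in> carrier G. h y = h (f x)}"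
proof
  have fx: "f x \<in> carrier G" using x f by auto
  show "kernel G H h <#> f ` {y \<in> carrier G. h y = h x} \<subseteq> {y \<in> carrier G. h y = h (f x)}"
  proof
    fix z assume "z \<in> kernel G H h <#> f ` {y \<in> carrier G. h y = h x}"
    then obtain k y where k: "k \<in> carrier G" "h k = \<one>\<^bsub>H\<^esub>" and y: "y \<in> carrier G" "h y = h x"
      and z: "z = k \<otimes> f y"
      unfolding set_mult_def kernel_def by blast
    have "f y \<in> carrier G" using f y by auto
    then show "z \<in> {y \<in> carrier G. h y = h (f x)}" using hf[OF y] fx k z by simp
  qed
  have "{y \<in> carrier G. h y = h (f x)} = kernel G H h #> f x"
    using rcoset_kernel_eq[OF fx] by simp
  also have "\<dots> \<subseteq> kernel G H h <#> f ` {y \<in> carrier G. h y = h x}"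
    using x unfolding r_coset_def set_mult_def by blast
  finally show "{y \<in> carrier G. h y = h (f x)} \<subseteq> kernel G H h <#> f ` {y \<in> carrier G. h y = h x}" .
qed

lemma (in group_hom) the_elem_image_fiber:
  "x \<in> carrier G \<Longrightarrow> the_elem (h ` {y \<in> carrier G. h y = h x}) = h x"
  by (rule the_elem_image_unique) auto

lemma (in group_hom) rcosets_kernel_eq:
  "rcosets (kernel G H h) = (\<lambda>x. {y \<in> carrier G. h y = h x}) ` carrier G"
  using rcoset_kernel_eq unfolding RCOSETS_def by auto

text \<open>The first isomorphism theorem in coordinates: a coset of \<open>K\<close> goes to the
  common value of \<open>\<psi>\<close> on it. \<open>G\<close> is only a group and
  \<open>g a\<close> a lift of scaling by \<open>a\<close> to it, so that the free abelian group
  behind a tensor product is covered as well as the additive group of a module.\<close>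

lemma (in cring) coordinates_cosets:
  fixes Q :: "('a, 'g set, 'c) module_scheme"
  assumes hom: "group_hom G (add_monoid (free_module R J)) \<psi>"
    and surj: "\<psi> ` carrier G = J \<rightarrow>\<^sub>E carrier R"
    and K: "K = {x \<in> carrier G. \<psi> x = (\<lambda>i\<in>J. \<zero>)}"
    and Q: "carrier Q = rcosets\<^bsub>G\<^esub> K" "\<zero>\<^bsub>Q\<^esub> = K" "add Q = set_mult G"
    and g: "\<And>a. a \<in> carrier R \<Longrightarrow> g a \<in> carrier G \<rightarrow> carrier G"
      "\<And>a x. a \<in> carrier R \<Longrightarrow> x \<in> carrier G \<Longrightarrow> \<psi> (g a x) = (\<lambda>i\<in>J. a \<otimes> \<psi> x i)"
      "\<And>a C. a \<in> carrier R \<Longrightarrow> C \<in> carrier Q \<Longrightarrow> a \<odot>\<^bsub>Q\<^esub> C = K <#>\<^bsub>G\<^esub> g a ` C"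
  shows "coordinates R Q J (\<lambda>C. the_elem (\<psi> ` C))"
proof -
  interpret group_hom G "add_monoid (free_module R J)" \<psi> by fact
  have ker: "kernel G (add_monoid (free_module R J)) \<psi> = K"
    by (simp add: kernel_def K free_module_def)
  define F where "F x = {y \<in> carrier G. \<psi> y = \<psi> x}" for x
  have carrier_Q: "carrier Q = F ` carrier G"
    using rcosets_kernel_eq unfolding Q(1) ker F_def by blast
  have the_F: "the_elem (\<psi> ` F x) = \<psi> x" if "x \<in> carrier G" for x
    unfolding F_def using that by (rule the_elem_image_fiber)
  have F_cong: "F x = F y" if "\<psi> x = \<psi> y" for x y using that by (simp add: F_def)
  have K_F: "K = F \<one>\<^bsub>G\<^esub>" using hom_one by (simp add: F_def K free_module_def)
  have add_F: "F x \<oplus>\<^bsub>Q\<^esub> F y = F (x \<otimes>\<^bsub>G\<^esub> y)" if "x \<in> carrier G" "y \<in> carrier G" for x y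
    unfolding Q(3) F_def using that by (rule fiber_mult)
  have smult_F: "a \<odot>\<^bsub>Q\<^esub> F x = F (g a x)" if "a \<in> carrier R" "x \<in> carrier G" for a x
  proof -
    have "a \<odot>\<^bsub>Q\<^esub> F x = K <#>\<^bsub>G\<^esub> g a ` F x" using that g(3) carrier_Q by blast
    also have "\<dots> = F (g a x)"
      unfolding F_def ker[symmetric] using that g
      by (intro kernel_mult_image_fiber) simp_all
    finally show ?thesis .
  qed
  have g_closed: "g a x \<in> carrier G" if "a \<in> carrier R" "x \<in> carrier G" for a x
    using g(1)[OF that(1)] that by auto
  show ?thesis
  proof
    have "inj_on (\<lambda>C. the_elem (\<psi> ` C)) (carrier Q)"
      unfolding carrier_Q by (rule inj_onI, clarsimp simp: the_F, rule F_cong)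
    moreover have "(\<lambda>C. the_elem (\<psi> ` C)) ` carrier Q = J \<rightarrow>\<^sub>E carrier R"
      unfolding carrier_Q surj[symmetric] by (force simp: the_F)
    ultimately show "bij_betw (\<lambda>C. the_elem (\<psi> ` C)) (carrier Q) (J \<rightarrow>\<^sub>E carrier R)"
      by (simp add: bij_betw_def)
    show "\<zero>\<^bsub>Q\<^esub> \<in> carrier Q" unfolding Q(2) K_F carrier_Q by simp
    show "the_elem (\<psi> ` \<zero>\<^bsub>Q\<^esub>) = (\<lambda>i\<in>J. \<zero>)"
      unfolding Q(2) K_F using hom_one by (simp add: the_F free_module_def)
    fix C D assume C: "C \<in> carrier Q" and D: "D \<in> carrier Q"
    show "C \<oplus>\<^bsub>Q\<^esub> D \<in> carrier Q" using C D unfolding carrier_Q by (auto simp: add_F)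
    show "the_elem (\<psi> ` (C \<oplus>\<^bsub>Q\<^esub> D)) = (\<lambda>i\<in>J. the_elem (\<psi> ` C) i \<oplus> the_elem (\<psi> ` D) i)"
      using C D unfolding carrier_Q by (auto simp: add_F the_F free_module_def)
  next
    fix a C assume a: "a \<in> carrier R" and C: "C \<in> carrier Q"
    show "a \<odot>\<^bsub>Q\<^esub> C \<in> carrier Q" using a C unfolding carrier_Q by (auto simp: smult_F g_closed)
    show "the_elem (\<psi> ` (a \<odot>\<^bsub>Q\<^esub> C)) = (\<lambda>i\<in>J. a \<otimes> the_elem (\<psi> ` C) i)"
      using a C unfolding carrier_Q by (auto simp: smult_F g_closed the_F g(2))
  qed
qed

text \<open>The submodule \<open>graph\<close> is the graph of a linear map from the coordinates in \<open>P\<close> to the others. The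
  value \<open>r i\<close> is irrelevant if \<open>c i = 0\<close>.\<close>

locale graph_submodule = coordinates A M I \<phi>
  for A (structure) and M :: "('a, 'm, 'c) module_scheme" and I :: "'i set" and \<phi> +
  fixes P :: "'i set" and c :: "'i \<Rightarrow> 'a" and r :: "'i \<Rightarrow> 'i"
  assumes P: "P \<subseteq> I" and c: "\<And>i. i \<in> I - P \<Longrightarrow> c i \<in> carrier A"
    and r: "\<And>i. i \<in> I - P \<Longrightarrow> r i \<in> I" "\<And>i. i \<in> I - P \<Longrightarrow> r i \<in> P \<or> c i = \<zero>"
begin

definition graph :: "'m set" where
  "graph = {v \<in> carrier M. \<forall>i\<in>I - P. \<phi> v i = c i \<otimes> \<phi> v (r i)}"

lemma coordinates_graph: "coordinates A (M\<lparr>carrier := graph\<rparr>) P (\<lambda>v. restrict (\<phi> v) P)"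
proof
  have "inj_on (\<lambda>v. restrict (\<phi> v) P) graph"
  proof (rule inj_onI)
    fix v w assume v: "v \<in> graph" and w: "w \<in> graph" and eq: "restrict (\<phi> v) P = restrict (\<phi> w) P"
    have eqP: "\<phi> v i = \<phi> w i" if "i \<in> P" for i using fun_cong[OF eq, of i] that by simp
    have "\<phi> v i = \<phi> w i" if i: "i \<in> I - P" for i
      using r[OF i] v w i eqP[of "r i"] by (auto simp: graph_def)
    then have "\<phi> v i = \<phi> w i" if "i \<in> I" for i using eqP[of i] that by blast
    then show "v = w" using v w by (intro coord_eqI) (auto simp: graph_def)
  qed
  moreover have "(\<lambda>v. restrict (\<phi> v) P) ` graph = P \<rightarrow>\<^sub>E carrier A"
  proof
    show "(\<lambda>v. restrict (\<phi> v) P) ` graph \<subseteq> P \<rightarrow>\<^sub>E carrier A" using P by (auto simp: graph_def)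
    show "P \<rightarrow>\<^sub>E carrier A \<subseteq> (\<lambda>v. restrict (\<phi> v) P) ` graph"
    proof
      fix u assume u: "u \<in> P \<rightarrow>\<^sub>E carrier A"
      \<comment> \<open>Extend \<open>u\<close> by the relations. Where \<open>r i\<close> lies
        outside \<open>P\<close>, the coefficient \<open>c i\<close> is \<open>\<zero>\<close> and
        forces the value \<open>\<zero>\<close>.\<close>
      define v where "v = (\<lambda>i\<in>I. if i \<in> P then u i else if r i \<in> P then c i \<otimes> u (r i) else \<zero>)"
      have uP: "u i \<in> carrier A" if "i \<in> P" for i using u that by blast
      have v: "v \<in> I \<rightarrow>\<^sub>E carrier A" using uP P c by (auto simp: v_def)
      have vc: "v i = c i \<otimes> v (r i)" if i: "i \<in> I - P" for i
      proof (cases "r i \<in> P")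
        case True
        then show ?thesis using i P by (simp add: v_def subset_iff)
      next
        case False
        then have "v i = \<zero>" "c i = \<zero>" using i r[OF i] by (simp_all add: v_def)
        then show ?thesis using PiE_mem[OF v r(1)[OF i]] by simp
      qed
      have "of_coord v \<in> graph"
        using vc by (simp add: graph_def of_coord_closed[OF v] coord_of_coord[OF v])
      moreover have "restrict (\<phi> (of_coord v)) P = u"
      proof
        fix i
        show "restrict (\<phi> (of_coord v)) P i = u i"
          unfolding coord_of_coord[OF v] using P PiE_arb[OF u, of i]
          by (cases "i \<in> P") (simp_all add: v_def subset_iff)
      qed
      ultimately show "u \<in> (\<lambda>v. restrict (\<phi> v) P) ` graph" by blast
    qed
  qed
  ultimately show "bij_betw (\<lambda>v. restrict (\<phi> v) P) (carrier (M\<lparr>carrier := graph\<rparr>)) (P \<rightarrow>\<^sub>E carrier A)"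
    by (simp add: bij_betw_def)
next
  show "\<zero>\<^bsub>M\<lparr>carrier := graph\<rparr>\<^esub> \<in> carrier (M\<lparr>carrier := graph\<rparr>)"
    using r c by (simp add: graph_def zero_coord)
  show "restrict (\<phi> \<zero>\<^bsub>M\<lparr>carrier := graph\<rparr>\<^esub>) P = (\<lambda>i\<in>P. \<zero>)"
    by (simp add: zero_coord Int_absorb1[OF P])
next
  fix x y assume "x \<in> carrier (M\<lparr>carrier := graph\<rparr>)" "y \<in> carrier (M\<lparr>carrier := graph\<rparr>)"
  then have xy: "x \<in> carrier M" "y \<in> carrier M"
    and eq: "\<And>i. i \<in> I - P \<Longrightarrow> \<phi> x i = c i \<otimes> \<phi> x (r i)" "\<And>i. i \<in> I - P \<Longrightarrow> \<phi> y i = c i \<otimes> \<phi> y (r i)"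
    by (simp_all add: graph_def)
  have "\<phi> (x \<oplus>\<^bsub>M\<^esub> y) i = c i \<otimes> \<phi> (x \<oplus>\<^bsub>M\<^esub> y) (r i)" if i: "i \<in> I - P" for i
  proof -
    have "\<phi> (x \<oplus>\<^bsub>M\<^esub> y) i = c i \<otimes> \<phi> x (r i) \<oplus> c i \<otimes> \<phi> y (r i)"
      using i xy by (simp add: add_coord eq[OF i, symmetric])
    also have "\<dots> = c i \<otimes> \<phi> (x \<oplus>\<^bsub>M\<^esub> y) (r i)"
      using xy r(1)[OF i] c[OF i] by (simp add: add_coord R.r_distr)
    finally show ?thesis .
  qed
  then show "x \<oplus>\<^bsub>M\<lparr>carrier := graph\<rparr>\<^esub> y \<in> carrier (M\<lparr>carrier := graph\<rparr>)"
    using xy by (simp add: graph_def add_coord(1))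
  show "restrict (\<phi> (x \<oplus>\<^bsub>M\<lparr>carrier := graph\<rparr>\<^esub> y)) P = (\<lambda>i\<in>P. restrict (\<phi> x) P i \<oplus> restrict (\<phi> y) P i)"
    using xy P by (intro restrict_ext) (auto simp: add_coord)
next
  fix a x assume a: "a \<in> carrier A" and "x \<in> carrier (M\<lparr>carrier := graph\<rparr>)"
  then have x: "x \<in> carrier M" and eq: "\<And>i. i \<in> I - P \<Longrightarrow> \<phi> x i = c i \<otimes> \<phi> x (r i)"
    by (simp_all add: graph_def)
  have "\<phi> (a \<odot>\<^bsub>M\<^esub> x) i = c i \<otimes> \<phi> (a \<odot>\<^bsub>M\<^esub> x) (r i)" if i: "i \<in> I - P" for i
  proof -
    have "\<phi> (a \<odot>\<^bsub>M\<^esub> x) i = a \<otimes> (c i \<otimes> \<phi> x (r i))"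
      using i x a by (simp add: smult_coord eq[OF i, symmetric])
    also have "\<dots> = c i \<otimes> \<phi> (a \<odot>\<^bsub>M\<^esub> x) (r i)"
      using x a r(1)[OF i] c[OF i] by (simp add: smult_coord R.m_lcomm)
    finally show ?thesis .
  qed
  then show "a \<odot>\<^bsub>M\<lparr>carrier := graph\<rparr>\<^esub> x \<in> carrier (M\<lparr>carrier := graph\<rparr>)"
    using a x by (simp add: graph_def smult_coord(1))
  show "restrict (\<phi> (a \<odot>\<^bsub>M\<lparr>carrier := graph\<rparr>\<^esub> x)) P = (\<lambda>i\<in>P. a \<otimes> restrict (\<phi> x) P i)"
    using a x P by (intro restrict_ext) (auto simp: smult_coord)
qed

text \<open>The failure of the relations. Its kernel is \<open>graph\<close> and it is onto the
  tuples on \<open>I - P\<close>, so it identifies the quotient with these tuples.\<close>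

definition graph_defect :: "'m \<Rightarrow> 'i \<Rightarrow> 'a" where
  "graph_defect v = (\<lambda>i\<in>I - P. \<phi> v i \<ominus> c i \<otimes> \<phi> v (r i))"

lemma graph_defect_hom: "group_hom (add_monoid M) (add_monoid (free_module A (I - P))) graph_defect"
proof -
  interpret F: coordinates A "free_module A (I - P)" "I - P" "\<lambda>v. v" by (rule coordinates_free_module)
  show ?thesis
  proof (intro group_hom.intro group_hom_axioms.intro)
    show "graph_defect \<in> hom (add_monoid M) (add_monoid (free_module A (I - P)))"
    proof (rule homI)
      fix v w assume vw: "v \<in> carrier (add_monoid M)" "w \<in> carrier (add_monoid M)"
      show "graph_defect (v \<otimes>\<^bsub>add_monoid M\<^esub> w)
          = graph_defect v \<otimes>\<^bsub>add_monoid (free_module A (I - P))\<^esub> graph_defect w"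
        using vw r c
        by (auto simp: graph_defect_def free_module_def fun_eq_iff add_coord r_distr R.minus_add
            R.minus_eq R.a_ac)
    qed (use r c in \<open>auto simp: graph_defect_def free_module_def\<close>)
  qed (auto intro: M.a_group F.M.a_group)
qed

lemma graph_defect_surj: "graph_defect ` carrier M = (I - P) \<rightarrow>\<^sub>E carrier A"
proof
  show "graph_defect ` carrier M \<subseteq> (I - P) \<rightarrow>\<^sub>E carrier A"
    using r c by (intro image_subsetI) (simp add: graph_defect_def restrict_PiE_iff)
  show "(I - P) \<rightarrow>\<^sub>E carrier A \<subseteq> graph_defect ` carrier M"
  proof
    fix u assume u: "u \<in> (I - P) \<rightarrow>\<^sub>E carrier A"
    \<comment> \<open>Vectors vanishing on \<open>P\<close> suffice: for them the correction
      \<open>c i \<otimes> v (r i)\<close> is zero, either because \<open>r i \<in> P\<close> or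
      because \<open>c i = \<zero>\<close>.\<close>
    define v where "v = (\<lambda>i\<in>I. if i \<in> P then \<zero> else u i)"
    have v: "v \<in> I \<rightarrow>\<^sub>E carrier A" using u by (auto simp: v_def)
    have "c i \<otimes> v (r i) = \<zero>" if "i \<in> I - P" for i
      using r[OF that] c[OF that] PiE_mem[OF v r(1)[OF that]] by (auto simp: v_def)
    then have "graph_defect (of_coord v) = u"
      using u v by (auto simp: graph_defect_def coord_of_coord fun_eq_iff PiE_iff extensional_def
          R.minus_eq) (auto simp: v_def)
    then show "u \<in> graph_defect ` carrier M" using of_coord_closed[OF v] by blast
  qed
qed

lemma graph_defect_eq_zero_iff:
  assumes "v \<in> carrier M"
  shows "graph_defect v = (\<lambda>i\<in>I - P. \<zero>) \<longleftrightarrow> (\<forall>i\<in>I - P. \<phi> v i = c i \<otimes> \<phi> v (r i))"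
proof -
  have "\<phi> v i \<ominus> c i \<otimes> \<phi> v (r i) = \<zero> \<longleftrightarrow> \<phi> v i = c i \<otimes> \<phi> v (r i)" if "i \<in> I - P" for i
    using that assms r[OF that] c[OF that] by (intro R.r_right_minus_eq) auto
  then show ?thesis by (auto simp add: graph_defect_def restrict_def fun_eq_iff)
qed

lemma coordinates_quotient:
  "coordinates A (quotient_module M graph) (I - P) (\<lambda>C. the_elem (graph_defect ` C))"
proof (rule coordinates_cosets[where G = "add_monoid M" and g = "\<lambda>a x. a \<odot>\<^bsub>M\<^esub> x" and K = graph])
  show "graph = {x \<in> carrier (add_monoid M). graph_defect x = (\<lambda>i\<in>I - P. \<zero>)}"
    using graph_defect_eq_zero_iff by (auto simp: graph_def)
  fix a x assume "a \<in> carrier A" "x \<in> carrier (add_monoid M)"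
  then show "graph_defect (a \<odot>\<^bsub>M\<^esub> x) = (\<lambda>i\<in>I - P. a \<otimes> graph_defect x i)"
    using r c by (auto simp: graph_defect_def fun_eq_iff smult_coord R.minus_eq R.r_distr R.r_minus R.m_lcomm)
next
  show "group_hom (add_monoid M) (add_monoid (free_module A (I - P))) graph_defect"
    by (rule graph_defect_hom)
  show "graph_defect ` carrier (add_monoid M) = I - P \<rightarrow>\<^sub>E carrier A"
    using graph_defect_surj by simp
qed (simp_all add: quotient_module_def A_RCOSETS_def set_add_def smult_coord)

end

section \<open>Fixed vectors of affine permutations\<close>

text \<open>The equivalence relation generated by \<open>x \<sim> f x\<close>, described by the invariant predicates instead of
  by the powers of \<open>f\<close>.\<close>

definition same_orbit :: "(int \<Rightarrow> int) \<Rightarrow> int \<Rightarrow> int \<Rightarrow> bool" where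
  "same_orbit f x y \<longleftrightarrow> (\<forall>Q :: int \<Rightarrow> bool. (\<forall>x. Q (f x) = Q x) \<longrightarrow> Q x = Q y)"

lemma same_orbit_refl: "same_orbit f x x"
  by (simp add: same_orbit_def)

lemma same_orbit_sym: "same_orbit f x y \<Longrightarrow> same_orbit f y x"
  by (simp add: same_orbit_def eq_commute[of "_ x" "_ y"])

lemma same_orbit_trans: "same_orbit f x y \<Longrightarrow> same_orbit f y w \<Longrightarrow> same_orbit f x w"
  by (simp add: same_orbit_def) (metis (full_types))

lemma same_orbit_step: "same_orbit f x (f x)"
  by (simp add: same_orbit_def)

text \<open>Invariant functions reduce to invariant predicates by asking where the value at
  \<open>x\<close> is attained.\<close>

lemma same_orbit_invariant:
  assumes "same_orbit f x y" "\<And>x. u (f x) = u x"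
  shows "u x = u y"
proof -
  have "(u x = u x) = (u y = u x)"
    using assms(1)[unfolded same_orbit_def, rule_format, of "\<lambda>w. u w = u x"] assms(2) by simp
  then show ?thesis by simp
qed

lemma same_orbit_fixed:
  assumes "same_orbit f x y" "inj f" "f x = x"
  shows "y = x"
proof -
  have "f w = x \<longleftrightarrow> w = x" for w using assms(2,3) by (metis injD)
  then show ?thesis using assms(1)[unfolded same_orbit_def, rule_format, of "\<lambda>w. w = x"] by simp
qed

text \<open>If \<open>Q\<close> is invariant under \<open>f\<close>, so is its translate by a
  multiple of \<open>n\<close>.\<close>

lemma same_orbit_shift:
  assumes f: "affine_perm n f" and "same_orbit f x y"
  shows "same_orbit f (x + k * int n) (y + k * int n)"
  unfolding same_orbit_def
proof (intro allI impI)
  fix Q :: "int \<Rightarrow> bool"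
  assume "\<forall>x. Q (f x) = Q x"
  then have "Q (f x + k * int n) = Q (x + k * int n)" for x
    using affine_perm_shift[OF f, of x k] by metis
  then show "Q (x + k * int n) = Q (y + k * int n)"
    using assms(2)[unfolded same_orbit_def, rule_format, of "\<lambda>w. Q (w + k * int n)"] by simp
qed

section \<open>Orbits modulo translation by multiples of \<open>n\<close>\<close>

locale affine_orbits =
  fixes n :: nat and f :: "int \<Rightarrow> int"
  assumes n: "n > 0" and f: "affine_perm n f"
begin

lemma Omega_mod [simp]: "x mod int n \<in> Omega n"
  using n by (simp add: Omega_eq)

lemma Omega_modD: "i \<in> Omega n \<Longrightarrow> i mod int n = i"
  using n by (simp add: Omega_eq)

text \<open>These classes are the orbits of the permutation that \<open>f\<close> induces on the
  integers modulo \<open>n\<close>.\<close>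

definition same_class :: "int \<Rightarrow> int \<Rightarrow> bool" where
  "same_class i j \<longleftrightarrow> (\<exists>k. same_orbit f i (j + k * int n))"

text \<open>The orbit meets none of its proper translates. On all other orbits a fixed vector
  vanishes, so they carry no free coordinate.\<close>

definition good :: "int \<Rightarrow> bool" where
  "good i \<longleftrightarrow> (\<forall>k. same_orbit f i (i + k * int n) \<longrightarrow> k = 0)"

definition rep :: "int \<Rightarrow> int" where
  "rep i = (SOME j. j \<in> Omega n \<and> same_class i j)"

text \<open>For a good \<open>i\<close> the value is unique; it enters the exponent of zeta that
  relates the coordinates at \<open>i\<close> and at \<open>rep i\<close>.\<close>

definition offset :: "int \<Rightarrow> int" where
  "offset i = (SOME k. same_orbit f i (rep i + k * int n))"

text \<open>The free coordinates, one for each good class.\<close>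

definition reps :: "int set" where
  "reps = {i \<in> Omega n. good i \<and> rep i = i}"

lemma same_class_sym:
  assumes "same_class i j"
  shows "same_class j i"
proof -
  obtain k where "same_orbit f i (j + k * int n)" using assms by (auto simp: same_class_def)
  from same_orbit_shift[OF f same_orbit_sym[OF this], of "- k"]
  show ?thesis unfolding same_class_def by (intro exI[of _ "- k"]) simp
qed

lemma same_class_trans:
  assumes "same_class i j" "same_class j l"
  shows "same_class i l"
proof -
  obtain k m where "same_orbit f i (j + k * int n)" "same_orbit f j (l + m * int n)"
    using assms by (auto simp: same_class_def)
  from same_orbit_trans[OF this(1) same_orbit_shift[OF f this(2)]]
  show ?thesis unfolding same_class_def by (intro exI[of _ "m + k"]) (simp add: algebra_simps)
qed

lemma rep_same_class: "rep i \<in> Omega n" "same_class i (rep i)"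
proof -
  have "same_class i (i mod int n)"
    unfolding same_class_def
    by (rule exI[of _ "i div int n"]) (simp add: same_orbit_refl)
  then have "\<exists>j. j \<in> Omega n \<and> same_class i j" using Omega_mod by blast
  from someI_ex[OF this] show "rep i \<in> Omega n" "same_class i (rep i)"
    by (simp_all add: rep_def)
qed

lemma offset: "same_orbit f i (rep i + offset i * int n)"
  using rep_same_class(2)[of i] someI_ex unfolding same_class_def offset_def by fast

text \<open>Equivalent indices define the same predicate and hence the same choice.\<close>

lemma rep_cong:
  assumes "same_class i j"
  shows "rep i = rep j"
proof -
  have "same_class i l \<longleftrightarrow> same_class j l" for l
    using assms same_class_sym same_class_trans by blast
  then show ?thesis by (simp add: rep_def)
qed

lemma good_cong:
  assumes "same_class i j" "good i"
  shows "good j"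
  unfolding good_def
proof (intro allI impI)
  fix k assume j: "same_orbit f j (j + k * int n)"
  obtain l where l: "same_orbit f i (j + l * int n)" using assms by (auto simp: same_class_def)
  have "same_orbit f (j + l * int n) (j + k * int n + l * int n)"
    by (rule same_orbit_shift[OF f j])
  moreover have "same_orbit f (j + k * int n + l * int n) (i + k * int n)"
    using same_orbit_shift[OF f same_orbit_sym[OF l], of k] by (simp add: algebra_simps)
  ultimately have "same_orbit f i (i + k * int n)" using l same_orbit_trans by blast
  then show "k = 0" using assms(2) by (simp add: good_def)
qed

lemma same_class_perm_mod: "same_class x (f x mod int n)"
  unfolding same_class_def
  by (rule exI[of _ "f x div int n"]) (simp add: same_orbit_step)

text \<open>A class has only one representative, so if \<open>f p mod int n\<close> is one, it is
  \<open>p\<close>; then \<open>f p\<close> is a translate of \<open>p\<close> in its orbit, and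
  goodness makes it \<open>p\<close> itself.\<close>

lemma perm_of_rep:
  assumes p: "p \<in> reps"
  shows "f p = p \<or> f p mod int n \<notin> reps"
proof (rule disjCI)
  assume "\<not> f p mod int n \<notin> reps"
  then have "f p mod int n = rep (f p mod int n)" by (simp add: reps_def)
  also have "\<dots> = rep p" using rep_cong[OF same_class_perm_mod] by simp
  finally have "f p mod int n = p" using p by (simp add: reps_def)
  then have "f p = p + (f p div int n) * int n" using mod_mult_div_eq[of "f p" "int n"] by (simp add: mult.commute)
  moreover from this have "f p div int n = 0"
    using p same_orbit_step[of f p] unfolding reps_def good_def by auto
  ultimately show "f p = p" by simp
qed

text \<open>Let \<open>t\<close> be the only residue outside \<open>reps\<close>. Every other
  residue is fixed by \<open>f\<close> or sent into the class of \<open>t\<close>, and injectivity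
  modulo \<open>n\<close> allows the latter only once. The total displacement zero does the rest: it
  excludes that \<open>f\<close> moves the class of \<open>t\<close> alone, and it makes the
  displacements of \<open>t\<close> and its partner opposite.\<close>

lemma swap_of_card_1:
  assumes card: "card (Omega n - reps) = 1"
  obtains a b where "f = affine_swap n a b" "\<not> int n dvd a - b"
proof -
  obtain t where t: "Omega n - reps = {t}" using card by (rule card_1_singletonE)
  then have t_in: "t \<in> Omega n" "t \<notin> reps" by auto
  have rep_iff: "p \<in> reps \<longleftrightarrow> p \<noteq> t" if "p \<in> Omega n" for p using t that by auto
  have fixed: "f p = p \<or> f p mod int n = t" if "p \<in> Omega n" "p \<noteq> t" for p
    using perm_of_rep[of p] rep_iff that rep_iff[of "f p mod int n"] by auto
  have bij: "bij_betw (\<lambda>x. f x mod int n) (Omega n) (Omega n)"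
    using bij_betw_affine_perm_mod[OF f n] n by (simp add: Omega_eq)
  have inj: "x = y" if "x \<in> Omega n" "y \<in> Omega n" "f x mod int n = f y mod int n" for x y
    using inj_onD[OF bij_betw_imp_inj_on[OF bij], of x y] that by blast
  have fin: "finite (Omega n)" using n by (simp add: Omega_eq)
  have sum0: "(\<Sum>x\<in>Omega n. f x - x) = 0" using f n by (simp add: affine_perm_def Omega_eq)
  \<comment> \<open>If \<open>f\<close> kept the class of \<open>t\<close>, all other residues would
    be fixed, so the vanishing sum would give \<open>f t = t\<close>; then \<open>t\<close> would be
    good and its own representative.\<close>
  have ft: "f t mod int n \<noteq> t"
  proof
    assume ft: "f t mod int n = t"
    have "f x - x = 0" if "x \<in> Omega n - {t}" for x
      using fixed[of x] inj[of x t] ft that t_in by auto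
    then have "(\<Sum>x\<in>Omega n - {t}. f x - x) = 0" by simp
    then have "f t = t" using sum0 sum.remove[OF fin t_in(1), of "\<lambda>x. f x - x"] by simp
    then have single: "y = t" if "same_orbit f t y" for y
      using same_orbit_fixed[OF that] f by (simp add: affine_perm_def bij_is_inj)
    have "good t"
      unfolding good_def
    proof (intro allI impI)
      fix k assume "same_orbit f t (t + k * int n)"
      from single[OF this] n show "k = 0" by simp
    qed
    moreover have "rep t = t"
    proof -
      have "(rep t + offset t * int n) mod int n = t mod int n" using single[OF offset] by simp
      then show ?thesis using Omega_modD rep_same_class(1) t_in by simp
    qed
    ultimately show False using t_in by (simp add: reps_def)
  qed
  obtain p where p: "p \<in> Omega n" "f p mod int n = t"
  proof -
    have "t \<in> (\<lambda>x. f x mod int n) ` Omega n" using bij t_in by (simp add: bij_betw_def)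
    then show thesis using that by auto
  qed
  have pt: "p \<noteq> t" using p ft by auto
  have others: "f x = x" if "x \<in> Omega n" "x \<noteq> t" "x \<noteq> p" for x
    using fixed[OF that(1,2)] inj[OF that(1) p(1)] that(3) p(2) by auto
  \<comment> \<open>Otherwise \<open>f t mod int n\<close> would be fixed by \<open>f\<close>, and
    injectivity modulo \<open>n\<close> would identify it with \<open>t\<close>.\<close>
  have ftp: "f t mod int n = p"
  proof (rule ccontr)
    assume ne: "f t mod int n \<noteq> p"
    then have "f (f t mod int n) mod int n = f t mod int n" using others[of "f t mod int n"] ft by simp
    then show False using inj[of "f t mod int n" t] ft t_in by simp
  qed
  have "(\<Sum>x\<in>Omega n. f x - x) = (f t - t) + (f p - p) + (\<Sum>x\<in>Omega n - {t} - {p}. f x - x)"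
    using sum.remove[OF fin t_in(1), of "\<lambda>x. f x - x"]
      sum.remove[of "Omega n - {t}" p "\<lambda>x. f x - x"] fin p pt by simp
  also have "(\<Sum>x\<in>Omega n - {t} - {p}. f x - x) = 0"
    by (rule sum.neutral) (auto simp: others)
  finally have sum_eq: "f t - t + (f p - p) = 0" using sum0 by simp
  \<comment> \<open>The second argument is \<open>f p\<close> rather than its residue
    \<open>t\<close>, because the displacement of \<open>p\<close> is
    \<open>f p - p\<close>.\<close>
  have "f x = affine_swap n p (f p) x" for x
  proof -
    define i k where "i = x mod int n" and "k = x div int n"
    have x: "x = i + k * int n" by (simp add: i_def k_def)
    have fx: "f x = f i + k * int n" using affine_perm_shift[OF f] x by simp
    have i: "i \<in> Omega n" by (simp add: i_def)
    have d1: "int n dvd x - p \<longleftrightarrow> i = p"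
      using Omega_modD[OF p(1)] by (simp add: i_def mod_eq_dvd_iff[symmetric])
    have d2: "int n dvd x - f p \<longleftrightarrow> i = t"
      using p(2) by (simp add: i_def mod_eq_dvd_iff[symmetric])
    show ?thesis using d1 d2 fx x others[OF i] sum_eq by (auto simp: affine_swap_def)
  qed
  then have "f = affine_swap n p (f p)" by (rule ext)
  moreover have "\<not> int n dvd p - f p"
    using Omega_modD[OF p(1)] p(2) pt by (simp add: mod_eq_dvd_iff[symmetric])
  ultimately show thesis using that by blast
qed

end

text \<open>\<open>z\<close> is an injective homomorphism from the integers to the units of
  \<open>A\<close>. Keeping it abstract lets one argument serve the Laurent ring and every algebra
  in which zeta has infinite order.\<close>

locale affine_monomial = domain A for A (structure) +
  fixes n :: nat and z :: "int \<Rightarrow> 'a"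
  assumes n: "n > 0"
    and z_closed [simp, intro]: "z k \<in> carrier A"
    and z_0 [simp]: "z 0 = \<one>"
    and z_add: "z (k + l) = z k \<otimes> z l"
    and z_inj: "z k = \<one> \<Longrightarrow> k = 0"
begin

lemma Omega_mod [simp]: "x mod int n \<in> Omega n"
  using n by (simp add: Omega_eq)

text \<open>The coefficient of \<open>y\<^sub>x = \<zeta>\<^sup>x x\<^bsub>x mod n\<^esub>\<close>, where \<open>z k\<close> stands for \<open>\<zeta>\<^sup>k\<close>.\<close>

definition ext_coord :: "(int \<Rightarrow> 'a) \<Rightarrow> int \<Rightarrow> 'a" where
  "ext_coord v x = z (- x) \<otimes> v (x mod int n)"

text \<open>The linear map sending \<open>y_j\<close> to \<open>y_(f j)\<close>, read off in the
  coordinates at the \<open>x_i\<close>: the new coefficient at \<open>i\<close> comes from the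
  preimage of \<open>i\<close>, and the power of zeta accounts for the change of basis.\<close>

definition perm_action :: "(int \<Rightarrow> int) \<Rightarrow> (int \<Rightarrow> 'a) \<Rightarrow> int \<Rightarrow> 'a" where
  "perm_action f v = (\<lambda>i\<in>Omega n. z (i - inv_into UNIV f i) \<otimes> v (inv_into UNIV f i mod int n))"

abbreviation "vectors \<equiv> Omega n \<rightarrow>\<^sub>E carrier A"

lemma vector_closed [simp, intro]: "v \<in> vectors \<Longrightarrow> v (x mod int n) \<in> carrier A"
  using Omega_mod by blast

lemma ext_coord_closed [simp, intro]: "v \<in> vectors \<Longrightarrow> ext_coord v x \<in> carrier A"
  by (simp add: ext_coord_def)

lemma z_mult: "z k \<otimes> z l = z (k + l)"
  by (simp add: z_add)

lemma z_mult_left: "a \<in> carrier A \<Longrightarrow> z k \<otimes> (z l \<otimes> a) = z (k + l) \<otimes> a"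
  by (simp add: z_add m_assoc)

lemma vector_eq_ext_coord: "v \<in> vectors \<Longrightarrow> v (x mod int n) = z x \<otimes> ext_coord v x"
  by (simp add: ext_coord_def z_mult_left)

lemma ext_coord_shift:
  assumes "v \<in> vectors"
  shows "ext_coord v (x + k * int n) = z (- (k * int n)) \<otimes> ext_coord v x"
proof -
  have "- (x + k * int n) = - (k * int n) + (- x)" by simp
  then have "z (- (x + k * int n)) = z (- (k * int n)) \<otimes> z (- x)" using z_add by metis
  then show ?thesis using assms by (simp add: ext_coord_def m_assoc del: minus_add_distrib)
qed

lemma vector_eqI:
  assumes v: "v \<in> vectors" and w: "w \<in> vectors" and eq: "\<And>x. ext_coord v x = ext_coord w x"
  shows "v = w"
proof (rule PiE_ext[OF v w])
  fix i assume "i \<in> Omega n"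
  then have "i mod int n = i" using n by (simp add: Omega_eq)
  then show "v i = w i" using vector_eq_ext_coord[OF v, of i] vector_eq_ext_coord[OF w, of i] eq by simp
qed

lemma perm_action_closed [simp, intro]: "v \<in> vectors \<Longrightarrow> perm_action f v \<in> vectors"
  by (simp add: perm_action_def restrict_PiE_iff)

lemma ext_coord_perm_action:
  assumes f: "affine_perm n f" and v: "v \<in> vectors"
  shows "ext_coord (perm_action f v) x = ext_coord v (inv_into UNIV f x)"
proof -
  define i k where "i = x mod int n" and "k = x div int n"
  have x: "x = i + k * int n" by (simp add: i_def k_def)
  have inv_x: "inv_into UNIV f x = inv_into UNIV f i + k * int n"
    unfolding x by (rule affine_perm_inv_shift[OF f])
  have "ext_coord (perm_action f v) x
      = z (- x) \<otimes> (z (i - inv_into UNIV f i) \<otimes> v (inv_into UNIV f i mod int n))"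
    by (simp add: ext_coord_def perm_action_def i_def)
  also have "\<dots> = ext_coord v (inv_into UNIV f x)"
    using v by (simp add: ext_coord_def inv_x z_mult_left) (simp add: x)
  finally show ?thesis .
qed

lemma perm_action_comp:
  assumes f: "affine_perm n f" and g: "affine_perm n g" and v: "v \<in> vectors"
  shows "perm_action (f \<circ> g) v = perm_action f (perm_action g v)"
proof (rule vector_eqI)
  have "affine_perm n (f \<circ> g)" using affine_perm_comp[OF f g n] .
  then show "ext_coord (perm_action (f \<circ> g) v) x = ext_coord (perm_action f (perm_action g v)) x" for x
    using f g v by (simp add: ext_coord_perm_action o_inv_distrib affine_perm_bij)
qed (use v in auto)

lemma perm_action_id: "v \<in> vectors \<Longrightarrow> perm_action id v = v"
  by (rule vector_eqI) (simp_all add: ext_coord_perm_action affine_perm_id)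

lemma perm_action_fixed_iff:
  assumes f: "affine_perm n f" and v: "v \<in> vectors"
  shows "perm_action f v = v \<longleftrightarrow> (\<forall>x. ext_coord v (f x) = ext_coord v x)"
proof
  assume "perm_action f v = v"
  then have "ext_coord v (inv_into UNIV f (f x)) = ext_coord v (f x)" for x
    using ext_coord_perm_action[OF f v] by metis
  then show "\<forall>x. ext_coord v (f x) = ext_coord v x"
    using affine_perm_bij[OF f] by (simp add: bij_is_inj)
next
  assume *: "\<forall>x. ext_coord v (f x) = ext_coord v x"
  show "perm_action f v = v"
  proof (rule vector_eqI)
    fix x
    have "ext_coord v (inv_into UNIV f x) = ext_coord v (f (inv_into UNIV f x))" using * by simp
    then show "ext_coord (perm_action f v) x = ext_coord v x"
      using affine_perm_bij[OF f] by (simp add: ext_coord_perm_action[OF f v] bij_is_surj surj_f_inv_f)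
  qed (use v in auto)
qed

text \<open>Test on the basis vector at the residue of the preimage \<open>y\<close> of
  \<open>x\<close> under \<open>f\<close>: if \<open>w\<close> is the preimage under
  \<open>g\<close>, equal actions give \<open>z (- y) = z (- w)\<close>, and infinite order gives
  \<open>y = w\<close>.\<close>

lemma perm_action_inj:
  assumes f: "affine_perm n f" and g: "affine_perm n g"
    and eq: "\<And>v. v \<in> vectors \<Longrightarrow> perm_action f v = perm_action g v"
  shows "f = g"
proof -
  have "inv_into UNIV f x = inv_into UNIV g x" for x
  proof -
    define y w where "y = inv_into UNIV f x" and "w = inv_into UNIV g x"
    define v where "v = (\<lambda>i\<in>Omega n. if i = y mod int n then \<one> else \<zero>)"
    have v: "v \<in> vectors" by (auto simp: v_def)
    have "ext_coord v y = ext_coord v w"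
      using eq[OF v] ext_coord_perm_action[OF f v, of x] ext_coord_perm_action[OF g v, of x]
      by (simp add: y_def w_def)
    moreover have "ext_coord v y = z (- y)" by (simp add: ext_coord_def v_def)
    moreover have "ext_coord v w = (if w mod int n = y mod int n then z (- w) else \<zero>)"
      by (simp add: ext_coord_def v_def)
    ultimately have *: "z (- y) = (if w mod int n = y mod int n then z (- w) else \<zero>)" by simp
    have "z y \<otimes> z (- y) = \<one>" by (simp add: z_mult)
    then have "z (- y) \<noteq> \<zero>" by auto
    then have "z (- y) = z (- w)" using * by (auto split: if_splits)
    then have "z (y + - w) = \<one>" using z_add[of y "- w"] z_add[of y "- y"] by simp
    then show ?thesis using z_inj[of "y + - w"] by (simp add: y_def w_def)
  qed
  then have "inv_into UNIV f = inv_into UNIV g" by (rule ext)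
  then show ?thesis using f g affine_perm_bij inv_inv_eq by metis
qed

text \<open>The relations are those between a residue and the representative of its class; the last
  clause leads from corank one to a swap.\<close>

lemma fixed_vectors:
  assumes f: "affine_perm n f"
  obtains P c r where "P \<subseteq> Omega n"
    "\<forall>i. c i \<in> carrier A \<and> r i \<in> Omega n \<and> (r i \<in> P \<or> c i = \<zero>)"
    "\<forall>v\<in>vectors. perm_action f v = v \<longleftrightarrow> (\<forall>i\<in>Omega n - P. v i = c i \<otimes> v (r i))"
    "card (Omega n - P) = 1 \<longrightarrow> (\<exists>a b. f = affine_swap n a b \<and> \<not> int n dvd a - b)"
proof -
  interpret affine_orbits n f by unfold_locales (rule n f)+
  \<comment> \<open>The exponent collects \<open>i\<close> from
    \<open>v i = z i \<otimes> ext_coord v i\<close>, then \<open>- offset i * int n\<close> from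
    the shift to \<open>rep i\<close>, and \<open>- rep i\<close> from \<open>ext_coord\<close> at
    \<open>rep i\<close>.\<close>
  define c where "c i = (if good i then z (i - rep i - offset i * int n) else \<zero>)" for i
  have c: "c i \<in> carrier A" for i by (simp add: c_def)
  have c_rep: "c i = \<one>" if "i \<in> reps" for i
  proof -
    have "offset i = 0" using that offset[of i] by (simp add: reps_def good_def)
    then show ?thesis using that by (simp add: c_def reps_def)
  qed
  have fixed_iff: "perm_action f v = v \<longleftrightarrow> (\<forall>i\<in>Omega n - reps. v i = c i \<otimes> v (rep i))"
    if v: "v \<in> vectors" for v
  proof -
    have v_eq: "v i = z i \<otimes> ext_coord v i" if "i \<in> Omega n" for i
      using vector_eq_ext_coord[OF v, of i] Omega_modD[OF that] by simp
    have ext_eq: "ext_coord v i = z (- i) \<otimes> v i" if "i \<in> Omega n" for i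
      by (simp add: ext_coord_def Omega_modD[OF that])
    show ?thesis
    proof
      assume "perm_action f v = v"
      then have invariant: "ext_coord v (f x) = ext_coord v x" for x
        using perm_action_fixed_iff[OF f v] by blast
      have const: "ext_coord v x = ext_coord v y" if "same_orbit f x y" for x y
        using same_orbit_invariant[of f x y "ext_coord v", OF that invariant] .
      show "\<forall>i\<in>Omega n - reps. v i = c i \<otimes> v (rep i)"
      proof
        fix i assume i: "i \<in> Omega n - reps"
        then have i': "i \<in> Omega n" by simp
        have rep_i: "v (rep i) \<in> carrier A" using v rep_same_class(1) by blast
        show "v i = c i \<otimes> v (rep i)"
        proof (cases "good i")
          case True
          have "v i = z i \<otimes> ext_coord v (rep i + offset i * int n)"
            using v_eq[OF i'] const[OF offset] by simp
          also have "\<dots> = c i \<otimes> v (rep i)"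
            using True rep_i by (simp add: ext_coord_shift[OF v] ext_eq[OF rep_same_class(1)]
                c_def z_mult_left) (simp add: algebra_simps)
          finally show ?thesis .
        next
          case False
          then obtain k where k: "same_orbit f i (i + k * int n)" "k \<noteq> 0" by (auto simp: good_def)
          \<comment> \<open>The shift by \<open>k * int n\<close> stays in the orbit, so it
            preserves \<open>ext_coord v\<close>, but it also multiplies it by \<open>?a\<close>. By
            infinite order \<open>\<one> \<ominus> ?a\<close> is nonzero and can be cancelled in a
            domain.\<close>
          let ?a = "z (- (k * int n))"
          have "ext_coord v i = ?a \<otimes> ext_coord v i"
            using const[OF k(1)] by (simp add: ext_coord_shift[OF v])
          then have "(\<one> \<ominus> ?a) \<otimes> ext_coord v i = \<zero>"
            using v by (simp add: minus_eq l_distr l_minus r_neg)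
          moreover have "\<one> \<ominus> ?a \<noteq> \<zero>"
            using z_inj[of "- (k * int n)"] k(2) n r_right_minus_eq[of \<one> ?a] by auto
          ultimately have "ext_coord v i = \<zero>" using v by (simp add: integral_iff)
          then show ?thesis using False rep_i v_eq[OF i'] by (simp add: c_def)
        qed
      qed
    next
      assume *: "\<forall>i\<in>Omega n - reps. v i = c i \<otimes> v (rep i)"
      \<comment> \<open>At a representative the relation is trivial with coefficient
        \<open>\<one>\<close>, so it may be used at every residue.\<close>
      have rel: "v i = c i \<otimes> v (rep i)" if "i \<in> Omega n" for i
      proof (cases "i \<in> reps")
        case True
        moreover have "v i \<in> carrier A" using v that by blast
        ultimately show ?thesis using c_rep[OF True] by (simp add: reps_def)
      qed (use * that in blast)
      have "ext_coord v (f x) = ext_coord v x" for x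
      proof -
        define i k j l where "i = x mod int n" and "k = x div int n"
          and "j = f x mod int n" and "l = f x div int n"
        have x: "x = i + k * int n" and fx: "f x = j + l * int n"
          by (simp_all add: i_def k_def j_def l_def)
        have ij: "i \<in> Omega n" "j \<in> Omega n" by (simp_all add: i_def j_def)
        have step: "same_orbit f (i + k * int n) (j + l * int n)"
          using same_orbit_step[of f x] unfolding x[symmetric] fx .
        have "same_class i j"
          using same_orbit_shift[OF f step, of "- k"] unfolding same_class_def
          by (intro exI[of _ "l - k"]) (simp add: algebra_simps)
        note cls = this
        have rep: "rep j = rep i" using rep_cong[OF cls] by simp
        have good: "good j \<longleftrightarrow> good i" using good_cong cls same_class_sym by blast
        have v_rep: "v (rep i) \<in> carrier A" using v rep_same_class(1) by blast
        have ext: "ext_coord v (a + m * int n) = z (- (a + m * int n)) \<otimes> (c a \<otimes> v (rep a))"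
          if "a \<in> Omega n" for a m
          using rel[OF that] Omega_modD[OF that] by (simp add: ext_coord_def)
        show ?thesis
        proof (cases "good i")
          case True
          have 1: "same_orbit f (i + k * int n) (rep i + (offset i + k) * int n)"
            using same_orbit_shift[OF f offset, of i k] by (simp add: algebra_simps)
          have 2: "same_orbit f (j + l * int n) (rep i + (offset j + l) * int n)"
            using same_orbit_shift[OF f offset, of j l] by (simp add: algebra_simps rep)
          \<comment> \<open>\<open>x\<close> and \<open>f x\<close> share an orbit, which contains
            these two translates of one good representative; hence the translates coincide.\<close>
          have "same_orbit f (rep i + (offset i + k) * int n) (rep i + (offset j + l) * int n)"
            using 1 2 step same_orbit_sym same_orbit_trans by blast
          from same_orbit_shift[OF f this, of "- (offset i + k)"]
          have "same_orbit f (rep i) (rep i + (offset j + l - offset i - k) * int n)"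
            by (simp add: algebra_simps)
          moreover have "good (rep i)" using good_cong[OF rep_same_class(2) True] .
          ultimately have "offset j + l - offset i - k = 0" unfolding good_def by blast
          then have off: "offset j + l = offset i + k" by simp
          have "ext_coord v (i + k * int n) = z (- rep i - (offset i + k) * int n) \<otimes> v (rep i)"
            using True v_rep by (simp add: ext[OF ij(1)] c_def z_mult_left) (simp add: algebra_simps)
          moreover have "ext_coord v (j + l * int n) = z (- rep i - (offset j + l) * int n) \<otimes> v (rep i)"
            using True good rep v_rep by (simp add: ext[OF ij(2)] c_def z_mult_left) (simp add: algebra_simps)
          ultimately show ?thesis using off x fx by simp
        next
          case False
          then have "ext_coord v (i + k * int n) = \<zero>" "ext_coord v (j + l * int n) = \<zero>"
            using ext[OF ij(1)] ext[OF ij(2)] v_rep by (simp_all add: c_def good rep)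
          then show ?thesis using x fx by simp
        qed
      qed
      then show "perm_action f v = v" using perm_action_fixed_iff[OF f v] by blast
    qed
  qed
  have "rep i \<in> reps \<or> c i = \<zero>" for i
  proof (cases "good i")
    case True
    then show ?thesis
      using rep_same_class[of i] good_cong[OF rep_same_class(2) True] rep_cong[OF rep_same_class(2), of i]
      by (simp add: reps_def)
  qed (simp add: c_def)
  then have "\<forall>i. c i \<in> carrier A \<and> rep i \<in> Omega n \<and> (rep i \<in> reps \<or> c i = \<zero>)"
    using c rep_same_class(1) by simp
  moreover have "reps \<subseteq> Omega n" by (auto simp: reps_def)
  moreover have "\<exists>a b. f = affine_swap n a b \<and> \<not> int n dvd a - b" if "card (Omega n - reps) = 1"
    by (rule swap_of_card_1[OF that]) (intro exI conjI)
  ultimately show thesis using fixed_iff by (intro that[of reps c rep]) simp_all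
qed

text \<open>\<open>fixed_vectors\<close> leads from corank one to a swap; for the converse the graph
  of a swap is given by hand. Quasi-periodicity reduces all conditions to the one that compares
  \<open>a\<close> with \<open>b\<close>.\<close>

lemma fixed_vectors_swap:
  assumes ab: "\<not> int n dvd a - b" and v: "v \<in> vectors"
  shows "perm_action (affine_swap n a b) v = v \<longleftrightarrow> v (b mod int n) = z (b - a) \<otimes> v (a mod int n)"
proof -
  note f = affine_perm_swap[OF n ab]
  have v_b: "v (b mod int n) = z b \<otimes> ext_coord v b" using vector_eq_ext_coord[OF v] .
  have v_a: "z (b - a) \<otimes> v (a mod int n) = z b \<otimes> ext_coord v a"
    using v by (simp add: vector_eq_ext_coord[OF v, of a] z_mult_left)
  have unit: "ext_coord v x = z (- b) \<otimes> (z b \<otimes> ext_coord v x)" for x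
    using v by (simp add: z_mult_left)
  have "v (b mod int n) = z (b - a) \<otimes> v (a mod int n) \<longleftrightarrow> ext_coord v b = ext_coord v a"
    unfolding v_b v_a using unit by metis
  moreover have "(\<forall>x. ext_coord v (affine_swap n a b x) = ext_coord v x) \<longleftrightarrow> ext_coord v b = ext_coord v a"
  proof
    assume eq: "ext_coord v b = ext_coord v a"
    show "\<forall>x. ext_coord v (affine_swap n a b x) = ext_coord v x"
    proof
      fix x
      show "ext_coord v (affine_swap n a b x) = ext_coord v x"
      proof (cases "int n dvd x - a \<or> int n dvd x - b")
        case True
        then obtain c k where c: "c = a \<or> c = b" and x: "x = c + k * int n"
          by (auto simp: dvd_def algebra_simps)
        have "affine_swap n a b x = affine_swap n a b c + k * int n"
          unfolding x by (rule affine_perm_shift[OF f])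
        then show ?thesis
          using c eq affine_swap_right[OF ab] by (auto simp: x ext_coord_shift[OF v])
      qed (simp add: affine_swap_other)
    qed
  qed (metis affine_swap_left)
  ultimately show ?thesis using perm_action_fixed_iff[OF f v] by simp
qed

end

text \<open>In coordinates \<open>\<rho>\<close> is the monomial action of \<open>perm w\<close>;
  that it is a linear representation is derived. Extensionality is what membership in
  \<open>Bij\<close> demands.\<close>

locale affine_monomial_rep = affine_monomial A n z + affine_A_system n W s + coordinates A M "Omega n" \<phi>
  for A :: "('a, 'b) ring_scheme" (structure) and n and z and W :: "('g, 'x) monoid_scheme" and s
    and M :: "('a, 'm, 'c) module_scheme" and \<phi> +
  fixes \<rho> :: "'g \<Rightarrow> 'm \<Rightarrow> 'm"
  assumes \<rho>_closed: "w \<in> carrier W \<Longrightarrow> x \<in> carrier M \<Longrightarrow> \<rho> w x \<in> carrier M"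
    and \<rho>_extensional: "w \<in> carrier W \<Longrightarrow> \<rho> w \<in> extensional (carrier M)"
    and \<rho>_coord: "w \<in> carrier W \<Longrightarrow> x \<in> carrier M \<Longrightarrow> \<phi> (\<rho> w x) = perm_action (perm w) (\<phi> x)"
begin

lemma invariants_iff:
  "w \<in> carrier W \<Longrightarrow> x \<in> invariants (carrier M) \<rho> w \<longleftrightarrow> x \<in> carrier M \<and> perm_action (perm w) (\<phi> x) = \<phi> x"
  unfolding invariants_def using \<rho>_closed \<rho>_coord coord_inj by fastforce

lemma \<rho>_mult:
  assumes "v \<in> carrier W" "w \<in> carrier W" "x \<in> carrier M"
  shows "\<rho> (v \<otimes>\<^bsub>W\<^esub> w) x = \<rho> v (\<rho> w x)"
  using assms coord_PiE[of x]
  by (intro coord_inj) (simp_all add: \<rho>_closed \<rho>_coord perm_mult perm_action_comp perm_affine)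

lemma \<rho>_one: "x \<in> carrier M \<Longrightarrow> \<rho> \<one>\<^bsub>W\<^esub> x = x"
  using coord_PiE[of x] by (intro coord_inj) (simp_all add: \<rho>_closed \<rho>_coord perm_action_id)

lemma \<rho>_Bij:
  assumes w: "w \<in> carrier W"
  shows "\<rho> w \<in> Bij (carrier M)"
proof -
  have "bij_betw (\<rho> w) (carrier M) (carrier M)"
    using w \<rho>_mult[of "inv\<^bsub>W\<^esub> w" w] \<rho>_mult[of w "inv\<^bsub>W\<^esub> w"] \<rho>_closed \<rho>_one
    by (intro bij_betwI[where g = "\<rho> (inv\<^bsub>W\<^esub> w)"]) auto
  then show ?thesis using w \<rho>_extensional by (simp add: Bij_def)
qed

lemma linear_rep: "linear_representation W A M \<rho>"
proof -
  have "group_action W (carrier M) \<rho>"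
  proof (intro group_action.intro group_hom.intro group_hom_axioms.intro)
    show "\<rho> \<in> hom W (BijGroup (carrier M))"
    proof (rule homI)
      fix v w assume vw: "v \<in> carrier W" "w \<in> carrier W"
      have "\<rho> (v \<otimes>\<^bsub>W\<^esub> w) = compose (carrier M) (\<rho> v) (\<rho> w)"
        using vw \<rho>_mult \<rho>_extensional[of "v \<otimes>\<^bsub>W\<^esub> w"]
        by (intro extensionalityI[of _ "carrier M"]) (auto simp: compose_def)
      then show "\<rho> (v \<otimes>\<^bsub>W\<^esub> w) = \<rho> v \<otimes>\<^bsub>BijGroup (carrier M)\<^esub> \<rho> w"
        using vw by (simp add: BijGroup_def \<rho>_Bij)
    qed (simp add: BijGroup_def \<rho>_Bij)
  qed (simp_all add: group_BijGroup)
  moreover have "\<rho> w (x \<oplus>\<^bsub>M\<^esub> y) = \<rho> w x \<oplus>\<^bsub>M\<^esub> \<rho> w y"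
    if "w \<in> carrier W" "x \<in> carrier M" "y \<in> carrier M" for w x y
    using that
    by (intro coord_eqI) (simp_all add: \<rho>_closed \<rho>_coord add_coord perm_action_def r_distr)
  moreover have "\<rho> w (a \<odot>\<^bsub>M\<^esub> x) = a \<odot>\<^bsub>M\<^esub> \<rho> w x"
    if "w \<in> carrier W" "a \<in> carrier A" "x \<in> carrier M" for w a x
    using that
    by (intro coord_eqI) (simp_all add: \<rho>_closed \<rho>_coord smult_coord perm_action_def m_lcomm)
  ultimately show ?thesis
    unfolding linear_representation_def using is_module by blast
qed

text \<open>A reflection gets the explicit graph with one dependent coordinate. For any other
  \<open>w\<close> the general graph is taken; with just one dependent coordinate \<open>w\<close>
  would act as a swap and be a reflection.\<close>

lemma invariants_graph:
  assumes w: "w \<in> carrier W"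
  obtains P c r where "graph_submodule A M (Omega n) \<phi> P c r"
    "invariants (carrier M) \<rho> w = graph_submodule.graph A M (Omega n) \<phi> P c r"
    "card (Omega n - P) = 1 \<longleftrightarrow> w \<in> reflections W (s ` Omega n)"
proof (cases "w \<in> reflections W (s ` Omega n)")
  case True
  then obtain a b where f: "perm w = affine_swap n a b" and ab: "\<not> int n dvd a - b"
    by (rule swap_of_reflection)
  define P where "P = Omega n - {b mod int n}"
  have OP: "Omega n - P = {b mod int n}" by (auto simp: P_def)
  have "a mod int n \<in> P" using ab by (simp add: P_def mod_eq_dvd_iff)
  then interpret G: graph_submodule A M "Omega n" \<phi> P "\<lambda>_. z (b - a)" "\<lambda>_. a mod int n"
    by unfold_locales (auto simp: P_def)
  have "invariants (carrier M) \<rho> w = G.graph"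
    using invariants_iff[OF w] coord_PiE fixed_vectors_swap[OF ab]
    by (auto simp: G.graph_def OP f)
  then show thesis using that[OF G.graph_submodule_axioms] OP True by simp
next
  case False
  obtain P c r where P: "P \<subseteq> Omega n"
    and c: "\<forall>i. c i \<in> carrier A \<and> r i \<in> Omega n \<and> (r i \<in> P \<or> c i = \<zero>)"
    and fixed: "\<forall>v\<in>vectors. perm_action (perm w) v = v \<longleftrightarrow> (\<forall>i\<in>Omega n - P. v i = c i \<otimes> v (r i))"
    and swap: "card (Omega n - P) = 1 \<longrightarrow> (\<exists>a b. perm w = affine_swap n a b \<and> \<not> int n dvd a - b)"
    using fixed_vectors[OF perm_affine[OF w]] .
  interpret G: graph_submodule A M "Omega n" \<phi> P c r
    by unfold_locales (use P c in simp_all)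
  have "invariants (carrier M) \<rho> w = G.graph"
    using invariants_iff[OF w] coord_PiE fixed by (auto simp: G.graph_def)
  moreover have "card (Omega n - P) \<noteq> 1"
  proof
    assume "card (Omega n - P) = 1"
    then obtain a b where f: "perm w = affine_swap n a b" and ab: "\<not> int n dvd a - b"
      using swap by blast
    \<comment> \<open>\<open>reflection_of_swap\<close> expects the smaller integer first, so both
      orders are prepared.\<close>
    have ba: "\<not> int n dvd b - a" using ab dvd_diff_commute by metis
    have "a \<noteq> b" using ab by auto
    then have "w \<in> reflections W (s ` Omega n)"
      using reflection_of_swap[OF w f _ ab] reflection_of_swap[OF w _ _ ba] f affine_swap_commute[OF ab]
      by (cases "a < b") auto
    then show False using False by simp
  qed
  ultimately show thesis using that[OF G.graph_submodule_axioms] False by simp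
qed

theorem reflection_faithful: "reflection_faithful W (s ` Omega n) A M \<rho>"
proof -
  have fin: "finite (Omega n - P)" "finite (Omega n)" for P using n by (simp_all add: Omega_eq)
  have "faithful_action W (carrier M) \<rho>"
  proof (intro faithful_action.intro faithful_action_axioms.intro)
    show "group_action W (carrier M) \<rho>" using linear_rep by (simp add: linear_representation_def)
    show "inj_on \<rho> (carrier W)"
    proof (rule inj_onI)
      fix v w assume vw: "v \<in> carrier W" "w \<in> carrier W" "\<rho> v = \<rho> w"
      have "perm_action (perm v) u = perm_action (perm w) u" if "u \<in> vectors" for u
        using \<rho>_coord[of v "of_coord u"] \<rho>_coord[of w "of_coord u"] vw that
        by (simp add: of_coord_closed coord_of_coord)
      then have "perm v = perm w" using vw by (intro perm_action_inj perm_affine) auto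
      then show "v = w" using vw perm_inj by blast
    qed
  qed
  moreover have "free_of_finite_rank A (fixed_submodule M \<rho> w) \<and>
      free_of_finite_rank A (quotient_module M (invariants (carrier M) \<rho> w)) \<and>
      (free_of_rank A (quotient_module M (invariants (carrier M) \<rho> w)) 1 \<longleftrightarrow>
        w \<in> reflections W (s ` Omega n))" if w: "w \<in> carrier W" for w
  proof -
    obtain P c r where G: "graph_submodule A M (Omega n) \<phi> P c r"
      "invariants (carrier M) \<rho> w = graph_submodule.graph A M (Omega n) \<phi> P c r"
      and card: "card (Omega n - P) = 1 \<longleftrightarrow> w \<in> reflections W (s ` Omega n)"
      using invariants_graph[OF w] .
    interpret G: graph_submodule A M "Omega n" \<phi> P c r by (rule G(1))
    have finP: "finite P" using finite_subset[OF G.P fin(2)] .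
    have "free_of_rank A (fixed_submodule M \<rho> w) (card P)"
      unfolding fixed_submodule_def G(2)
      by (rule coordinates.free_of_rank_card[OF G.coordinates_graph finP one_not_zero])
    moreover have "free_of_rank A (quotient_module M (invariants (carrier M) \<rho> w)) (card (Omega n - P))"
      unfolding G(2)
      by (rule coordinates.free_of_rank_card[OF G.coordinates_quotient fin(1) one_not_zero])
    \<comment> \<open>Having a basis of \<open>card (Omega n - P)\<close> elements does not by
      itself exclude a basis of one element; uniqueness of rank does.\<close>
    moreover have "card (Omega n - P) = 1" if "free_of_rank A (quotient_module M (invariants (carrier M) \<rho> w)) 1"
      using that unfolding G(2)
      by (rule coordinates.card_eq_1_of_free_of_rank_1[OF G.coordinates_quotient fin(1) domain_axioms])
    ultimately show ?thesis
      unfolding free_of_finite_rank_def card[symmetric] by metis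
  qed
  ultimately show ?thesis
    unfolding reflection_faithful_def using domain_axioms linear_rep by blast
qed

end

section \<open>Extension of scalars of a free module\<close>

lemma (in group_hom) image_fiber_map:
  assumes h: "h ` carrier G = carrier H" and C: "C \<in> rcosets (kernel G H h)"
    and f: "f \<in> carrier G \<rightarrow> carrier G" and hf: "\<And>x. x \<in> carrier G \<Longrightarrow> h (f x) = g (h x)"
  shows "kernel G H h <#> f ` C \<in> rcosets (kernel G H h)"
    and "the_elem (h ` (kernel G H h <#> f ` C)) = g (the_elem (h ` C))"
proof -
  obtain x where x: "x \<in> carrier G" and C_eq: "C = {y \<in> carrier G. h y = h x}"
    using C unfolding rcosets_kernel_eq by blast
  have fx: "f x \<in> carrier G" using f x by auto
  have eq: "kernel G H h <#> f ` C = {y \<in> carrier G. h y = h (f x)}"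
    unfolding C_eq using x f by (rule kernel_mult_image_fiber) (simp_all add: hf x)
  show "kernel G H h <#> f ` C \<in> rcosets (kernel G H h)"
    unfolding eq rcosets_kernel_eq using fx by (rule imageI)
  show "the_elem (h ` (kernel G H h <#> f ` C)) = g (the_elem (h ` C))"
  proof -
    have "the_elem (h ` (kernel G H h <#> f ` C)) = h (f x)"
      by (subst eq) (rule the_elem_image_fiber[OF fx])
    moreover have "the_elem (h ` C) = h x"
      by (subst C_eq) (rule the_elem_image_fiber[OF x])
    ultimately show ?thesis by (simp add: hf[OF x])
  qed
qed

lemma (in abelian_group) add_minus_minus:
  assumes "x \<in> carrier G" "y \<in> carrier G"
  shows "x \<oplus> y \<ominus> x \<ominus> y = \<zero>"
proof -
  have "x \<oplus> y \<ominus> x = y" using assms by (simp add: minus_eq a_comm[of x y] a_assoc r_neg)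
  then show ?thesis using assms by (simp add: minus_eq r_neg)
qed

locale free_base_change = alg: algebra R A
  for R :: "('r, 'b) ring_scheme" and A :: "('r, 'a, 'd) module_scheme" +
  fixes I :: "'i set"
  assumes finite_index: "finite I"
begin

abbreviation "F \<equiv> free_module R I"
abbreviation "T \<equiv> tensor_free F A"
abbreviation "K \<equiv> tensor_kernel R F A"

sublocale F: coordinates R F I "\<lambda>v. v"
  by (rule cring.coordinates_free_module[OF alg.R_cring])

sublocale C: coordinates A "free_module A I" I "\<lambda>v. v"
  by (rule cring.coordinates_free_module[OF alg.M_cring])

text \<open>The universal property of the free abelian group provides the map that will identify the
  tensor product with tuples over \<open>A\<close>.\<close>

lemma coord_hom_exists:
  "\<exists>h. h \<in> hom T (add_monoid (free_module A I)) \<and>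
    (\<forall>x\<in>carrier F. \<forall>a\<in>carrier A. h (frag_of (x, a)) = (\<lambda>i\<in>I. x i \<odot>\<^bsub>A\<^esub> a))"
proof -
  have img: "(\<lambda>(x, a). \<lambda>i\<in>I. x i \<odot>\<^bsub>A\<^esub> a) ` (carrier F \<times> carrier A)
      \<subseteq> carrier (add_monoid (free_module A I))"
    by (auto simp: free_module_def)
  show ?thesis
    by (rule comm_group.free_Abelian_group_universal[OF C.M.a_comm_group img]) (auto simp: tensor_free_def)
qed

lemma coefficient_module_simps:
  "carrier (free_module A I) = I \<rightarrow>\<^sub>E carrier A" "\<zero>\<^bsub>free_module A I\<^esub> = (\<lambda>i\<in>I. \<zero>\<^bsub>A\<^esub>)"
  "u \<oplus>\<^bsub>free_module A I\<^esub> v = (\<lambda>i\<in>I. u i \<oplus>\<^bsub>A\<^esub> v i)"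
  by (simp_all add: free_module_def)

definition coord :: "(('i \<Rightarrow> 'r) \<times> 'a \<Rightarrow>\<^sub>0 int) \<Rightarrow> 'i \<Rightarrow> 'a" where
  "coord = (SOME h. h \<in> hom T (add_monoid (free_module A I)) \<and>
    (\<forall>x\<in>carrier F. \<forall>a\<in>carrier A. h (frag_of (x, a)) = (\<lambda>i\<in>I. x i \<odot>\<^bsub>A\<^esub> a)))"

lemma coord_hom: "coord \<in> hom T (add_monoid (free_module A I))"
  and coord_frag: "x \<in> carrier F \<Longrightarrow> a \<in> carrier A \<Longrightarrow> coord (frag_of (x, a)) = (\<lambda>i\<in>I. x i \<odot>\<^bsub>A\<^esub> a)"
  using someI_ex[OF coord_hom_exists] unfolding coord_def[symmetric] by blast+

lemma T_iff: "c \<in> carrier T \<longleftrightarrow> Poly_Mapping.keys c \<subseteq> carrier F \<times> carrier A"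
  by (simp add: tensor_free_def)

lemma T_simps [simp]: "c \<otimes>\<^bsub>T\<^esub> d = c + d" "\<one>\<^bsub>T\<^esub> = 0"
  by (simp_all add: tensor_free_def)

lemma T_inv: "c \<in> carrier T \<Longrightarrow> inv\<^bsub>T\<^esub> c = - c"
  unfolding T_iff by (simp add: tensor_free_def)

lemma T_group: "group T"
  by (simp add: tensor_free_def)

lemma coord_group_hom: "group_hom T (add_monoid (free_module A I)) coord"
  by (intro group_hom.intro group_hom_axioms.intro T_group C.M.a_group coord_hom)

interpretation coord: group_hom T "add_monoid (free_module A I)" coord
  by (rule coord_group_hom)

lemma T_frag: "x \<in> carrier F \<Longrightarrow> a \<in> carrier A \<Longrightarrow> frag_of (x, a) \<in> carrier T"
  by (simp add: T_iff)

lemma T_diff: "c \<in> carrier T \<Longrightarrow> d \<in> carrier T \<Longrightarrow> c - d \<in> carrier T"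
  using coord.G.m_closed[of c "inv\<^bsub>T\<^esub> d"] coord.G.inv_closed[of d] by (simp add: T_inv)

lemma T_sum: "(\<And>i. i \<in> J \<Longrightarrow> c i \<in> carrier T) \<Longrightarrow> sum c J \<in> carrier T"
  unfolding tensor_free_def by (rule sum_closed_free_Abelian_group)

lemma coord_closed: "c \<in> carrier T \<Longrightarrow> coord c \<in> I \<rightarrow>\<^sub>E carrier A"
  using coord.hom_closed by (simp add: coefficient_module_simps)

lemma coord_add: "c \<in> carrier T \<Longrightarrow> d \<in> carrier T \<Longrightarrow> i \<in> I \<Longrightarrow> coord (c + d) i = coord c i \<oplus>\<^bsub>A\<^esub> coord d i"
  using coord.hom_mult[of c d] by (simp add: coefficient_module_simps)

lemma coord_zero: "coord 0 = (\<lambda>i\<in>I. \<zero>\<^bsub>A\<^esub>)"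
  using coord.hom_one by (simp add: coefficient_module_simps)

lemma coord_diff:
  assumes "c \<in> carrier T" "d \<in> carrier T" "i \<in> I"
  shows "coord (c - d) i = coord c i \<ominus>\<^bsub>A\<^esub> coord d i"
proof -
  have "coord c i = coord (c - d) i \<oplus>\<^bsub>A\<^esub> coord d i"
    using coord_add[of "c - d" d i] assms T_diff by simp
  moreover have "coord (c - d) i \<in> carrier A" "coord d i \<in> carrier A"
    using assms coord_closed T_diff by blast+
  ultimately show ?thesis
    by (simp add: alg.M.minus_eq alg.M.add.m_assoc alg.M.r_neg)
qed

lemma T_zero: "0 \<in> carrier T"
  by (simp add: T_iff)

lemma tensor_induct [consumes 1, case_names zero diff frag]:
  assumes "c \<in> carrier T" "P 0"
    "\<And>c d. c \<in> carrier T \<Longrightarrow> d \<in> carrier T \<Longrightarrow> P c \<Longrightarrow> P d \<Longrightarrow> P (c - d)"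
    "\<And>x a. x \<in> carrier F \<Longrightarrow> a \<in> carrier A \<Longrightarrow> P (frag_of (x, a))"
  shows "P c"
  using assms(1) unfolding T_iff
proof (rule free_Abelian_group_induct)
  show "P (c - d)" if "Poly_Mapping.keys c \<subseteq> carrier F \<times> carrier A"
    "Poly_Mapping.keys d \<subseteq> carrier F \<times> carrier A" "P c" "P d" for c d
    using that assms(3) by (simp add: T_iff)
qed (use assms in auto)

section \<open>The kernel of the coordinate map\<close>

lemma relations_T: "tensor_relations R F A \<subseteq> carrier T"
  unfolding tensor_relations_def
  by (rule subsetI, elim UnE CollectE exE conjE) (simp_all add: T_diff T_frag)

lemma K_subgroup: "subgroup K T"
  unfolding tensor_kernel_def by (rule coord.G.generate_is_subgroup[OF relations_T])

lemma K_T: "c \<in> K \<Longrightarrow> c \<in> carrier T"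
  using K_subgroup subgroup.mem_carrier by fast

lemma K_zero: "0 \<in> K"
  using subgroup.one_closed[OF K_subgroup] by simp

lemma K_add: "c \<in> K \<Longrightarrow> d \<in> K \<Longrightarrow> c + d \<in> K"
  using subgroup.m_closed[OF K_subgroup, of c d] by simp

lemma K_minus: "c \<in> K \<Longrightarrow> - c \<in> K"
  using subgroup.m_inv_closed[OF K_subgroup, of c] by (simp add: T_inv K_T)

lemma K_diff: "c \<in> K \<Longrightarrow> d \<in> K \<Longrightarrow> c - d \<in> K"
  using K_add[OF _ K_minus, of c d] by simp

lemma K_sum: "(\<And>i. i \<in> J \<Longrightarrow> c i \<in> K) \<Longrightarrow> sum c J \<in> K"
  by (induction J rule: infinite_finite_induct) (simp_all add: K_zero K_add)

lemma K_add_left: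
  "x \<in> carrier F \<Longrightarrow> y \<in> carrier F \<Longrightarrow> a \<in> carrier A \<Longrightarrow>
    frag_of (x \<oplus>\<^bsub>F\<^esub> y, a) - frag_of (x, a) - frag_of (y, a) \<in> K"
  unfolding tensor_kernel_def tensor_relations_def by (rule generate.incl, rule UnI1, rule UnI1) blast

lemma K_add_right:
  "x \<in> carrier F \<Longrightarrow> a \<in> carrier A \<Longrightarrow> b \<in> carrier A \<Longrightarrow>
    frag_of (x, a \<oplus>\<^bsub>A\<^esub> b) - frag_of (x, a) - frag_of (x, b) \<in> K"
  unfolding tensor_kernel_def tensor_relations_def by (rule generate.incl, rule UnI1, rule UnI2) blast

lemma K_balance:
  "r \<in> carrier R \<Longrightarrow> x \<in> carrier F \<Longrightarrow> a \<in> carrier A \<Longrightarrow>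
    frag_of (r \<odot>\<^bsub>F\<^esub> x, a) - frag_of (x, r \<odot>\<^bsub>A\<^esub> a) \<in> K"
  unfolding tensor_kernel_def tensor_relations_def by (rule generate.incl, rule UnI2) blast

text \<open>At \<open>0 + 0\<close> the additivity relation is the negative of the pure tensor; the
  same holds in the second factor.\<close>

lemma K_zero_left: "a \<in> carrier A \<Longrightarrow> frag_of (\<zero>\<^bsub>F\<^esub>, a) \<in> K"
  using K_minus[OF K_add_left[of "\<zero>\<^bsub>F\<^esub>" "\<zero>\<^bsub>F\<^esub>" a]] by simp

lemma K_zero_right: "x \<in> carrier F \<Longrightarrow> frag_of (x, \<zero>\<^bsub>A\<^esub>) \<in> K"
  using K_minus[OF K_add_right[of x "\<zero>\<^bsub>A\<^esub>" "\<zero>\<^bsub>A\<^esub>"]] by simp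

lemma K_coord: "K \<subseteq> kernel T (add_monoid (free_module A I)) coord"
  unfolding tensor_kernel_def
proof (rule coord.G.generate_subgroup_incl[OF _ coord.subgroup_kernel])
  have "coord (frag_of (x \<oplus>\<^bsub>F\<^esub> y, a) - frag_of (x, a) - frag_of (y, a)) i = \<zero>\<^bsub>A\<^esub>"
    if "x \<in> carrier F" "y \<in> carrier F" "a \<in> carrier A" "i \<in> I" for x y a i
    using that fun_cong[OF F.add_coord(2)[of x y], of i]
    by (simp add: coord_diff coord_frag T_diff T_frag alg.smult_l_distr
        alg.M.add_minus_minus F.coord_closed)
  moreover have "coord (frag_of (x, a \<oplus>\<^bsub>A\<^esub> b) - frag_of (x, a) - frag_of (x, b)) i = \<zero>\<^bsub>A\<^esub>"
    if "x \<in> carrier F" "a \<in> carrier A" "b \<in> carrier A" "i \<in> I" for x a b i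
    using that
    by (simp add: coord_diff coord_frag T_diff T_frag alg.smult_r_distr
        alg.M.add_minus_minus F.coord_closed)
  moreover have "coord (frag_of (r \<odot>\<^bsub>F\<^esub> x, a) - frag_of (x, r \<odot>\<^bsub>A\<^esub> a)) i = \<zero>\<^bsub>A\<^esub>"
    if "r \<in> carrier R" "x \<in> carrier F" "a \<in> carrier A" "i \<in> I" for r x a i
    using that fun_cong[OF F.smult_coord(2)[of r x], of i] alg.smult_assoc1[of "x i" r a] alg.smult_assoc1[of r "x i" a]
    by (simp add: coord_diff coord_frag T_diff T_frag alg.M.minus_eq alg.R.m_comm alg.M.r_neg F.coord_closed)
  ultimately have zero: "\<forall>i\<in>I. coord c i = \<zero>\<^bsub>A\<^esub>" if "c \<in> tensor_relations R F A" for c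
    using that unfolding tensor_relations_def by (elim UnE CollectE exE conjE) simp_all
  show "tensor_relations R F A \<subseteq> kernel T (add_monoid (free_module A I)) coord"
  proof
    fix c assume c: "c \<in> tensor_relations R F A"
    then have cT: "c \<in> carrier T" using relations_T by blast
    have "coord c = (\<lambda>i\<in>I. \<zero>\<^bsub>A\<^esub>)"
    proof (rule PiE_ext[OF coord_closed[OF cT]])
      show "(\<lambda>i\<in>I. \<zero>\<^bsub>A\<^esub>) \<in> I \<rightarrow>\<^sub>E carrier A" by simp
    qed (simp add: zero[OF c])
    then show "c \<in> kernel T (add_monoid (free_module A I)) coord"
      using cT by (simp add: kernel_def coefficient_module_simps)
  qed
qed

text \<open>The inverse of \<open>coord\<close> modulo \<open>K\<close>; comparing tensors with
  normal forms shows that \<open>coord\<close> kills nothing outside \<open>K\<close>.\<close>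

definition normal_form :: "('i \<Rightarrow> 'a) \<Rightarrow> (('i \<Rightarrow> 'r) \<times> 'a \<Rightarrow>\<^sub>0 int)" where
  "normal_form v = (\<Sum>i\<in>I. frag_of (F.unit_vector i, v i))"

lemma normal_form_T: "v \<in> I \<rightarrow>\<^sub>E carrier A \<Longrightarrow> normal_form v \<in> carrier T"
  unfolding normal_form_def by (intro T_sum T_frag) auto

lemma K_chain:
  assumes "c - d - e \<in> K" "d - d' \<in> K" "e - e' \<in> K"
  shows "c - (d' + e') \<in> K"
  using K_add[OF K_add[OF assms(1,2)] assms(3)] by (simp add: algebra_simps)

text \<open>Coordinates are collected one at a time: the multiple of a unit vector by
  \<open>x j\<close> is split off by additivity, and balancing moves \<open>x j\<close> to the
  second factor.\<close>

lemma frag_normal_form_partial: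
  assumes "finite S" "S \<subseteq> I" "x \<in> carrier F" "a \<in> carrier A"
  shows "frag_of (\<lambda>i\<in>I. if i \<in> S then x i else \<zero>\<^bsub>R\<^esub>, a)
    - (\<Sum>i\<in>S. frag_of (F.unit_vector i, x i \<odot>\<^bsub>A\<^esub> a)) \<in> K"
  using assms(1,2)
proof (induction S)
  case empty
  have "(\<lambda>i\<in>I. if i \<in> {} then x i else \<zero>\<^bsub>R\<^esub>) = \<zero>\<^bsub>F\<^esub>" by (simp add: free_module_def)
  then show ?case using K_zero_left[OF assms(4)] by simp
next
  case (insert j S)
  let ?p = "\<lambda>S. \<lambda>i\<in>I. if i \<in> S then x i else \<zero>\<^bsub>R\<^esub>"
  have x: "x i \<in> carrier R" if "i \<in> I" for i using assms(3) that by (rule F.coord_closed)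
  have p: "?p S \<in> carrier F" for S using x by (simp add: free_module_def restrict_PiE_iff)
  have j: "j \<in> I" using insert by simp
  have xe: "x j \<odot>\<^bsub>F\<^esub> F.unit_vector j \<in> carrier F" using x[OF j] by simp
  have "?p (insert j S) = (x j \<odot>\<^bsub>F\<^esub> F.unit_vector j) \<oplus>\<^bsub>F\<^esub> ?p S"
  proof (rule F.coord_eqI[OF p])
    show "(x j \<odot>\<^bsub>F\<^esub> F.unit_vector j) \<oplus>\<^bsub>F\<^esub> ?p S \<in> carrier F" using xe p by (rule F.add_coord(1))
    fix i assume i: "i \<in> I"
    have "((x j \<odot>\<^bsub>F\<^esub> F.unit_vector j) \<oplus>\<^bsub>F\<^esub> ?p S) i = (x j \<odot>\<^bsub>F\<^esub> F.unit_vector j) i \<oplus>\<^bsub>R\<^esub> ?p S i"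
      using fun_cong[OF F.add_coord(2)[OF xe p], of S i] i by simp
    moreover have "(x j \<odot>\<^bsub>F\<^esub> F.unit_vector j) i = x j \<otimes>\<^bsub>R\<^esub> F.unit_vector j i"
      using fun_cong[OF F.smult_coord(2)[OF x[OF j] F.unit_vector_closed], of j i] i by simp
    ultimately show "?p (insert j S) i = ((x j \<odot>\<^bsub>F\<^esub> F.unit_vector j) \<oplus>\<^bsub>F\<^esub> ?p S) i"
      using insert(2) x i j by (simp add: F.unit_vector_coord)
  qed
  then have 1: "frag_of (?p (insert j S), a) - frag_of (x j \<odot>\<^bsub>F\<^esub> F.unit_vector j, a) - frag_of (?p S, a) \<in> K"
    using K_add_left[OF xe p[of S] assms(4)] by simp
  have 2: "frag_of (x j \<odot>\<^bsub>F\<^esub> F.unit_vector j, a) - frag_of (F.unit_vector j, x j \<odot>\<^bsub>A\<^esub> a) \<in> K"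
    using K_balance[OF x[OF j] F.unit_vector_closed assms(4)] .
  have 3: "frag_of (?p S, a) - (\<Sum>i\<in>S. frag_of (F.unit_vector i, x i \<odot>\<^bsub>A\<^esub> a)) \<in> K"
    by (rule insert.IH) (use insert.prems in blast)
  show ?case
    unfolding sum.insert[OF insert(1,2)] by (rule K_chain[OF 1 2 3])
qed

lemma frag_normal_form:
  assumes "x \<in> carrier F" "a \<in> carrier A"
  shows "frag_of (x, a) - normal_form (coord (frag_of (x, a))) \<in> K"
proof -
  have "(\<lambda>i\<in>I. if i \<in> I then x i else \<zero>\<^bsub>R\<^esub>) = x"
    using F.coord_PiE[OF assms(1)] by (auto simp: fun_eq_iff PiE_iff extensional_def)
  then show ?thesis
    using frag_normal_form_partial[OF finite_index order_refl assms]
    by (simp add: normal_form_def coord_frag[OF assms])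
qed

lemma normal_form_diff:
  assumes u: "u \<in> I \<rightarrow>\<^sub>E carrier A" and v: "v \<in> I \<rightarrow>\<^sub>E carrier A" and w: "w \<in> I \<rightarrow>\<^sub>E carrier A"
    and uvw: "\<And>i. i \<in> I \<Longrightarrow> u i = v i \<oplus>\<^bsub>A\<^esub> w i"
  shows "normal_form u - normal_form v - normal_form w \<in> K"
proof -
  have "(\<Sum>i\<in>I. frag_of (F.unit_vector i, u i) - frag_of (F.unit_vector i, v i)
      - frag_of (F.unit_vector i, w i)) \<in> K"
  proof (rule K_sum)
    fix i assume i: "i \<in> I"
    then show "frag_of (F.unit_vector i, u i) - frag_of (F.unit_vector i, v i)
      - frag_of (F.unit_vector i, w i) \<in> K"
      unfolding uvw[OF i] using v w by (intro K_add_right) auto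
  qed
  then show ?thesis by (simp add: normal_form_def sum_subtractf)
qed

lemma tensor_normal_form:
  assumes "c \<in> carrier T"
  shows "c - normal_form (coord c) \<in> K"
  using assms
proof (induction c rule: tensor_induct)
  case zero
  have "normal_form (coord 0) \<in> K"
    unfolding normal_form_def by (intro K_sum) (simp add: coord_zero K_zero_right)
  then show ?case using K_minus by simp
next
  case (diff c d)
  have cd: "c - d \<in> carrier T" using diff T_diff by simp
  have "coord c i = coord (c - d) i \<oplus>\<^bsub>A\<^esub> coord d i" if "i \<in> I" for i
    using coord_add[OF cd, of d i] diff that by simp
  then have "normal_form (coord c) - normal_form (coord (c - d)) - normal_form (coord d) \<in> K"
    using diff cd by (intro normal_form_diff coord_closed) auto
  \<comment> \<open>The three members of \<open>K\<close> combine to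
    \<open>c - d - normal_form (coord (c - d))\<close>.\<close>
  from K_add[OF K_diff[OF diff(3) diff(4)] this] show ?case by (simp add: algebra_simps)
qed (rule frag_normal_form)

text \<open>A tensor equals its normal form modulo \<open>K\<close>, and the normal form of the zero
  tuple is a sum of pure tensors with second factor zero.\<close>

lemma K_eq: "K = {c \<in> carrier T. coord c = (\<lambda>i\<in>I. \<zero>\<^bsub>A\<^esub>)}"
proof
  show "K \<subseteq> {c \<in> carrier T. coord c = (\<lambda>i\<in>I. \<zero>\<^bsub>A\<^esub>)}"
    using K_coord by (auto simp: kernel_def coefficient_module_simps)
  show "{c \<in> carrier T. coord c = (\<lambda>i\<in>I. \<zero>\<^bsub>A\<^esub>)} \<subseteq> K"
  proof
    fix c assume c: "c \<in> {c \<in> carrier T. coord c = (\<lambda>i\<in>I. \<zero>\<^bsub>A\<^esub>)}"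
    then have "normal_form (coord c) = normal_form (coord 0)" by (simp add: coord_zero)
    moreover have "normal_form (coord 0) \<in> K"
      unfolding normal_form_def by (intro K_sum) (simp add: coord_zero K_zero_right)
    ultimately have "(c - normal_form (coord c)) + normal_form (coord c) \<in> K"
      using c tensor_normal_form[of c] by (intro K_add) simp_all
    then show "c \<in> K" by simp
  qed
qed

lemma kernel_eq_K: "kernel T (add_monoid (free_module A I)) coord = K"
  unfolding K_eq by (simp add: kernel_def coefficient_module_simps)

lemma coord_normal_form:
  assumes v: "v \<in> I \<rightarrow>\<^sub>E carrier A"
  shows "coord (normal_form v) = v"
proof (rule PiE_ext[OF coord_closed[OF normal_form_T[OF v]] v])
  fix j assume j: "j \<in> I"
  have "coord (\<Sum>i\<in>S. frag_of (F.unit_vector i, v i)) j = (if j \<in> S then v j else \<zero>\<^bsub>A\<^esub>)"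
    if "finite S" "S \<subseteq> I" for S
    using that
  proof (induction S)
    case empty
    then show ?case using j by (simp add: coord_zero)
  next
    case (insert k S)
    have vk: "v i \<in> carrier A" if "i \<in> I" for i using v that by blast
    have "coord (\<Sum>i\<in>insert k S. frag_of (F.unit_vector i, v i)) j
        = coord (frag_of (F.unit_vector k, v k)) j \<oplus>\<^bsub>A\<^esub> coord (\<Sum>i\<in>S. frag_of (F.unit_vector i, v i)) j"
    proof -
      have "frag_of (F.unit_vector k, v k) \<in> carrier T" "(\<Sum>i\<in>S. frag_of (F.unit_vector i, v i)) \<in> carrier T"
        using insert vk by (auto intro!: T_frag T_sum)
      then show ?thesis using coord_add j insert by simp
    qed
    also have "coord (frag_of (F.unit_vector k, v k)) j = (if j = k then v j else \<zero>\<^bsub>A\<^esub>)"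
      using insert j vk by (simp add: coord_frag F.unit_vector_coord)
    finally show ?case using insert j vk by auto
  qed
  from this[OF finite_index] show "coord (normal_form v) j = v j" using j by (simp add: normal_form_def)
qed

lemma coord_surj: "coord ` carrier T = I \<rightarrow>\<^sub>E carrier A"
proof
  show "coord ` carrier T \<subseteq> I \<rightarrow>\<^sub>E carrier A" using coord_closed by blast
  show "I \<rightarrow>\<^sub>E carrier A \<subseteq> coord ` carrier T"
  proof
    fix v assume v: "v \<in> I \<rightarrow>\<^sub>E carrier A"
    show "v \<in> coord ` carrier T"
      using imageI[OF normal_form_T[OF v], of coord] unfolding coord_normal_form[OF v] .
  qed
qed

lemma frag_extend_T:
  assumes "\<And>x b. x \<in> carrier F \<Longrightarrow> b \<in> carrier A \<Longrightarrow> g x b \<in> carrier T" "c \<in> carrier T"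
  shows "frag_extend (\<lambda>(x, b). g x b) c \<in> carrier T"
  using assms(2)
  by (induction c rule: tensor_induct) (simp_all add: frag_extend_diff T_diff T_zero assms(1))

text \<open>Both sides are additive in \<open>c\<close> and agree on pure tensors.\<close>

lemma coord_frag_extend:
  assumes g: "\<And>x b. x \<in> carrier F \<Longrightarrow> b \<in> carrier A \<Longrightarrow> g x b \<in> carrier T"
    and coord_g: "\<And>x b. x \<in> carrier F \<Longrightarrow> b \<in> carrier A \<Longrightarrow> coord (g x b) = h (coord (frag_of (x, b)))"
    and h: "\<And>u v. u \<in> I \<rightarrow>\<^sub>E carrier A \<Longrightarrow> v \<in> I \<rightarrow>\<^sub>E carrier A \<Longrightarrow>
        h (\<lambda>i\<in>I. u i \<oplus>\<^bsub>A\<^esub> v i) = (\<lambda>i\<in>I. h u i \<oplus>\<^bsub>A\<^esub> h v i)"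
    and h_closed: "\<And>v. v \<in> I \<rightarrow>\<^sub>E carrier A \<Longrightarrow> h v \<in> I \<rightarrow>\<^sub>E carrier A"
    and c: "c \<in> carrier T"
  shows "coord (frag_extend (\<lambda>(x, b). g x b) c) = h (coord c)"
proof -
  have h_hom: "group_hom T (add_monoid (free_module A I)) (\<lambda>c. h (coord c))"
  proof (intro group_hom.intro group_hom_axioms.intro T_group C.M.a_group homI)
    fix c d assume cd: "c \<in> carrier T" "d \<in> carrier T"
    have "coord (c + d) = (\<lambda>i\<in>I. coord c i \<oplus>\<^bsub>A\<^esub> coord d i)"
      using coord.hom_mult[OF cd] by (simp add: coefficient_module_simps)
    then show "h (coord (c \<otimes>\<^bsub>T\<^esub> d)) = h (coord c) \<otimes>\<^bsub>add_monoid (free_module A I)\<^esub> h (coord d)"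
      using h[OF coord_closed coord_closed, OF cd] by (simp add: coefficient_module_simps)
  qed (use h_closed coord_closed in \<open>simp add: coefficient_module_simps\<close>)
  interpret h: group_hom T "add_monoid (free_module A I)" "\<lambda>c. h (coord c)" by (rule h_hom)
  have gT: "frag_extend (\<lambda>(x, b). g x b) c \<in> carrier T" if "c \<in> carrier T" for c
    using g that by (rule frag_extend_T)
  show ?thesis
    using c
  proof (induction c rule: tensor_induct)
    case zero
    have "h (coord 0) = coord 0" using h.hom_one coord.hom_one unfolding T_simps by metis
    then show ?case by simp
  next
    case (diff c d)
    have cd: "c - d \<in> carrier T" using diff T_diff by simp
    \<comment> \<open>The induction runs over differences whereas \<open>h\<close> is additive, so
      the value at \<open>c - d\<close> is recovered by cancelling the value at
      \<open>d\<close>.\<close>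
    have split: "(\<lambda>i\<in>I. u i \<oplus>\<^bsub>A\<^esub> v i) = (\<lambda>i\<in>I. w i \<oplus>\<^bsub>A\<^esub> v i) \<Longrightarrow> u = w"
      if "u \<in> I \<rightarrow>\<^sub>E carrier A" "v \<in> I \<rightarrow>\<^sub>E carrier A" "w \<in> I \<rightarrow>\<^sub>E carrier A" for u v w
    proof (rule PiE_ext[OF that(1,3)])
      fix i assume i: "i \<in> I" and eq: "(\<lambda>i\<in>I. u i \<oplus>\<^bsub>A\<^esub> v i) = (\<lambda>i\<in>I. w i \<oplus>\<^bsub>A\<^esub> v i)"
      have "u i \<oplus>\<^bsub>A\<^esub> v i = w i \<oplus>\<^bsub>A\<^esub> v i" using fun_cong[OF eq, of i] i by simp
      moreover have "u i \<in> carrier A" "v i \<in> carrier A" "w i \<in> carrier A" using that i by auto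
      ultimately show "u i = w i" by simp
    qed
    let ?e = "frag_extend (\<lambda>(x, b). g x b)"
    have "(\<lambda>i\<in>I. coord (?e (c - d)) i \<oplus>\<^bsub>A\<^esub> coord (?e d) i) = coord (?e c)"
      using coord.hom_mult[OF gT[OF cd] gT[OF diff(2)]]
      by (simp add: coefficient_module_simps frag_extend_diff)
    moreover have "(\<lambda>i\<in>I. h (coord (c - d)) i \<oplus>\<^bsub>A\<^esub> coord (?e d) i) = coord (?e c)"
      unfolding diff(3,4) using h.hom_mult[OF cd diff(2)] by (simp add: coefficient_module_simps)
    ultimately have eq: "(\<lambda>i\<in>I. coord (?e (c - d)) i \<oplus>\<^bsub>A\<^esub> coord (?e d) i)
        = (\<lambda>i\<in>I. h (coord (c - d)) i \<oplus>\<^bsub>A\<^esub> coord (?e d) i)" by (simp only:)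
    show ?case
      by (rule split[OF coord_closed[OF gT[OF cd]] coord_closed[OF gT[OF diff(2)]]
          h_closed[OF coord_closed[OF cd]] eq])
  next
    case (frag x a)
    then show ?case by (simp add: coord_g)
  qed
qed

lemma coordinates_base_change:
  "coordinates A (base_change R F A) I (\<lambda>C. the_elem (coord ` C))"
proof (rule cring.coordinates_cosets[OF alg.M_cring coord_group_hom coord_surj K_eq,
      where g = "\<lambda>a. frag_extend (\<lambda>(x, b). frag_of (x, a \<otimes>\<^bsub>A\<^esub> b))"])
  fix a assume a: "a \<in> carrier A"
  show "frag_extend (\<lambda>(x, b). frag_of (x, a \<otimes>\<^bsub>A\<^esub> b)) \<in> carrier T \<rightarrow> carrier T"
    using a by (intro funcsetI frag_extend_T T_frag) auto
  fix c assume c: "c \<in> carrier T"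
  show "coord (frag_extend (\<lambda>(x, b). frag_of (x, a \<otimes>\<^bsub>A\<^esub> b)) c) = (\<lambda>i\<in>I. a \<otimes>\<^bsub>A\<^esub> coord c i)"
  proof (rule coord_frag_extend[OF _ _ _ _ c, where h = "\<lambda>v. \<lambda>i\<in>I. a \<otimes>\<^bsub>A\<^esub> v i"])
    fix x b assume xb: "x \<in> carrier F" "b \<in> carrier A"
    then show "frag_of (x, a \<otimes>\<^bsub>A\<^esub> b) \<in> carrier T" using a by (intro T_frag) auto
    have "x i \<odot>\<^bsub>A\<^esub> (a \<otimes>\<^bsub>A\<^esub> b) = a \<otimes>\<^bsub>A\<^esub> (x i \<odot>\<^bsub>A\<^esub> b)" if "i \<in> I" for i
      using F.coord_closed[OF xb(1) that] xb a alg.smult_assoc2[of "x i" b a]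
      by (simp add: alg.m_comm[of a])
    then show "coord (frag_of (x, a \<otimes>\<^bsub>A\<^esub> b)) = (\<lambda>i\<in>I. a \<otimes>\<^bsub>A\<^esub> coord (frag_of (x, b)) i)"
      using xb a by (simp add: coord_frag cong: restrict_cong)
  next
    fix u v assume "u \<in> I \<rightarrow>\<^sub>E carrier A" "v \<in> I \<rightarrow>\<^sub>E carrier A"
    then have "u i \<in> carrier A" "v i \<in> carrier A" if "i \<in> I" for i using that by auto
    then show "(\<lambda>i\<in>I. a \<otimes>\<^bsub>A\<^esub> (\<lambda>i\<in>I. u i \<oplus>\<^bsub>A\<^esub> v i) i)
        = (\<lambda>i\<in>I. (\<lambda>i\<in>I. a \<otimes>\<^bsub>A\<^esub> u i) i \<oplus>\<^bsub>A\<^esub> (\<lambda>i\<in>I. a \<otimes>\<^bsub>A\<^esub> v i) i)"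
      using a by (simp add: alg.r_distr cong: restrict_cong)
  next
    fix v assume "v \<in> I \<rightarrow>\<^sub>E carrier A"
    then show "(\<lambda>i\<in>I. a \<otimes>\<^bsub>A\<^esub> v i) \<in> I \<rightarrow>\<^sub>E carrier A" using a by auto
  qed
qed (simp_all add: base_change_def carrier_FactGroup FactGroup_def)

text \<open>Meant for \<open>t\<close> the action of a group element on the free module and
  \<open>h\<close> the monomial action over \<open>A\<close>.\<close>

lemma base_change_map:
  assumes C: "C \<in> carrier (base_change R F A)"
    and t: "\<And>x. x \<in> carrier F \<Longrightarrow> t x \<in> carrier F"
    and coord_t: "\<And>x b. x \<in> carrier F \<Longrightarrow> b \<in> carrier A \<Longrightarrow> coord (frag_of (t x, b)) = h (coord (frag_of (x, b)))"
    and h: "\<And>u v. u \<in> I \<rightarrow>\<^sub>E carrier A \<Longrightarrow> v \<in> I \<rightarrow>\<^sub>E carrier A \<Longrightarrow>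
        h (\<lambda>i\<in>I. u i \<oplus>\<^bsub>A\<^esub> v i) = (\<lambda>i\<in>I. h u i \<oplus>\<^bsub>A\<^esub> h v i)"
    and h_closed: "\<And>v. v \<in> I \<rightarrow>\<^sub>E carrier A \<Longrightarrow> h v \<in> I \<rightarrow>\<^sub>E carrier A"
  defines "D \<equiv> K <#>\<^bsub>T\<^esub> (frag_extend (\<lambda>(x, b). frag_of (t x, b)) ` C)"
  shows "D \<in> carrier (base_change R F A)" "the_elem (coord ` D) = h (the_elem (coord ` C))"
proof -
  have C': "C \<in> rcosets\<^bsub>T\<^esub> (kernel T (add_monoid (free_module A I)) coord)"
    using C by (simp add: base_change_def FactGroup_def kernel_eq_K)
  have surj: "coord ` carrier T = carrier (add_monoid (free_module A I))"
    by (simp add: coord_surj coefficient_module_simps)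
  have tT: "frag_extend (\<lambda>(x, b). frag_of (t x, b)) \<in> carrier T \<rightarrow> carrier T"
    by (intro funcsetI frag_extend_T T_frag t)
  have coord_ext: "coord (frag_extend (\<lambda>(x, b). frag_of (t x, b)) c) = h (coord c)" if "c \<in> carrier T" for c
  proof (rule coord_frag_extend[where g = "\<lambda>x b. frag_of (t x, b)" and h = h])
    show "frag_of (t x, b) \<in> carrier T" if "x \<in> carrier F" "b \<in> carrier A" for x b
      using T_frag[OF t] that .
  qed (fact coord_t h h_closed that)+
  note map = coord.image_fiber_map[OF surj C' tT, where g = h, OF coord_ext, unfolded kernel_eq_K, folded D_def]
  show "D \<in> carrier (base_change R F A)" using map(1) by (simp add: base_change_def FactGroup_def)
  show "the_elem (coord ` D) = h (the_elem (coord ` C))" by (rule map(2))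
qed

end

section \<open>The deformed affine realization\<close>

lemma laurent_ring_simps [simp]:
  "carrier laurent_ring = UNIV" "p \<otimes>\<^bsub>laurent_ring\<^esub> q = p * q" "\<one>\<^bsub>laurent_ring\<^esub> = 1"
  "p \<oplus>\<^bsub>laurent_ring\<^esub> q = p + q" "\<zero>\<^bsub>laurent_ring\<^esub> = 0"
  by (simp_all add: laurent_ring_def ring_of_type_algebra_def)

lemma domain_laurent_ring: "domain laurent_ring"
proof (intro domain.intro domain_axioms.intro)
  show "cring laurent_ring" unfolding laurent_ring_def by (rule cring_from_type_algebra)
qed auto

abbreviation zeta_power :: "int \<Rightarrow> laurent" where
  "zeta_power k \<equiv> Poly_Mapping.single k 1"

lemma zeta_power_add: "zeta_power (k + l) = zeta_power k * zeta_power l"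
  by (simp add: mult_single)

lemma zeta_power_eq_1:
  assumes "zeta_power k = 1"
  shows "k = 0"
proof -
  have "Poly_Mapping.keys (zeta_power k) = Poly_Mapping.keys (zeta_power 0)"
    using assms by simp
  then show ?thesis by (simp only: keys_single) simp
qed

lemma affine_monomial_laurent: "n > 0 \<Longrightarrow> affine_monomial laurent_ring n zeta_power"
  by (intro affine_monomial.intro affine_monomial_axioms.intro domain_laurent_ring)
    (simp_all add: mult_single zeta_power_eq_1)

text \<open>This is the passage from \<open>y_k\<close> to \<open>y_(f k)\<close>, with the powers
  of zeta of exponents \<open>k\<close> and \<open>f k\<close> gathered in the coefficient.\<close>

lemma (in affine_monomial) perm_action_basis:
  assumes f: "affine_perm n f" and k: "k \<in> Omega n"
  shows "perm_action f (\<lambda>i\<in>Omega n. if i = k then \<one> else \<zero>)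
    = (\<lambda>i\<in>Omega n. z (f k - k) \<otimes> (if i = f k mod int n then \<one> else \<zero>))"
  unfolding perm_action_def
proof (rule restrict_ext)
  fix i assume i: "i \<in> Omega n"
  define y where "y = inv_into UNIV f i"
  have fy: "f y = i" using affine_perm_bij[OF f] by (simp add: y_def bij_is_surj surj_f_inv_f)
  have i_mod: "i mod int n = i" and k_mod: "k mod int n = k" using i k n by (simp_all add: Omega_eq)
  have "y mod int n = k \<longleftrightarrow> int n dvd y - k" using k_mod by (simp add: mod_eq_dvd_iff[symmetric])
  also have "\<dots> \<longleftrightarrow> int n dvd f y - f k" using affine_perm_dvd_iff[OF f] by simp
  also have "\<dots> \<longleftrightarrow> i = f k mod int n" using i_mod fy by (simp add: mod_eq_dvd_iff[symmetric])
  finally have iff: "y mod int n = k \<longleftrightarrow> i = f k mod int n" .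
  have "i - y = f k - k" if "y mod int n = k"
  proof -
    have "y = k + (y div int n) * int n" using that by auto
    then show ?thesis using affine_perm_shift[OF f, of k "y div int n"] fy by simp
  qed
  then show "z (i - inv_into UNIV f i) \<otimes> (\<lambda>i\<in>Omega n. if i = k then \<one> else \<zero>) (inv_into UNIV f i mod int n)
      = z (f k - k) \<otimes> (if i = f k mod int n then \<one> else \<zero>)"
    using iff by (simp add: y_def)
qed

lemma (in coordinates) linear_maps_eqI:
  assumes fin: "finite J" and one: "\<one> \<noteq> \<zero>"
    and f: "\<And>x. x \<in> carrier M \<Longrightarrow> f x \<in> carrier M"
      "\<And>x y. x \<in> carrier M \<Longrightarrow> y \<in> carrier M \<Longrightarrow> f (x \<oplus>\<^bsub>M\<^esub> y) = f x \<oplus>\<^bsub>M\<^esub> f y"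
      "\<And>a x. a \<in> carrier A \<Longrightarrow> x \<in> carrier M \<Longrightarrow> f (a \<odot>\<^bsub>M\<^esub> x) = a \<odot>\<^bsub>M\<^esub> f x"
    and g: "\<And>x. x \<in> carrier M \<Longrightarrow> g x \<in> carrier M"
      "\<And>x y. x \<in> carrier M \<Longrightarrow> y \<in> carrier M \<Longrightarrow> g (x \<oplus>\<^bsub>M\<^esub> y) = g x \<oplus>\<^bsub>M\<^esub> g y"
      "\<And>a x. a \<in> carrier A \<Longrightarrow> x \<in> carrier M \<Longrightarrow> g (a \<odot>\<^bsub>M\<^esub> x) = a \<odot>\<^bsub>M\<^esub> g x"
    and eq: "\<And>j. j \<in> J \<Longrightarrow> f (unit_vector j) = g (unit_vector j)"
    and x: "x \<in> carrier M"
  shows "f x = g x"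
proof -
  obtain c where c: "c \<in> unit_vector ` J \<rightarrow>\<^sub>E carrier A"
    and x_eq: "x = (\<Oplus>\<^bsub>M\<^esub>b\<in>unit_vector ` J. c b \<odot>\<^bsub>M\<^esub> b)"
    using unit_vectors_basis[OF fin one] x unfolding is_basis_def by blast
  have zero: "h \<zero>\<^bsub>M\<^esub> = \<zero>\<^bsub>M\<^esub>"
    if "\<And>a x. a \<in> carrier A \<Longrightarrow> x \<in> carrier M \<Longrightarrow> h (a \<odot>\<^bsub>M\<^esub> x) = a \<odot>\<^bsub>M\<^esub> h x"
      "h \<zero>\<^bsub>M\<^esub> \<in> carrier M" for h
    using that(1)[of \<zero> "\<zero>\<^bsub>M\<^esub>"] that(2) by simp
  have "f (\<Oplus>\<^bsub>M\<^esub>b\<in>B. c b \<odot>\<^bsub>M\<^esub> b) = g (\<Oplus>\<^bsub>M\<^esub>b\<in>B. c b \<odot>\<^bsub>M\<^esub> b)"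
    if "finite B" "B \<subseteq> unit_vector ` J" for B
    using that
  proof (induction B)
    case empty
    then show ?case using zero[of f] zero[of g] f g by simp
  next
    case (insert b B)
    have "b \<in> unit_vector ` J" using insert by simp
    then obtain j where j: "j \<in> J" "b = unit_vector j" by blast
    have cb: "c b \<in> carrier A" "b \<in> carrier M" using c insert j by auto
    have B: "(\<lambda>b. c b \<odot>\<^bsub>M\<^esub> b) \<in> B \<rightarrow> carrier M"
    proof
      fix x assume "x \<in> B"
      then have x: "x \<in> unit_vector ` J" using insert by blast
      then have "x \<in> carrier M" by auto
      then show "c x \<odot>\<^bsub>M\<^esub> x \<in> carrier M" using PiE_mem[OF c x] by simp
    qed
    have sum: "(\<Oplus>\<^bsub>M\<^esub>b\<in>B. c b \<odot>\<^bsub>M\<^esub> b) \<in> carrier M" using B by (rule M.finsum_closed)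
    have "(\<Oplus>\<^bsub>M\<^esub>b\<in>insert b B. c b \<odot>\<^bsub>M\<^esub> b) = c b \<odot>\<^bsub>M\<^esub> b \<oplus>\<^bsub>M\<^esub> (\<Oplus>\<^bsub>M\<^esub>b\<in>B. c b \<odot>\<^bsub>M\<^esub> b)"
      using insert(1,2) B cb by (intro M.finsum_insert) auto
    then show ?case
      using insert.IH insert.prems cb sum f(2,3) g(2,3) eq[OF j(1)] j(2) by simp
  qed
  then show ?thesis unfolding x_eq using fin by simp
qed

section \<open>The action on the integral realization\<close>

context affine_A_system
begin

text \<open>Gives the uniqueness behind the description in \<open>Lambda_action\<close>: values on
  generators and basis vectors extend to vectors by linearity and to words by the homomorphism
  property; extensionality settles all other arguments.\<close>

lemma representation_eqI:
  assumes "coordinates A M J \<phi>" and fin: "finite J" and one: "\<one>\<^bsub>A\<^esub> \<noteq> \<zero>\<^bsub>A\<^esub>"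
    and \<rho>: "linear_representation W A M \<rho>" "\<rho> \<in> extensional (carrier W)"
    and \<sigma>: "linear_representation W A M \<sigma>" "\<sigma> \<in> extensional (carrier W)"
    and gens: "\<And>i j. i \<in> Omega n \<Longrightarrow> j \<in> J \<Longrightarrow>
      \<rho> (s i) (coordinates.unit_vector A M J \<phi> j) = \<sigma> (s i) (coordinates.unit_vector A M J \<phi> j)"
  shows "\<rho> = \<sigma>"
proof -
  interpret coordinates A M J \<phi> by fact
  interpret r: group_action W "carrier M" \<rho> using \<rho> by (simp add: linear_representation_def)
  interpret s: group_action W "carrier M" \<sigma> using \<sigma> by (simp add: linear_representation_def)
  have linear: "\<tau> w x \<in> carrier M" "\<tau> w (x \<oplus>\<^bsub>M\<^esub> y) = \<tau> w x \<oplus>\<^bsub>M\<^esub> \<tau> w y" "\<tau> w (a \<odot>\<^bsub>M\<^esub> x) = a \<odot>\<^bsub>M\<^esub> \<tau> w x"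
    if \<tau>: "linear_representation W A M \<tau>"
      and w: "w \<in> carrier W" "x \<in> carrier M" "y \<in> carrier M" "a \<in> carrier A" for \<tau> w x y a
  proof -
    have "group_action W (carrier M) \<tau>" using \<tau> by (simp add: linear_representation_def)
    then show "\<tau> w x \<in> carrier M" by (rule group_action.element_image[OF _ w(1,2) HOL.refl])
  qed (use \<tau> w in \<open>simp_all add: linear_representation_def\<close>)
  have gen: "\<rho> (s i) x = \<sigma> (s i) x" if i: "i \<in> Omega n" and x: "x \<in> carrier M" for i x
  proof (rule linear_maps_eqI[OF fin one _ _ _ _ _ _ _ x, of "\<rho> (s i)" "\<sigma> (s i)"])
    fix y u assume y: "y \<in> carrier M" and u: "u \<in> carrier M"
    show "\<rho> (s i) y \<in> carrier M" "\<sigma> (s i) y \<in> carrier M"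
      "\<rho> (s i) (y \<oplus>\<^bsub>M\<^esub> u) = \<rho> (s i) y \<oplus>\<^bsub>M\<^esub> \<rho> (s i) u"
      "\<sigma> (s i) (y \<oplus>\<^bsub>M\<^esub> u) = \<sigma> (s i) y \<oplus>\<^bsub>M\<^esub> \<sigma> (s i) u"
      using linear[OF \<rho>(1) gen_closed[OF i] y u R.zero_closed]
        linear[OF \<sigma>(1) gen_closed[OF i] y u R.zero_closed] by blast+
  next
    fix a y assume a: "a \<in> carrier A" and y: "y \<in> carrier M"
    show "\<rho> (s i) (a \<odot>\<^bsub>M\<^esub> y) = a \<odot>\<^bsub>M\<^esub> \<rho> (s i) y" "\<sigma> (s i) (a \<odot>\<^bsub>M\<^esub> y) = a \<odot>\<^bsub>M\<^esub> \<sigma> (s i) y"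
      using linear(3)[OF \<rho>(1) gen_closed[OF i] y y a] linear(3)[OF \<sigma>(1) gen_closed[OF i] y y a] by blast+
  qed (rule gens[OF i])
  have words: "\<rho> (value_of u) x = \<sigma> (value_of u) x" if u: "u \<in> lists (Omega n)" and x: "x \<in> carrier M" for u x
    using u
  proof (induction u)
    case Nil
    then show ?case using r.id_eq_one s.id_eq_one by (metis value_simps(1))
  next
    case (Cons i u)
    have iu: "s i \<in> carrier W" "value_of u \<in> carrier W" using Cons by auto
    have "\<rho> (value_of (i # u)) x = \<rho> (s i) (\<rho> (value_of u) x)"
      using r.composition_rule[OF x iu] by simp
    also have "\<dots> = \<sigma> (s i) (\<sigma> (value_of u) x)"
      using Cons gen[OF _ s.element_image[OF iu(2) x HOL.refl]] by simp
    also have "\<dots> = \<sigma> (value_of (i # u)) x"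
      using s.composition_rule[OF x iu] by simp
    finally show ?case .
  qed
  show ?thesis
  proof (rule extensionalityI[OF \<rho>(2) \<sigma>(2)])
    fix w assume w: "w \<in> carrier W"
    then obtain u where u: "u \<in> lists (Omega n)" "value_of u = w" by (rule value_surj)
    show "\<rho> w = \<sigma> w"
    proof (rule extensionalityI[of _ "carrier M"])
      show "\<rho> w \<in> extensional (carrier M)" using r.bij_prop0[OF w] by (simp add: Bij_def)
      show "\<sigma> w \<in> extensional (carrier M)" using s.bij_prop0[OF w] by (simp add: Bij_def)
    qed (use words[OF u(1)] u(2) in simp)
  qed
qed

lemma n_pos: "n > 0"
  using n by simp

lemma Lambda_coordinates: "coordinates laurent_ring (Lambda n) (Omega n) (\<lambda>v. v)"
  unfolding Lambda_def by (rule cring.coordinates_free_module[OF domain.axioms(1)[OF domain_laurent_ring]])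

interpretation L: affine_monomial laurent_ring n zeta_power
  by (rule affine_monomial_laurent[OF n_pos])

interpretation LC: coordinates laurent_ring "Lambda n" "Omega n" "\<lambda>v. v"
  by (rule Lambda_coordinates)

definition laurent_action :: "'g \<Rightarrow> (int \<Rightarrow> laurent) \<Rightarrow> int \<Rightarrow> laurent" where
  "laurent_action = (\<lambda>w\<in>carrier W. \<lambda>v\<in>carrier (Lambda n). L.perm_action (perm w) v)"

lemma carrier_Lambda: "carrier (Lambda n) = Omega n \<rightarrow>\<^sub>E carrier laurent_ring"
  by (simp add: Lambda_def free_module_def)

lemma laurent_rep: "affine_monomial_rep laurent_ring n zeta_power W s (Lambda n) (\<lambda>v. v) laurent_action"
proof (intro affine_monomial_rep.intro affine_monomial_rep_axioms.intro)
  fix w x assume "w \<in> carrier W" "x \<in> carrier (Lambda n)"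
  then show "laurent_action w x \<in> carrier (Lambda n)" "laurent_action w x = L.perm_action (perm w) x"
    using L.perm_action_closed[of x "perm w"] by (simp_all add: laurent_action_def carrier_Lambda)
qed (simp_all add: laurent_action_def L.affine_monomial_axioms affine_A_system_axioms Lambda_coordinates)

lemma x_basis_eq: "x_basis n j = LC.unit_vector j"
proof -
  have "(\<lambda>i\<in>Omega n. if i = j then \<one>\<^bsub>laurent_ring\<^esub> else \<zero>\<^bsub>laurent_ring\<^esub>)
      \<in> Omega n \<rightarrow>\<^sub>E carrier laurent_ring" by simp
  then show ?thesis unfolding x_basis_def LC.unit_vector_def by (rule LC.coord_of_coord[symmetric])
qed

lemma laurent_action_gen:
  assumes "i \<in> Omega n" "j \<in> Omega n"
  shows "laurent_action (s i) (x_basis n j)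
    = zeta_power (adjacent_swap n i j - j) \<odot>\<^bsub>Lambda n\<^esub> x_basis n (adjacent_swap n i j mod int n)"
proof -
  have "x_basis n j \<in> carrier (Lambda n)" unfolding x_basis_eq by (rule LC.unit_vector_closed)
  then have "laurent_action (s i) (x_basis n j) = L.perm_action (adjacent_swap n i) (x_basis n j)"
    using assms by (simp add: laurent_action_def)
  also have "\<dots> = (\<lambda>k\<in>Omega n. zeta_power (adjacent_swap n i j - j) \<otimes>\<^bsub>laurent_ring\<^esub>
      (if k = adjacent_swap n i j mod int n then \<one>\<^bsub>laurent_ring\<^esub> else \<zero>\<^bsub>laurent_ring\<^esub>))"
    unfolding x_basis_def by (rule L.perm_action_basis[OF affine_perm_adjacent_swap[OF n] assms(2)])
  also have "\<dots> = zeta_power (adjacent_swap n i j - j) \<odot>\<^bsub>Lambda n\<^esub> x_basis n (adjacent_swap n i j mod int n)"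
    unfolding Lambda_def free_module_def x_basis_def module.simps by (rule restrict_ext) simp
  finally show ?thesis .
qed

text \<open>At the wrap-around \<open>i = n - 1\<close> the successor is \<open>0\<close> and its
  image is \<open>-1\<close>, not \<open>i\<close>. The displacement is \<open>-1\<close> in every
  case, which produces \<open>zeta_inv\<close>, and reduction modulo \<open>n\<close> returns
  \<open>i\<close>.\<close>

lemma adjacent_swap_Omega:
  assumes i: "i \<in> Omega n" and j: "j \<in> Omega n"
  shows "adjacent_swap n i (succ_mod n i) = succ_mod n i - 1"
    and "j \<noteq> i \<Longrightarrow> j \<noteq> succ_mod n i \<Longrightarrow> adjacent_swap n i j = j"
proof -
  define q where "q = (i + 1) div int n"
  have succ: "succ_mod n i = (i + 1) + (- q) * int n"
    unfolding succ_mod_eq q_def using minus_div_mult_eq_mod[of "i + 1" "int n"] by simp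
  show "adjacent_swap n i (succ_mod n i) = succ_mod n i - 1"
    unfolding succ affine_perm_shift[OF affine_perm_adjacent_swap[OF n]] adjacent_swap_right[OF n] by simp
  assume "j \<noteq> i" "j \<noteq> succ_mod n i"
  then have "\<not> int n dvd j - i" "\<not> int n dvd i + 1 - j"
    using eq_Omega_iff[OF n_pos j i] eq_succ_mod_iff[OF n_pos j, of i] by simp_all
  then show "adjacent_swap n i j = j"
    by (intro affine_swap_other) (simp_all add: dvd_diff_commute[of "int n" j "i + 1"])
qed

lemma succ_mod_Omega [simp]: "succ_mod n i \<in> Omega n"
  using n by (simp add: Omega_eq succ_mod_eq)

lemma Lambda_smult_one: "x \<in> carrier (Lambda n) \<Longrightarrow> zeta_power 0 \<odot>\<^bsub>Lambda n\<^esub> x = x"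
  using LC.smult_one by simp

lemma laurent_action_gens:
  assumes i: "i \<in> Omega n"
  shows "laurent_action (s i) (x_basis n i) = zeta \<odot>\<^bsub>Lambda n\<^esub> x_basis n (succ_mod n i)"
    and "laurent_action (s i) (x_basis n (succ_mod n i)) = zeta_inv \<odot>\<^bsub>Lambda n\<^esub> x_basis n i"
    and "\<And>j. j \<in> Omega n - {i, succ_mod n i} \<Longrightarrow> laurent_action (s i) (x_basis n j) = x_basis n j"
proof -
  show "laurent_action (s i) (x_basis n i) = zeta \<odot>\<^bsub>Lambda n\<^esub> x_basis n (succ_mod n i)"
    using laurent_action_gen[OF i i] by (simp add: zeta_def succ_mod_eq)
  have "(succ_mod n i - 1) mod int n = i"
    using i n by (simp add: succ_mod_eq Omega_eq mod_diff_left_eq)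
  then show "laurent_action (s i) (x_basis n (succ_mod n i)) = zeta_inv \<odot>\<^bsub>Lambda n\<^esub> x_basis n i"
    using laurent_action_gen[OF i succ_mod_Omega] adjacent_swap_Omega(1)[OF i i] by (simp add: zeta_inv_def)
  fix j assume j: "j \<in> Omega n - {i, succ_mod n i}"
  then have "adjacent_swap n i j = j" "j mod int n = j"
    using adjacent_swap_Omega(2)[OF i] n by (auto simp: Omega_eq)
  moreover have "x_basis n j \<in> carrier (Lambda n)" unfolding x_basis_eq by (rule LC.unit_vector_closed)
  ultimately show "laurent_action (s i) (x_basis n j) = x_basis n j"
    using laurent_action_gen[OF i, of j] j Lambda_smult_one by simp
qed

lemma Lambda_action_eq: "Lambda_action W n s = laurent_action"
  unfolding Lambda_action_def
proof (rule the_equality)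
  have ext: "laurent_action \<in> extensional (carrier W)" by (simp add: laurent_action_def)
  have lin: "linear_representation W laurent_ring (Lambda n) laurent_action"
    by (rule affine_monomial_rep.linear_rep[OF laurent_rep])
  show "linear_representation W laurent_ring (Lambda n) laurent_action \<and>
      laurent_action \<in> extensional (carrier W) \<and>
      (\<forall>i\<in>Omega n.
        laurent_action (s i) (x_basis n i) = zeta \<odot>\<^bsub>Lambda n\<^esub> x_basis n (succ_mod n i) \<and>
        laurent_action (s i) (x_basis n (succ_mod n i)) = zeta_inv \<odot>\<^bsub>Lambda n\<^esub> x_basis n i \<and>
        (\<forall>j\<in>Omega n - {i, succ_mod n i}. laurent_action (s i) (x_basis n j) = x_basis n j))"
    using ext lin laurent_action_gens by blast
  fix \<rho>
  assume \<rho>: "linear_representation W laurent_ring (Lambda n) \<rho> \<and> \<rho> \<in> extensional (carrier W) \<and>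
     (\<forall>i\<in>Omega n.
        \<rho> (s i) (x_basis n i) = zeta \<odot>\<^bsub>Lambda n\<^esub> x_basis n (succ_mod n i) \<and>
        \<rho> (s i) (x_basis n (succ_mod n i)) = zeta_inv \<odot>\<^bsub>Lambda n\<^esub> x_basis n i \<and>
        (\<forall>j\<in>Omega n - {i, succ_mod n i}. \<rho> (s i) (x_basis n j) = x_basis n j))"
  show "\<rho> = laurent_action"
  proof (rule representation_eqI[OF Lambda_coordinates _ _ _ _ lin ext])
    show "finite (Omega n)" using n by (simp add: Omega_eq)
    fix i j assume ij: "i \<in> Omega n" "j \<in> Omega n"
    have "\<rho> (s i) (x_basis n j) = laurent_action (s i) (x_basis n j)"
      using \<rho> ij laurent_action_gens[OF ij(1)]
      by (cases "j = i"; cases "j = succ_mod n i") auto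
    then show "\<rho> (s i) (LC.unit_vector j) = laurent_action (s i) (LC.unit_vector j)"
      unfolding x_basis_eq .
  qed (use \<rho> in simp_all)
qed

lemma reflection_faithful_Lambda:
  "reflection_faithful W (s ` Omega n) laurent_ring (Lambda n) (Lambda_action W n s)"
  unfolding Lambda_action_eq by (rule affine_monomial_rep.reflection_faithful[OF laurent_rep])

section \<open>The action after extension of scalars\<close>

lemma reflection_faithful_base_change:
  fixes A :: "(laurent, 'a, 'd) module_scheme"
  assumes alg: "algebra laurent_ring A" and dom: "domain A"
    and zeta: "\<And>k :: nat. k > 0 \<Longrightarrow> (zeta \<odot>\<^bsub>A\<^esub> \<one>\<^bsub>A\<^esub>) [^]\<^bsub>A\<^esub> k \<noteq> \<one>\<^bsub>A\<^esub>"
  shows "reflection_faithful W (s ` Omega n) A (base_change laurent_ring (Lambda n) A)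
    (base_change_action laurent_ring (Lambda n) A (Lambda_action W n s))"
proof -
  interpret alg: algebra laurent_ring A by (rule alg)
  interpret D: domain A by (rule dom)
  interpret B: free_base_change laurent_ring A "Omega n"
    by (intro free_base_change.intro free_base_change_axioms.intro alg) (use n in \<open>simp add: Omega_eq\<close>)
  define z where "z k = zeta_power k \<odot>\<^bsub>A\<^esub> \<one>\<^bsub>A\<^esub>" for k
  have z_closed: "z k \<in> carrier A" for k by (simp add: z_def)
  have z_mult: "z k \<otimes>\<^bsub>A\<^esub> y = zeta_power k \<odot>\<^bsub>A\<^esub> y" if "y \<in> carrier A" for k y
    using alg.smult_assoc2[of "zeta_power k" "\<one>\<^bsub>A\<^esub>" y] that by (simp add: z_def)
  have z_add: "z (k + l) = z k \<otimes>\<^bsub>A\<^esub> z l" for k l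
    using alg.smult_assoc1[of "zeta_power k" "zeta_power l" "\<one>\<^bsub>A\<^esub>"] z_mult[OF z_closed, of k l]
    by (simp add: z_def zeta_power_add)
  have z_0: "z 0 = \<one>\<^bsub>A\<^esub>" using alg.smult_one[of "\<one>\<^bsub>A\<^esub>"] by (simp add: z_def)
  have z_pow: "z (int k) = (zeta \<odot>\<^bsub>A\<^esub> \<one>\<^bsub>A\<^esub>) [^]\<^bsub>A\<^esub> k" for k
  proof (induction k)
    case (Suc k)
    have "z (int (Suc k)) = z (int k) \<otimes>\<^bsub>A\<^esub> z 1" using z_add[of "int k" 1] by (simp add: add.commute)
    then show ?case using Suc by (simp add: z_def zeta_def)
  qed (simp add: z_0)
  have z_inj: "k = 0" if "z k = \<one>\<^bsub>A\<^esub>" for k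
  proof (rule ccontr)
    assume "k \<noteq> 0"
    \<comment> \<open>The hypothesis speaks of positive exponents; passing to the inverse reduces
      negative ones to them.\<close>
    have "z (- k) = \<one>\<^bsub>A\<^esub>" using z_add[of "- k" k] that z_0 z_closed by simp
    then have "z (int (nat \<bar>k\<bar>)) = \<one>\<^bsub>A\<^esub>" using that by (simp add: abs_if)
    then show False using zeta[of "nat \<bar>k\<bar>"] \<open>k \<noteq> 0\<close> unfolding z_pow by simp
  qed
  have mono: "affine_monomial A n z"
    by (intro affine_monomial.intro affine_monomial_axioms.intro dom n_pos z_closed z_0 z_add z_inj)
  interpret Z: affine_monomial A n z by (rule mono)
  let ?M = "base_change laurent_ring (Lambda n) A"
  let ?\<rho> = "base_change_action laurent_ring (Lambda n) A laurent_action"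
  \<comment> \<open>The powers of zeta that \<open>w\<close> produces in the first factor become
    factors \<open>z\<close> in \<open>A\<close>, so the same monomial formula holds over
    \<open>A\<close>.\<close>
  have coord_action: "B.coord (frag_of (laurent_action w x, b)) = Z.perm_action (perm w) (B.coord (frag_of (x, b)))"
    if w: "w \<in> carrier W" and x: "x \<in> carrier B.F" and b: "b \<in> carrier A" for w x b
  proof -
    have xL: "x \<in> carrier (Lambda n)" using x by (simp add: Lambda_def)
    have act: "laurent_action w x = L.perm_action (perm w) x" using w xL by (simp add: laurent_action_def)
    have "laurent_action w x \<in> carrier B.F"
      using affine_monomial_rep.\<rho>_closed[OF laurent_rep w xL] by (simp add: Lambda_def)
    then have "B.coord (frag_of (laurent_action w x, b)) = (\<lambda>i\<in>Omega n. laurent_action w x i \<odot>\<^bsub>A\<^esub> b)"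
      using b by (rule B.coord_frag)
    also have "\<dots> = Z.perm_action (perm w) (\<lambda>i\<in>Omega n. x i \<odot>\<^bsub>A\<^esub> b)"
      unfolding Z.perm_action_def
    proof (rule restrict_ext)
      fix i assume i: "i \<in> Omega n"
      let ?y = "inv_into UNIV (perm w) i"
      have "laurent_action w x i \<odot>\<^bsub>A\<^esub> b = zeta_power (i - ?y) \<odot>\<^bsub>A\<^esub> (x (?y mod int n) \<odot>\<^bsub>A\<^esub> b)"
        using i b alg.smult_assoc1[of "zeta_power (i - ?y)" "x (?y mod int n)" b]
        by (simp add: act L.perm_action_def)
      also have "\<dots> = z (i - ?y) \<otimes>\<^bsub>A\<^esub> (x (?y mod int n) \<odot>\<^bsub>A\<^esub> b)"
        using b by (simp add: z_mult)
      finally show "laurent_action w x i \<odot>\<^bsub>A\<^esub> b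
          = z (i - ?y) \<otimes>\<^bsub>A\<^esub> (\<lambda>i\<in>Omega n. x i \<odot>\<^bsub>A\<^esub> b) (?y mod int n)"
        by simp
    qed
    also have "(\<lambda>i\<in>Omega n. x i \<odot>\<^bsub>A\<^esub> b) = B.coord (frag_of (x, b))"
      using B.coord_frag[OF x b] by simp
    finally show ?thesis .
  qed
  have perm_action_add: "Z.perm_action f (\<lambda>i\<in>Omega n. u i \<oplus>\<^bsub>A\<^esub> v i)
      = (\<lambda>i\<in>Omega n. Z.perm_action f u i \<oplus>\<^bsub>A\<^esub> Z.perm_action f v i)"
    if "u \<in> Z.vectors" "v \<in> Z.vectors" for f u v
    unfolding Z.perm_action_def
    using that by (intro restrict_ext) (simp add: alg.r_distr)
  have action: "?\<rho> w C \<in> carrier ?M"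
    "the_elem (B.coord ` ?\<rho> w C) = Z.perm_action (perm w) (the_elem (B.coord ` C))"
    if w: "w \<in> carrier W" and C: "C \<in> carrier ?M" for w C
  proof -
    have C': "C \<in> carrier (base_change laurent_ring B.F A)" using C by (simp add: Lambda_def)
    have closed: "laurent_action w x \<in> carrier B.F" if "x \<in> carrier B.F" for x
      using affine_monomial_rep.\<rho>_closed[OF laurent_rep w, of x] that by (simp add: Lambda_def)
    have "?\<rho> w C = B.K <#>\<^bsub>B.T\<^esub> (frag_extend (\<lambda>(x, b). frag_of (laurent_action w x, b)) ` C)"
      using C by (simp add: base_change_action_def Lambda_def)
    moreover have "B.K <#>\<^bsub>B.T\<^esub> (frag_extend (\<lambda>(x, b). frag_of (laurent_action w x, b)) ` C)
        \<in> carrier (base_change laurent_ring B.F A)"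
      by (rule B.base_change_map(1)[where t = "laurent_action w" and h = "Z.perm_action (perm w)", OF C'])
        (fact closed coord_action[OF w] perm_action_add Z.perm_action_closed)+
    moreover have "the_elem (B.coord ` (B.K <#>\<^bsub>B.T\<^esub> (frag_extend (\<lambda>(x, b). frag_of (laurent_action w x, b)) ` C)))
        = Z.perm_action (perm w) (the_elem (B.coord ` C))"
      by (rule B.base_change_map(2)[where t = "laurent_action w" and h = "Z.perm_action (perm w)", OF C'])
        (fact closed coord_action[OF w] perm_action_add Z.perm_action_closed)+
    ultimately show "?\<rho> w C \<in> carrier ?M"
      "the_elem (B.coord ` ?\<rho> w C) = Z.perm_action (perm w) (the_elem (B.coord ` C))"
      by (simp_all only: Lambda_def)
  qed
  have "affine_monomial_rep A n z W s ?M (\<lambda>C. the_elem (B.coord ` C)) ?\<rho>"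
  proof (intro affine_monomial_rep.intro affine_monomial_rep_axioms.intro mono affine_A_system_axioms)
    show "coordinates A ?M (Omega n) (\<lambda>C. the_elem (B.coord ` C))"
      using B.coordinates_base_change by (simp add: Lambda_def)
    show "?\<rho> w \<in> extensional (carrier ?M)" for w by (simp add: base_change_action_def)
  qed (fact action)+
  then show ?thesis
    unfolding Lambda_action_eq by (rule affine_monomial_rep.reflection_faithful)
qed

end

theorem theorem3p49:
  fixes n :: nat and W :: "('g, 'x) monoid_scheme" and s :: "int \<Rightarrow> 'g"
  assumes "n \<ge> 3"
    and "coxeter_system W (Omega n) (affine_A_matrix n) s"
  shows "reflection_faithful W (s ` Omega n) laurent_ring (Lambda n) (Lambda_action W n s) \<and>
    (\<forall>A :: (laurent, 'a, 'c) module_scheme.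
       algebra laurent_ring A \<and> domain A \<and>
       (\<forall>k::nat. k > 0 \<longrightarrow> (zeta \<odot>\<^bsub>A\<^esub> \<one>\<^bsub>A\<^esub>) [^]\<^bsub>A\<^esub> k \<noteq> \<one>\<^bsub>A\<^esub>) \<longrightarrow>
       reflection_faithful W (s ` Omega n) A
         (base_change laurent_ring (Lambda n) A)
         (base_change_action laurent_ring (Lambda n) A (Lambda_action W n s)))"
proof -
  interpret affine_A_system n W s using assms by unfold_locales
  show ?thesis
  proof (intro conjI allI impI)
    fix A :: "(laurent, 'a, 'c) module_scheme"
    assume "algebra laurent_ring A \<and> domain A \<and>
      (\<forall>k::nat. k > 0 \<longrightarrow> (zeta \<odot>\<^bsub>A\<^esub> \<one>\<^bsub>A\<^esub>) [^]\<^bsub>A\<^esub> k \<noteq> \<one>\<^bsub>A\<^esub>)"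
    then show "reflection_faithful W (s ` Omega n) A (base_change laurent_ring (Lambda n) A)
        (base_change_action laurent_ring (Lambda n) A (Lambda_action W n s))"
      by (intro reflection_faithful_base_change) simp_all
  qed (rule reflection_faithful_Lambda)
qed

end
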